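(* Let $m,n\in\mathbb{N}$ and let $S\subseteq\mathbb{F}[X]^m$ be an infinite set. Let $\psi:\mathbb{F}[X]^m\to\{k^r:r\in\mathbb{Z}\}$ be such that $\psi(\mathbf{q})$ depends only on $|\mathbf{q}|_\infty$, is a decreasing function of $|\mathbf{q}|_\infty$, and such that the order at infinity $\lambda(\psi)$ exists. Then: (1) If $n\lambda(\psi)<v(S)$, then $\mathcal{W}_S(m,n;\psi)$ is full with respect to the Haar measure on $\mathrm{Mat}_{m\times n}(\mathbb{F}((X^{-1})))$, i.e. its complement has Haar measure zero. (2) If $n\lambda(\psi)\ge v(S)$, then $$\dim_H\mathcal{W}_S(m,n;\psi)=n(m-1)+\frac{n+v(S)}{1+\lambda(\psi)},$$ where $\dim_H$ denotes Hausdorff dimension.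
   Context: $\mathbb{F}$ is a finite field with $k=p^l$ elements; $\mathbb{F}[X]$ is the polynomial ring, $\mathbb{F}((X^{-1}))=\{\sum_{i=n}^\infty a_iX^{-i}: n\in\mathbb{Z}, a_i\in\mathbb{F}\}$ the field of formal Laurent series. The absolute value is $|0|=0$ and $|\sum_{i\ge -n} a_iX^{-i}|=k^{n}$ if $a_{-n}\neq 0$ (i.e. $k^{\text{degree}}$). On $\mathbb{F}((X^{-1}))^d$ use $|\mathbf{x}|_\infty=\max_i|x_i|$, and identify $\mathrm{Mat}_{m\times n}(\mathbb{F}((X^{-1})))$ with $\mathbb{F}((X^{-1}))^{mn}$ with this norm. For $\mathbf{v}\in\mathbb{F}((X^{-1}))^n$, $\|\mathbf{v}\|$ denotes the $|\cdot|_\infty$-distance from $\mathbf{v}$ to the nearest element of $\mathbb{F}[X]^n$. Haar measure $\mu$ on $\mathbb{F}((X^{-1}))^d$ is normalised so that the unit cube $U=\{\mathbf{x}:|\mathbf{x}|_\infty<1\}$ has measure 1. For $\psi$ defined on $\mathbb{F}[X]^m$ and $S\subseteq\mathbb{F}[X]^m$, $$\mathcal{W}_S(m,n;\psi)=\{A\in\mathrm{Mat}_{m\times n}(\mathbb{F}((X^{-1}))):\|\mathbf{q}A\|<\psi(\mathbf{q})\text{ for infinitely many }\mathbf{q}\in S\},$$ where $\mathbf{q}A$ is the row vector–matrix product. The exponent of convergence is $v(S)=\inf\{v\in\mathbb{R}:\sum_{\mathbf{q}\in S}|\mathbf{q}|_\infty^{-v}<\infty\}$. The order at infinity is $\lambda(\psi)=\lim_{|\mathbf{q}|_\infty\to\infty,\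 \mathbf{q}\in S}\frac{-\log\psi(\mathbf{q})}{\log|\mathbf{q}|_\infty}$, when this limit exists. *)

theory Defs
  imports "HOL-Analysis.Analysis" "HOL-Computational_Algebra.Polynomial"
begin

text \<open>Formal Laurent series in X^(-1) over a finite field: a series is
represented by its coefficient function c, where c d is the coefficient of X^d;
only finitely many positive powers occur.  The field size is k = CARD('a).\<close>

definition laurent :: "(int \<Rightarrow> 'a::zero) set" where
  "laurent = {c. \<exists>N. \<forall>d>N. c d = 0}"

definition labs :: "(int \<Rightarrow> 'a::zero) \<Rightarrow> real" where
  "labs c = (if c = (\<lambda>_. 0) then 0
             else real CARD('a) powi (GREATEST d. c d \<noteq> 0))"

definition ls_of_poly :: "'a::zero poly \<Rightarrow> int \<Rightarrow> 'a" where
  "ls_of_poly p = (\<lambda>d. if 0 \<le> d then coeff p (nat d) else 0)"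

definition pabs :: "'a::zero poly \<Rightarrow> real" where
  "pabs p = (if p = 0 then 0 else real CARD('a) ^ degree p)"

definition polyvecs :: "nat \<Rightarrow> (nat \<Rightarrow> 'a::zero poly) set" where
  "polyvecs m = {q. \<forall>i\<ge>m. q i = 0}"

definition vnorm :: "nat \<Rightarrow> (nat \<Rightarrow> 'a::zero poly) \<Rightarrow> real" where
  "vnorm m q = Max ((\<lambda>i. pabs (q i)) ` {..<m})"

definition pmul :: "'a::comm_ring poly \<Rightarrow> (int \<Rightarrow> 'a) \<Rightarrow> int \<Rightarrow> 'a" where
  "pmul p c = (\<lambda>d. \<Sum>e\<le>degree p. coeff p e * c (d - int e))"

definition mat_space :: "nat \<Rightarrow> nat \<Rightarrow> (nat \<Rightarrow> nat \<Rightarrow> int \<Rightarrow> 'a::zero) set" where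
  "mat_space m n = {A. (\<forall>i<m. \<forall>j<n. A i j \<in> laurent) \<and>
                      (\<forall>i j. \<not> (i < m \<and> j < n) \<longrightarrow> A i j = (\<lambda>_. 0))}"

definition vecmat :: "nat \<Rightarrow> nat \<Rightarrow> (nat \<Rightarrow> 'a::comm_ring poly)
    \<Rightarrow> (nat \<Rightarrow> nat \<Rightarrow> int \<Rightarrow> 'a) \<Rightarrow> nat \<Rightarrow> int \<Rightarrow> 'a" where
  "vecmat m n q A = (\<lambda>j d. if j < n then (\<Sum>i<m. pmul (q i) (A i j) d) else 0)"

definition lsnorm :: "nat \<Rightarrow> (nat \<Rightarrow> int \<Rightarrow> 'a::zero) \<Rightarrow> real" where
  "lsnorm n v = Max ((\<lambda>j. labs (v j)) ` {..<n})"

definition vdist :: "nat \<Rightarrow> (nat \<Rightarrow> int \<Rightarrow> 'a::ab_group_add) \<Rightarrow> real" where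
  "vdist n v = Inf ((\<lambda>p. lsnorm n (\<lambda>j d. v j d - ls_of_poly (p j) d)) ` polyvecs n)"

definition matnorm :: "nat \<Rightarrow> nat \<Rightarrow> (nat \<Rightarrow> nat \<Rightarrow> int \<Rightarrow> 'a::zero) \<Rightarrow> real" where
  "matnorm m n A = Max {labs (A i j) | i j. i < m \<and> j < n}"

definition matdist :: "nat \<Rightarrow> nat \<Rightarrow> (nat \<Rightarrow> nat \<Rightarrow> int \<Rightarrow> 'a::ab_group_add)
    \<Rightarrow> (nat \<Rightarrow> nat \<Rightarrow> int \<Rightarrow> 'a) \<Rightarrow> real" where
  "matdist m n A B = matnorm m n (\<lambda>i j d. A i j d - B i j d)"

definition W_set :: "nat \<Rightarrow> nat \<Rightarrow> (nat \<Rightarrow> 'a::comm_ring poly) set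
    \<Rightarrow> ((nat \<Rightarrow> 'a poly) \<Rightarrow> real) \<Rightarrow> (nat \<Rightarrow> nat \<Rightarrow> int \<Rightarrow> 'a) set" where
  "W_set m n S \<psi> = {A \<in> mat_space m n.
       infinite {q \<in> S. vdist n (vecmat m n q A) < \<psi> q}}"

text \<open>Haar (outer) measure on Mat_{m x n}(F((X^-1))), normalised so that the unit
cube has measure 1: the open ball of radius k^r has measure k^(mnr), and the
outer measure is the infimum over countable covers by such balls.\<close>
definition haar_outer :: "nat \<Rightarrow> nat \<Rightarrow> (nat \<Rightarrow> nat \<Rightarrow> int \<Rightarrow> 'a::ab_group_add) set
    \<Rightarrow> ennreal" where
  "haar_outer m n E =
     (INF Cr \<in> {(C, r). (\<forall>i. C i \<in> mat_space m n) \<and>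
                 E \<subseteq> (\<Union>i. {A \<in> mat_space m n. matdist m n A (C i) < real CARD('a) powi r i})}.
        (\<Sum>i. ennreal (real CARD('a) powi (int (m * n) * snd Cr i))))"

definition mdiam :: "nat \<Rightarrow> nat \<Rightarrow> (nat \<Rightarrow> nat \<Rightarrow> int \<Rightarrow> 'a::ab_group_add) set \<Rightarrow> real" where
  "mdiam m n E = (if E = {} then 0 else Sup {matdist m n A B | A B. A \<in> E \<and> B \<in> E})"

definition hausdorff_pre :: "nat \<Rightarrow> nat \<Rightarrow> real \<Rightarrow> real
    \<Rightarrow> (nat \<Rightarrow> nat \<Rightarrow> int \<Rightarrow> 'a::ab_group_add) set \<Rightarrow> ennreal" where
  "hausdorff_pre m n s \<delta> E =
     (INF U \<in> {U. (\<forall>i. U i \<subseteq> mat_space m n \<and>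
                       (\<forall>A\<in>U i. \<forall>B\<in>U i. matdist m n A B \<le> \<delta>)) \<and> E \<subseteq> (\<Union>i. U i)}.
        (\<Sum>i. ennreal (mdiam m n (U i) powr s)))"

definition hausdorff :: "nat \<Rightarrow> nat \<Rightarrow> real
    \<Rightarrow> (nat \<Rightarrow> nat \<Rightarrow> int \<Rightarrow> 'a::ab_group_add) set \<Rightarrow> ennreal" where
  "hausdorff m n s E = (SUP \<delta>\<in>{0<..}. hausdorff_pre m n s \<delta> E)"

definition hdim :: "nat \<Rightarrow> nat \<Rightarrow> (nat \<Rightarrow> nat \<Rightarrow> int \<Rightarrow> 'a::ab_group_add) set \<Rightarrow> real" where
  "hdim m n E = Inf {s. 0 \<le> s \<and> hausdorff m n s E = 0}"

definition conv_exp :: "nat \<Rightarrow> (nat \<Rightarrow> 'a::zero poly) set \<Rightarrow> real" where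
  "conv_exp m S = Inf {v. (\<lambda>q. vnorm m q powr (- v)) summable_on S}"

definition order_at_infinity :: "nat \<Rightarrow> (nat \<Rightarrow> 'a::zero poly) set
    \<Rightarrow> ((nat \<Rightarrow> 'a poly) \<Rightarrow> real) \<Rightarrow> real \<Rightarrow> bool" where
  "order_at_infinity m S \<psi> l \<longleftrightarrow>
     (\<forall>\<epsilon>>0. \<exists>R. \<forall>q\<in>S. vnorm m q > R \<longrightarrow>
         \<bar>(- ln (\<psi> q)) / ln (vnorm m q) - l\<bar> < \<epsilon>)"

end

theory Submission
  imports Defs "HOL-Computational_Algebra.Polynomial_Factorial"
begin

text \<open>Whether \<open>\<parallel>q A\<parallel> < k^(-b)\<close> holds depends only on finitely many coefficients of the fractional part
of \<open>A\<close>, so measures of such sets are counts of solutions of linear systems over the finite field.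
For \<open>q\<close> and \<open>q'\<close> the correlation of the two events is governed by the number of relations
\<open>C q + C' q' = 0\<close> with \<open>deg C, deg C' \<le> b\<close>, and the divisor bound shows that this is small on average.
By the second moment method the \<open>q \<in> S\<close> of norm \<open>k^t\<close> therefore approximate almost every matrix with
exponent \<open>a\<close>, for infinitely many \<open>t\<close>, as long as \<open>n a < v(S)\<close>.  This is the full measure statement, and
it also drives the lower bound for the dimension: shrinking each of these neighbourhoods of planes from
exponent \<open>a\<close> to exponent \<open>\<lambda>\<close> and iterating gives a Cantor subset of \<open>W\<close> that no cover of small
content can exhaust.  The upper bound comes from the cover in the definition of \<open>W\<close>.\<close>

section \<open>Linear systems over a finite field\<close>

text \<open>With \<open>s = n (m - 1) + \<sigma>\<close>, the matrices of a unit ball that are near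
  one \<open>q\<close> of degree \<open>t\<close> to precision \<open>b\<close> fill
  \<open>k^(mnL - nb)\<close> balls of depth \<open>L = t + b\<close>, at cost
  \<open>k^(-sL)\<close> each: in total \<open>k^(nt - \<sigma> L)\<close>. For about
  \<open>k^(vt)\<close> vectors and \<open>b\<close> about \<open>\<lambda> t\<close> the sum
  converges once \<open>n + v < \<sigma> (1 + \<lambda>)\<close>; this is the origin of the formula.
  In the lower bound the critical scale is the last one, \<open>t + \<lambda> t\<close>, where the
  requirement is \<open>\<sigma> (1 + \<lambda>) < n + n a\<close>. As \<open>a\<close> may approach
  \<open>v/n\<close>, the thresholds meet; \<open>n \<lambda> \<ge> v\<close> allows
  \<open>a \<le> \<lambda>\<close> and keeps \<open>\<sigma>\<close> below \<open>n\<close>. The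
  obstacle is that \<open>S\<close> has no structure, so the events of different \<open>q\<close>
  can be strongly dependent. But \<open>C q + C' q' = 0\<close> forces \<open>C'\<close> to divide
  \<open>C\<close> times an entry of \<open>q\<close>, and divisors number only
  \<open>k^(o(t))\<close>. The strict inequality \<open>n a < v(S)\<close> absorbs this
  loss.\<close>

definition supp_on :: "'i set \<Rightarrow> ('i \<Rightarrow> 'a::zero) set" where
  "supp_on I = {f. \<forall>i. i \<notin> I \<longrightarrow> f i = 0}"

lemma supp_on_bij:
  "bij_betw (\<lambda>f. restrict f I) (supp_on I :: ('i \<Rightarrow> 'a::zero) set) (I \<rightarrow>\<^sub>E UNIV)"
  by (rule bij_betw_byWitness[where f' = "\<lambda>f i. if i \<in> I then f i else 0"])
     (auto simp: supp_on_def fun_eq_iff PiE_def extensional_def)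

lemma finite_supp_on: "finite I \<Longrightarrow> finite (supp_on I :: ('i \<Rightarrow> 'a::{zero,finite}) set)"
  using bij_betw_finite[OF supp_on_bij[of I, where 'a = 'a]] by (simp add: finite_PiE)

lemma card_supp_on:
  "finite I \<Longrightarrow> card (supp_on I :: ('i \<Rightarrow> 'a::{zero,finite}) set) = CARD('a) ^ card I"
  using bij_betw_same_card[OF supp_on_bij[of I, where 'a = 'a]] by (simp add: card_PiE)

lemma card_supp_on_prescribed:
  fixes g :: "'i \<Rightarrow> 'a::{zero,finite}"
  assumes "finite I" "K \<subseteq> I"
  shows "card {f \<in> supp_on I. \<forall>i\<in>K. f i = g i} = CARD('a) ^ card (I - K)"
proof -
  have "bij_betw (\<lambda>f i. if i \<in> K then 0 else f i)
          {f \<in> supp_on I. \<forall>i\<in>K. f i = g i} (supp_on (I - K))"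
    by (rule bij_betw_byWitness[where f' = "\<lambda>f i. if i \<in> K then g i else f i"])
       (use assms in \<open>auto simp: supp_on_def fun_eq_iff\<close>)
  from bij_betw_same_card[OF this] show ?thesis
    using assms by (simp add: card_supp_on)
qed

lemma card_field_ge_2: "CARD('a::{field,finite}) \<ge> 2"
proof -
  have "card {0, 1::'a} \<le> CARD('a)" by (rule card_mono) auto
  then show ?thesis by simp
qed

text \<open>The coordinate \<open>y j0\<close> is determined by the others, and these are free.
  Multiplying by the field size keeps subtraction out of the exponent.\<close>

lemma card_functional_kernel:
  fixes f :: "'j \<Rightarrow> 'a::{field,finite}"
  assumes J: "finite J" "j0 \<in> J" "f j0 \<noteq> 0"
  shows "CARD('a) * card {y \<in> supp_on J. (\<Sum>j\<in>J. f j * y j) = 0} = CARD('a) ^ card J"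
proof -
  let ?A = "{y \<in> supp_on J. (\<Sum>j\<in>J. f j * y j) = 0}"
  define s where "s z = - (\<Sum>j\<in>J - {j0}. f j * z j) / f j0" for z
  have sumJ: "(\<Sum>j\<in>J. f j * y j) = f j0 * y j0 + (\<Sum>j\<in>J - {j0}. f j * y j)" for y
    using J by (auto intro: sum.remove)
  have s_cong: "s (z(j0 := c)) = s z" for z c
    unfolding s_def by (intro arg_cong2[where f = "(/)"] arg_cong[where f = uminus] sum.cong) auto
  have "bij_betw (\<lambda>y. y(j0 := 0)) ?A (supp_on (J - {j0}))"
  proof (rule bij_betw_byWitness[where f' = "\<lambda>z. z(j0 := s z)"])
    show "\<forall>a\<in>?A. (a(j0 := 0))(j0 := s (a(j0 := 0))) = a"
    proof
      fix y assume "y \<in> ?A"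
      then have "f j0 * y j0 = - (\<Sum>j\<in>J - {j0}. f j * y j)"
        unfolding sumJ by (simp add: eq_neg_iff_add_eq_0)
      then have "s y = y j0" using J by (simp add: s_def field_simps)
      then show "(y(j0 := 0))(j0 := s (y(j0 := 0))) = y" by (simp add: s_cong)
    qed
    show "\<forall>a'\<in>supp_on (J - {j0}). (a'(j0 := s a'))(j0 := 0) = a'"
      by (auto simp: supp_on_def fun_eq_iff)
    show "(\<lambda>y. y(j0 := 0)) ` ?A \<subseteq> supp_on (J - {j0})"
      by (auto simp: supp_on_def)
    show "(\<lambda>z. z(j0 := s z)) ` supp_on (J - {j0}) \<subseteq> ?A"
    proof clarify
      fix z :: "'j \<Rightarrow> 'a" assume z: "z \<in> supp_on (J - {j0})"
      have "(\<Sum>j\<in>J - {j0}. f j * (z(j0 := s z)) j) = (\<Sum>j\<in>J - {j0}. f j * z j)"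
        by (rule sum.cong) auto
      then have "(\<Sum>j\<in>J. f j * (z(j0 := s z)) j) = f j0 * s z + (\<Sum>j\<in>J - {j0}. f j * z j)"
        unfolding sumJ by simp
      also have "\<dots> = 0" using J unfolding s_def by simp
      finally have "(\<Sum>j\<in>J. f j * (z(j0 := s z)) j) = 0" .
      then show "z(j0 := s z) \<in> supp_on J \<and> (\<Sum>j\<in>J. f j * (z(j0 := s z)) j) = 0"
        using z J by (auto simp: supp_on_def)
    qed
  qed
  then have "card ?A = CARD('a) ^ (card J - 1)"
    using J by (simp add: card_supp_on bij_betw_same_card)
  moreover have "card J > 0" using J card_gt_0_iff by blast
  ultimately show ?thesis by (simp add: power_eq_if)
qed

text \<open>Since \<open>h\<close> below sums to zero over the field, averaging it over a linear functional
  detects whether the functional vanishes; it plays the role of an additive character.\<close>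

lemma card_kernel_transpose:
  fixes g :: "'i \<Rightarrow> 'j \<Rightarrow> 'a::{field,finite}"
  assumes I: "finite I" and J: "finite J"
  shows "card {x \<in> supp_on I. \<forall>j\<in>J. (\<Sum>i\<in>I. x i * g i j) = 0} * CARD('a) ^ card J =
         card {y \<in> supp_on J. \<forall>i\<in>I. (\<Sum>j\<in>J. g i j * y j) = 0} * CARD('a) ^ card I"
proof -
  define k where "k = real CARD('a)"
  define h :: "'a \<Rightarrow> real" where "h c = (if c = 0 then k - 1 else -1)" for c
  define X Y :: "('i \<Rightarrow> 'a) set" where "X = supp_on I" and "Y = {x \<in> X. \<forall>j\<in>J. (\<Sum>i\<in>I. x i * g i j) = 0}"
  define X' Y' :: "('j \<Rightarrow> 'a) set" where "X' = supp_on J" and "Y' = {y \<in> X'. \<forall>i\<in>I. (\<Sum>j\<in>J. g i j * y j) = 0}"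
  have fin: "finite X" "finite X'" using I J by (simp_all add: X_def X'_def finite_supp_on)
  have h: "(\<Sum>y\<in>supp_on J. h (\<Sum>j\<in>J. f j * y j)) = (if \<forall>j\<in>J. f j = 0 then (k - 1) * k ^ card J else 0)"
    if J: "finite J" for J and f :: "'b \<Rightarrow> 'a"
  proof (cases "\<forall>j\<in>J. f j = 0")
    case True
    then show ?thesis using J by (simp add: h_def card_supp_on k_def)
  next
    case False
    then obtain j0 where j0: "j0 \<in> J" "f j0 \<noteq> 0" by blast
    let ?K = "{y \<in> supp_on J. (\<Sum>j\<in>J. f j * y j) = 0}"
    have "k * card ?K = k ^ card J"
      using card_functional_kernel[where f = f, OF J j0] unfolding k_def
      by (simp only: flip: of_nat_mult of_nat_power)
    moreover have "(\<Sum>y\<in>supp_on J. h (\<Sum>j\<in>J. f j * y j)) = (\<Sum>y\<in>supp_on J. k * (if y \<in> ?K then 1 else 0) - 1)"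
      by (rule sum.cong) (auto simp: h_def)
    moreover have "(\<Sum>y\<in>supp_on J. k * (if y \<in> ?K then 1 else 0) - 1) = k * card ?K - k ^ card J"
    proof -
      have "(\<Sum>y\<in>supp_on J. if y \<in> ?K then 1 else 0 :: real) = card ?K"
        using finite_supp_on[OF J, where 'a = 'a] by (simp add: sum.If_cases Int_def conj_comms)
      then show ?thesis
        unfolding sum_subtractf sum_distrib_left[symmetric] by (simp add: card_supp_on J k_def)
    qed
    ultimately show ?thesis using False by auto
  qed
  \<comment> \<open>The same double sum over the bilinear form is evaluated twice, here with the
    inner sum over \<open>y\<close>, below over \<open>x\<close>. Comparing the values says that row
    rank equals column rank, in counting form.\<close>
  have "(\<Sum>x\<in>X. \<Sum>y\<in>X'. h (\<Sum>i\<in>I. \<Sum>j\<in>J. x i * g i j * y j)) = (k - 1) * k ^ card J * card Y"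
  proof -
    have "(\<Sum>x\<in>X. \<Sum>y\<in>X'. h (\<Sum>i\<in>I. \<Sum>j\<in>J. x i * g i j * y j))
        = (\<Sum>x\<in>X. if x \<in> Y then (k - 1) * k ^ card J else 0)"
      unfolding X'_def
    proof (rule sum.cong[OF refl])
      fix x assume x: "x \<in> X"
      have "(\<Sum>i\<in>I. \<Sum>j\<in>J. x i * g i j * y j) = (\<Sum>j\<in>J. (\<Sum>i\<in>I. x i * g i j) * y j)" for y
        unfolding sum_distrib_right by (rule sum.swap)
      then show "(\<Sum>y\<in>supp_on J. h (\<Sum>i\<in>I. \<Sum>j\<in>J. x i * g i j * y j)) =
          (if x \<in> Y then (k - 1) * k ^ card J else 0)"
        using x h[OF J, of "\<lambda>j. \<Sum>i\<in>I. x i * g i j"] by (auto simp: Y_def)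
    qed
    also have "\<dots> = (k - 1) * k ^ card J * card Y"
      using fin by (simp add: sum.If_cases Int_absorb1 Y_def Collect_conj_eq)
    finally show ?thesis .
  qed
  moreover have "(\<Sum>x\<in>X. \<Sum>y\<in>X'. h (\<Sum>i\<in>I. \<Sum>j\<in>J. x i * g i j * y j)) = (k - 1) * k ^ card I * card Y'"
  proof -
    have "(\<Sum>x\<in>X. \<Sum>y\<in>X'. h (\<Sum>i\<in>I. \<Sum>j\<in>J. x i * g i j * y j))
        = (\<Sum>y\<in>X'. if y \<in> Y' then (k - 1) * k ^ card I else 0)"
      unfolding X_def
    proof (subst sum.swap, rule sum.cong[OF refl])
      fix y assume y: "y \<in> X'"
      have "(\<Sum>i\<in>I. \<Sum>j\<in>J. x i * g i j * y j) = (\<Sum>i\<in>I. (\<Sum>j\<in>J. g i j * y j) * x i)" for x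
        unfolding sum_distrib_right by (intro sum.cong refl) (simp only: mult_ac)
      then show "(\<Sum>x\<in>supp_on I. h (\<Sum>i\<in>I. \<Sum>j\<in>J. x i * g i j * y j)) =
          (if y \<in> Y' then (k - 1) * k ^ card I else 0)"
        using y h[OF I, of "\<lambda>i. \<Sum>j\<in>J. g i j * y j"] by (auto simp: Y'_def)
    qed
    also have "\<dots> = (k - 1) * k ^ card I * card Y'"
      using fin by (simp add: sum.If_cases Int_absorb1 Y'_def Collect_conj_eq)
    finally show ?thesis .
  qed
  ultimately have "(k - 1) * (k ^ card J * card Y) = (k - 1) * (k ^ card I * card Y')"
    by (simp only: mult.assoc)
  moreover have "k - 1 \<noteq> 0" using card_field_ge_2[where 'a = 'a] by (simp add: k_def)
  ultimately have "k ^ card J * card Y = k ^ card I * card Y'" by simp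
  then have "card Y * CARD('a) ^ card J = card Y' * CARD('a) ^ card I"
    unfolding k_def of_nat_power[symmetric] of_nat_mult[symmetric] of_nat_eq_iff
    by (simp only: mult.commute)
  then show ?thesis by (simp add: Y_def Y'_def X_def X'_def)
qed

section \<open>The divisor bound\<close>

lemma finite_degree_le: "finite {p :: 'a::{zero,finite} poly. degree p \<le> D}"
proof (rule finite_imageD)
  show "inj_on coeff {p :: 'a poly. degree p \<le> D}" by (simp add: inj_on_def coeff_inject)
  have "coeff ` {p :: 'a poly. degree p \<le> D} \<subseteq> supp_on {..D}"
    by (auto simp: supp_on_def intro!: coeff_eq_0)
  then show "finite (coeff ` {p :: 'a poly. degree p \<le> D})"
    by (rule finite_subset) (simp add: finite_supp_on)
qed

lemma finite_poly_divisors: "f \<noteq> 0 \<Longrightarrow> finite {d :: 'a::{field,finite} poly. d dvd f}"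
  by (rule finite_subset[OF _ finite_degree_le[of "degree f"]]) (auto intro: dvd_imp_degree_le)

text \<open>A prime \<open>p\<close> dividing \<open>d * c\<close> can be cancelled from
  \<open>d\<close> or from the cofactor \<open>c\<close>. The representation need not be unique;
  existence is enough for an upper count of divisors.\<close>

lemma dvd_prime_power_mult:
  fixes p :: "'a::field poly"
  assumes p: "prime_elem p" and "d dvd p ^ e * g"
  shows "\<exists>i\<le>e. \<exists>d'. d = p ^ i * d' \<and> d' dvd g"
  using assms(2)
proof (induction e arbitrary: d)
  case 0
  then show ?case by simp
next
  case (Suc e)
  have p0: "p \<noteq> 0" using p by auto
  obtain c where c: "p * (p ^ e * g) = d * c" using Suc.prems by (auto simp: mult.assoc)
  then consider "p dvd d" | "p dvd c" using p prime_elem_dvd_multD by (metis dvd_triv_left)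
  then show ?case
  proof cases
    case 1
    then obtain d1 where d1: "d = p * d1" by (auto elim: dvdE)
    then have "d1 dvd p ^ e * g" using c p0 by (simp add: mult.assoc)
    then obtain i d' where "i \<le> e" "d1 = p ^ i * d'" "d' dvd g" using Suc.IH by blast
    then show ?thesis using d1 by (intro exI[of _ "Suc i"]) (auto simp: mult.assoc)
  next
    case 2
    then obtain c1 where "c = p * c1" by (auto elim: dvdE)
    then have "p ^ e * g = d * c1" using c p0 by (simp add: mult.left_commute)
    then have "d dvd p ^ e * g" by simp
    then show ?thesis using Suc.IH by (meson le_Suc_eq)
  qed
qed

lemma card_divisors_prime_power_mult:
  fixes p :: "'a::{field,finite} poly"
  assumes p: "prime_elem p" and g: "g \<noteq> 0"
  shows "card {d. d dvd p ^ e * g} \<le> (e + 1) * card {d. d dvd g}"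
proof -
  have "{d. d dvd p ^ e * g} \<subseteq> (\<Union>i\<le>e. (*) (p ^ i) ` {d. d dvd g})"
    using dvd_prime_power_mult[OF p] by fastforce
  then have "card {d. d dvd p ^ e * g} \<le> card (\<Union>i\<le>e. (*) (p ^ i) ` {d. d dvd g})"
    by (rule card_mono[rotated]) (simp add: finite_poly_divisors g)
  also have "\<dots> \<le> (\<Sum>i\<le>e. card ((*) (p ^ i) ` {d. d dvd g}))"
    by (rule card_UN_le) simp
  also have "\<dots> \<le> (\<Sum>i\<le>e. card {d. d dvd g})"
    by (rule sum_mono) (simp add: card_image_le finite_poly_divisors g)
  finally show ?thesis by simp
qed

lemma irreducible_factor_exists:
  fixes f :: "'a::field poly"
  assumes "degree f > 0"
  shows "\<exists>p. irreducible p \<and> p dvd f"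
  using assms
proof (induction "degree f" arbitrary: f rule: less_induct)
  case less
  have f0: "f \<noteq> 0" using less.prems by auto
  then have "\<not> f dvd 1" using less.prems by (simp add: is_unit_iff_degree)
  show ?case
  proof (cases "irreducible f")
    case False
    then obtain a b where ab: "f = a * b" "\<not> a dvd 1" "\<not> b dvd 1"
      using f0 \<open>\<not> f dvd 1\<close> by (auto simp: irreducible_def)
    have 0: "a \<noteq> 0" "b \<noteq> 0" using ab f0 by auto
    have "degree a > 0" "degree b > 0" using ab(2,3) 0 by (auto simp: is_unit_iff_degree)
    then have "degree a < degree f" using ab 0 by (simp add: degree_mult_eq)
    then obtain p where "irreducible p" "p dvd a" using less.hyps \<open>degree a > 0\<close> by blast
    then show ?thesis using ab(1) by auto
  qed auto
qed

lemma prime_power_decomposition: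
  fixes p f :: "'a::field poly"
  assumes "degree p > 0" "f \<noteq> 0"
  shows "\<exists>e g. f = p ^ e * g \<and> \<not> p dvd g"
  using assms(2)
proof (induction "degree f" arbitrary: f rule: less_induct)
  case less
  show ?case
  proof (cases "p dvd f")
    case True
    then obtain f1 where f1: "f = p * f1" by (auto elim: dvdE)
    then have "degree f1 < degree f" "f1 \<noteq> 0" using less.prems assms(1) by (auto simp: degree_mult_eq)
    then obtain e g where "f1 = p ^ e * g" "\<not> p dvd g" using less.hyps by blast
    then show ?thesis using f1 by (intro exI[of _ "Suc e"]) (auto simp: mult.assoc)
  next
    case False
    then show ?thesis by (intro exI[of _ 0] exI[of _ f]) auto
  qed
qed

text \<open>There are at most \<open>degree f / H\<close> irreducible factors, and each at most
  doubles the number of divisors. The factor \<open>CARD('a)\<close> bounds the constants, as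
  divisors are counted together with their unit multiples.\<close>

lemma card_divisors_large_factors:
  fixes f :: "'a::{field,finite} poly"
  assumes "H \<ge> 1" "f \<noteq> 0" "\<And>p. irreducible p \<Longrightarrow> p dvd f \<Longrightarrow> degree p \<ge> H"
  shows "real (card {d. d dvd f}) \<le> real CARD('a) * 2 powr (real (degree f) / real H)"
  using assms(2,3)
proof (induction "degree f" arbitrary: f rule: less_induct)
  case less
  show ?case
  proof (cases "degree f = 0")
    case True
    have "{d. d dvd f} \<subseteq> range (\<lambda>c. [:c:])"
    proof
      fix d assume "d \<in> {d. d dvd f}"
      then have "degree d = 0" using dvd_imp_degree_le[of d f] less.prems True by auto
      then show "d \<in> range (\<lambda>c. [:c:])" using degree0_coeffs by blast
    qed
    then have "card {d. d dvd f} \<le> card (range (\<lambda>c::'a. [:c:]))" by (intro card_mono) auto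
    also have "\<dots> \<le> CARD('a)" by (rule card_image_le) simp
    finally show ?thesis using True by simp
  next
    case False
    then obtain p where p: "irreducible p" "p dvd f" using irreducible_factor_exists by auto
    then obtain g where g: "f = p * g" by (auto elim: dvdE)
    have 0: "p \<noteq> 0" "g \<noteq> 0" using g less.prems by auto
    have dp: "degree p \<ge> H" using p less.prems by blast
    have df: "degree f = degree p + degree g" using g 0 by (simp add: degree_mult_eq)
    have "real (card {d. d dvd g}) \<le> real CARD('a) * 2 powr (real (degree g) / real H)"
      using df dp \<open>H \<ge> 1\<close> 0 less.prems g by (intro less.hyps) auto
    moreover have "card {d. d dvd f} \<le> 2 * card {d. d dvd g}"
      using card_divisors_prime_power_mult[of p g 1] field_poly_irreducible_imp_prime[OF p(1)] 0 g by simp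
    moreover have "1 + real (degree g) / real H \<le> real (degree f) / real H"
      using df dp \<open>H \<ge> 1\<close> by (simp add: field_simps)
    then have "2 * 2 powr (real (degree g) / real H) \<le> 2 powr (real (degree f) / real H)"
      by (metis powr_add powr_mono powr_one one_le_numeral zero_le_numeral)
    ultimately show ?thesis
      using mult_left_mono[of "2 * 2 powr (real (degree g) / real H)" "2 powr (real (degree f) / real H)" "real CARD('a)"]
      by linarith
  qed
qed

text \<open>Splitting off all of \<open>p ^ e\<close> costs a factor \<open>e + 1\<close>, at most
  \<open>2 H\<close> times the share \<open>2 powr (e * degree p / H)\<close> that
  \<open>p ^ e\<close> has in the bound. So only one factor \<open>2 H\<close> arises per element of
  \<open>P\<close>, whatever \<open>f\<close> is. \<open>P\<close> may contain reducible elements,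
  which lets it be the set of all polynomials of small degree later.\<close>

lemma card_divisors_few_small_factors:
  fixes P :: "'a::{field,finite} poly set"
  assumes H: "H \<ge> 1" and "finite P"
  shows "f \<noteq> 0 \<Longrightarrow> (\<And>p. irreducible p \<Longrightarrow> p dvd f \<Longrightarrow> degree p < H \<Longrightarrow> p \<in> P) \<Longrightarrow>
    real (card {d. d dvd f}) \<le> real CARD('a) * real (2 * H) ^ card P * 2 powr (real (degree f) / real H)"
  using \<open>finite P\<close>
proof (induction P arbitrary: f rule: finite_induct)
  case empty
  then have "real (card {d. d dvd f}) \<le> real CARD('a) * 2 powr (real (degree f) / real H)"
    by (intro card_divisors_large_factors[OF H]) (auto simp: not_less[symmetric])
  then show ?case by simp
next
  case (insert p P)
  show ?case
  proof (cases "irreducible p")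
    case False
    then have "real (card {d. d dvd f}) \<le> real CARD('a) * real (2 * H) ^ card P * 2 powr (real (degree f) / real H)"
      using insert.prems by (intro insert.IH) auto
    also have "\<dots> \<le> real CARD('a) * real (2 * H) ^ card (insert p P) * 2 powr (real (degree f) / real H)"
      using H insert.hyps by (intro mult_right_mono mult_left_mono power_increasing) auto
    finally show ?thesis .
  next
    case True
    then have dp: "degree p > 0" "p \<noteq> 0"
      by (metis bot_nat_0.not_eq_extremum irreducible_def is_unit_iff_degree, auto)
    obtain e g where fg: "f = p ^ e * g" and pg: "\<not> p dvd g"
      using prime_power_decomposition[OF dp(1) insert.prems(1)] by blast
    have g0: "g \<noteq> 0" using fg insert.prems by auto
    have df: "degree f = e * degree p + degree g"
      using fg g0 dp by (simp add: degree_mult_eq degree_power_eq)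
    have IH: "real (card {d. d dvd g}) \<le> real CARD('a) * real (2 * H) ^ card P * 2 powr (real (degree g) / real H)"
      using insert.prems g0 fg pg by (intro insert.IH) (auto dest: dvd_mult)
    \<comment> \<open>From \<open>1 + x \<le> exp x\<close> and \<open>ln 2 \<ge> 1/2\<close> comes
      \<open>1 + e / (2 H) \<le> 2 powr (e / H)\<close>; multiplied by \<open>2 H\<close> this
      bounds \<open>2 H + e\<close>, hence \<open>e + 1\<close>.\<close>
    have "1 + (e / H) * ln 2 \<le> exp ((e / H) * ln 2)" by (rule exp_ge_add_one_self)
    moreover have "(e / H) * (1 / 2) \<le> (e / H) * ln 2"
      using ln2_ge_two_thirds by (intro mult_left_mono) auto
    ultimately have "1 + e / H / 2 \<le> 2 powr (e / H)"
      unfolding powr_def by (simp only: if_False numeral_neq_zero)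
    then have "2 * H * (1 + e / H / 2) \<le> 2 * H * 2 powr (e / H)"
      by (intro mult_left_mono) simp_all
    moreover have "2 * real H * (1 + e / H / 2) = 2 * H + e"
      using H by (simp add: distrib_left)
    ultimately have "real e + 1 \<le> 2 * H * 2 powr (e / H)"
      using H by linarith
    also have "\<dots> \<le> 2 * H * 2 powr (e * degree p / H)"
      using dp by (intro mult_left_mono powr_mono divide_right_mono) (auto simp: mult_le_cancel_left1 Suc_le_eq)
    finally have e: "real e + 1 \<le> 2 * H * 2 powr (e * degree p / H)" .
    have "real (card {d. d dvd f}) \<le> (real e + 1) * real (card {d. d dvd g})"
      using of_nat_mono[OF card_divisors_prime_power_mult[OF field_poly_irreducible_imp_prime[OF True] g0, of e], where 'a = real]
      unfolding fg by (simp add: algebra_simps)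
    also have "\<dots> \<le> (2 * H * 2 powr (e * degree p / H)) *
        (real CARD('a) * real (2 * H) ^ card P * 2 powr (real (degree g) / real H))"
      using e IH by (intro mult_mono) auto
    also have "\<dots> = real CARD('a) * real (2 * H) ^ card (insert p P) *
        (2 powr (e * degree p / H) * 2 powr (real (degree g) / real H))"
      using insert.hyps by simp
    also have "2 powr (e * degree p / H) * 2 powr (real (degree g) / real H) = 2 powr (real (degree f) / real H)"
      by (simp add: df add_divide_distrib flip: powr_add)
    finally show ?thesis .
  qed
qed

text \<open>With \<open>H\<close> at least \<open>1/\<epsilon>\<close> the doubling over large
  factors stays below \<open>k powr (\<epsilon> * degree f)\<close>, because
  \<open>2 \<le> k\<close>. The finitely many small factors go into \<open>C\<close>.\<close>

lemma divisor_bound: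
  assumes "\<epsilon> > 0"
  shows "\<exists>C>0. \<forall>f :: 'a::{field,finite} poly. f \<noteq> 0 \<longrightarrow>
           real (card {d. d dvd f}) \<le> C * real CARD('a) powr (\<epsilon> * real (degree f))"
proof -
  define H where "H = nat \<lceil>1 / \<epsilon>\<rceil> + 1"
  have H: "H \<ge> 1" "1 / real H \<le> \<epsilon>"
  proof -
    have "1 / \<epsilon> \<le> real H" unfolding H_def by linarith
    then have "1 \<le> \<epsilon> * real H" using assms by (simp add: field_simps)
    then show "1 / real H \<le> \<epsilon>" by (simp add: H_def divide_le_eq)
  qed (simp add: H_def)
  define P :: "'a poly set" where "P = {p. degree p \<le> H}"
  define C where "C = real CARD('a) * real (2 * H) ^ card P"
  have "C > 0" using H card_field_ge_2[where 'a = 'a] by (simp add: C_def)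
  moreover have "real (card {d. d dvd f}) \<le> C * real CARD('a) powr (\<epsilon> * real (degree f))"
    if "f \<noteq> 0" for f :: "'a poly"
  proof -
    have "real (card {d. d dvd f}) \<le> C * 2 powr (real (degree f) / real H)"
      unfolding C_def using that H(1)
      by (intro card_divisors_few_small_factors) (auto simp: P_def finite_degree_le)
    also have "2 powr (real (degree f) / real H) \<le> real CARD('a) powr (real (degree f) / real H)"
      using card_field_ge_2[where 'a = 'a] by (intro powr_mono2) auto
    also have "\<dots> \<le> real CARD('a) powr (\<epsilon> * real (degree f))"
      using card_field_ge_2[where 'a = 'a] H mult_right_mono[OF H(2), of "real (degree f)"]
      by (intro powr_mono) auto
    finally show ?thesis using \<open>C > 0\<close> by simp
  qed
  ultimately show ?thesis by blast
qed

section \<open>Matrices near an integer point\<close>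

type_synonym 'a lmat = "nat \<Rightarrow> nat \<Rightarrow> int \<Rightarrow> 'a"
type_synonym 'a cellfun = "nat \<times> nat \<times> nat \<Rightarrow> 'a"

definition cells :: "nat \<Rightarrow> nat \<Rightarrow> nat \<Rightarrow> (nat \<times> nat \<times> nat) set" where
  "cells m n L = {..<m} \<times> {..<n} \<times> {1..L}"

lemma finite_cells [simp]: "finite (cells m n L)"
  and card_cells: "card (cells m n L) = m * n * L"
  by (simp_all add: cells_def card_cartesian_product)

text \<open>A function supported on cells encodes the fractional part of a matrix, the entry at
  \<open>(i, j, l)\<close> being the coefficient of \<open>X^(-l)\<close>.  The value \<open>qrow m q t x j l\<close> is then the
  coefficient of \<open>X^(t-l)\<close> of the \<open>j\<close>-th entry of the row vector \<open>q A\<close>; for \<open>s \<ge> l\<close> the truncated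
  difference \<open>l - s\<close> is \<open>0\<close>, where \<open>x\<close> vanishes.\<close>

definition qrow :: "nat \<Rightarrow> (nat \<Rightarrow> 'a::comm_ring poly) \<Rightarrow> nat \<Rightarrow> 'a cellfun \<Rightarrow> nat \<Rightarrow> nat \<Rightarrow> 'a" where
  "qrow m q t x j l = (\<Sum>i<m. \<Sum>s\<le>t. coeff (q i) (t - s) * x (i, j, l - s))"

text \<open>The index \<open>l = t + d\<close> belongs to the coefficient of \<open>X^(-d)\<close>
  of \<open>q A\<close>, so for entries of degree at most \<open>t\<close> this is the condition
  that the distance of \<open>q A\<close> to the polynomial vectors is below \<open>k^(-b)\<close>.
  It always holds for \<open>b = 0\<close>.\<close>

definition near :: "nat \<Rightarrow> nat \<Rightarrow> (nat \<Rightarrow> 'a::comm_ring poly) \<Rightarrow> nat \<Rightarrow> nat \<Rightarrow> 'a cellfun \<Rightarrow> bool" where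
  "near m n q t b x \<longleftrightarrow> (\<forall>j<n. \<forall>l\<in>{t+1..t+b}. qrow m q t x j l = 0)"

text \<open>The dual variables \<open>y (c, j, d)\<close>, multipliers of the equations for
  \<open>X^(-d)\<close>, assembled into one polynomial. As \<open>d\<close> starts at 1, it is
  divisible by \<open>X\<close> and has \<open>b\<close> free coefficients.\<close>

definition cpoly :: "nat \<Rightarrow> ('c \<times> nat \<times> nat \<Rightarrow> 'a::comm_ring_1) \<Rightarrow> 'c \<Rightarrow> nat \<Rightarrow> 'a poly" where
  "cpoly b y c j = (\<Sum>d\<in>{1..b}. monom (y (c, j, d)) d)"

lemma coeff_cpoly: "coeff (cpoly b y c j) d = (if d \<in> {1..b} then y (c, j, d) else 0)"
  by (simp add: cpoly_def coeff_sum coeff_monom sum.delta')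

lemma degree_cpoly: "degree (cpoly b y c j) \<le> b"
  by (rule degree_le) (simp add: coeff_cpoly)

lemma coeff_cpoly_mult:
  "coeff (cpoly b y c j * p) l = (\<Sum>d\<in>{1..b}. if d \<le> l then coeff p (l - d) * y (c, j, d) else 0)"
  unfolding cpoly_def sum_distrib_right coeff_sum
  by (rule sum.cong) (auto simp: coeff_monom_mult)

lemma qrow_eq_sum:
  assumes x: "x \<in> supp_on (cells m n L)" and L: "t + d \<le> L" and d: "d \<ge> 1"
    and q: "\<And>i. i < m \<Longrightarrow> degree (q i) \<le> t"
  shows "qrow m q t x j (t + d) = (\<Sum>i<m. \<Sum>l\<in>{1..L}. if d \<le> l then x (i, j, l) * coeff (q i) (l - d) else 0)"
  unfolding qrow_def
proof (rule sum.cong[OF refl])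
  fix i assume i: "i \<in> {..<m}"
  have "(\<Sum>s\<le>t. coeff (q i) (t - s) * x (i, j, t + d - s)) = (\<Sum>l\<in>{d..t+d}. x (i, j, l) * coeff (q i) (l - d))"
    by (rule sum.reindex_bij_witness[where i = "\<lambda>l. t + d - l" and j = "\<lambda>s. t + d - s"])
       (auto simp: mult.commute)
  also have "\<dots> = (\<Sum>l\<in>{1..L}. if d \<le> l then x (i, j, l) * coeff (q i) (l - d) else 0)"
    using L d q[of i] i by (intro sum.mono_neutral_cong_left) (auto simp: coeff_eq_0)
  finally show "(\<Sum>s\<le>t. coeff (q i) (t - s) * x (i, j, t + d - s)) = \<dots>" .
qed

text \<open>Reading off the coefficient of \<open>X^(-d)\<close> of \<open>q A\<close> is adjoint to
  multiplying \<open>q\<close> by \<open>X^d\<close>. The solutions of the transposed system are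
  therefore the polynomial relations between the vectors \<open>Q c\<close>, one relation for each
  column \<open>j\<close>.\<close>

lemma card_near_family:
  fixes Q :: "'c \<Rightarrow> nat \<Rightarrow> 'a::{field,finite} poly"
  assumes fin: "finite \<Gamma>" and deg: "\<And>c i. c \<in> \<Gamma> \<Longrightarrow> i < m \<Longrightarrow> degree (Q c i) \<le> t"
  shows "card {x \<in> supp_on (cells m n (t + b)). \<forall>c\<in>\<Gamma>. near m n (Q c) t b x} * CARD('a) ^ (card \<Gamma> * (n * b)) =
         card {y \<in> supp_on (\<Gamma> \<times> {..<n} \<times> {1..b}). \<forall>i<m. \<forall>j<n. (\<Sum>c\<in>\<Gamma>. cpoly b y c j * Q c i) = 0}
           * CARD('a) ^ (m * n * (t + b))"
proof -
  define J where "J = \<Gamma> \<times> {..<n} \<times> {1..b}"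
  define L where "L = t + b"
  define g :: "nat \<times> nat \<times> nat \<Rightarrow> 'c \<times> nat \<times> nat \<Rightarrow> 'a"
    where "g = (\<lambda>(i, j, l) (c, j', d). if j = j' \<and> d \<le> l then coeff (Q c i) (l - d) else 0)"
  have finJ: "finite J" using fin by (simp add: J_def)
  have cardJ: "card J = card \<Gamma> * (n * b)" by (simp add: J_def card_cartesian_product)
  have lhs: "(\<Sum>u\<in>cells m n L. x u * g u (c, j, d)) = qrow m (Q c) t x j (t + d)"
    if x: "x \<in> supp_on (cells m n L)" and c: "(c, j, d) \<in> J" for x c j d
  proof -
    have "(\<Sum>u\<in>cells m n L. x u * g u (c, j, d)) =
        (\<Sum>i<m. \<Sum>j'<n. \<Sum>l\<in>{1..L}. if j' = j \<and> d \<le> l then x (i, j', l) * coeff (Q c i) (l - d) else 0)"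
      unfolding cells_def sum.cartesian_product
      by (rule sum.cong) (auto simp: g_def)
    also have "\<dots> = (\<Sum>i<m. \<Sum>l\<in>{1..L}. \<Sum>j'<n. if j' = j \<and> d \<le> l then x (i, j', l) * coeff (Q c i) (l - d) else 0)"
      by (rule sum.cong[OF refl]) (rule sum.swap)
    also have "\<dots> = (\<Sum>i<m. \<Sum>l\<in>{1..L}. if d \<le> l then x (i, j, l) * coeff (Q c i) (l - d) else 0)"
    proof (intro sum.cong refl)
      fix i l
      have "(\<Sum>j'<n. if j' = j \<and> d \<le> l then x (i, j', l) * coeff (Q c i) (l - d) else 0) =
            (\<Sum>j'<n. if j' = j then (if d \<le> l then x (i, j, l) * coeff (Q c i) (l - d) else 0) else 0)"
        by (rule sum.cong) auto
      then show "(\<Sum>j'<n. if j' = j \<and> d \<le> l then x (i, j', l) * coeff (Q c i) (l - d) else 0) =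
            (if d \<le> l then x (i, j, l) * coeff (Q c i) (l - d) else 0)"
        using c by (simp add: J_def)
    qed
    also have "\<dots> = qrow m (Q c) t x j (t + d)"
      using c deg x by (subst qrow_eq_sum[of _ m n L]) (auto simp: J_def L_def)
    finally show ?thesis .
  qed
  have A: "{x \<in> supp_on (cells m n L). \<forall>v\<in>J. (\<Sum>u\<in>cells m n L. x u * g u v) = 0} =
      {x \<in> supp_on (cells m n L). \<forall>c\<in>\<Gamma>. near m n (Q c) t b x}"
  proof (intro Collect_cong conj_cong refl)
    fix x :: "'a cellfun" assume "x \<in> supp_on (cells m n L)"
    then have "(\<forall>v\<in>J. (\<Sum>u\<in>cells m n L. x u * g u v) = 0) \<longleftrightarrow> (\<forall>(c, j, d)\<in>J. qrow m (Q c) t x j (t + d) = 0)"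
      using lhs[of x] by auto
    also have "\<dots> \<longleftrightarrow> (\<forall>c\<in>\<Gamma>. near m n (Q c) t b x)"
    proof -
      have rng: "(\<forall>l\<in>{t+1..t+b}. P l) \<longleftrightarrow> (\<forall>d\<in>{1..b}. P (t + d))" for P
      proof
        assume *: "\<forall>d\<in>{1..b}. P (t + d)"
        show "\<forall>l\<in>{t+1..t+b}. P l"
        proof
          fix l assume "l \<in> {t+1..t+b}"
          then show "P l" using bspec[OF *, of "l - t"] by force
        qed
      qed auto
      show ?thesis unfolding near_def rng by (simp add: J_def Ball_def) fast
    qed
    finally show "(\<forall>v\<in>J. (\<Sum>u\<in>cells m n L. x u * g u v) = 0) \<longleftrightarrow> (\<forall>c\<in>\<Gamma>. near m n (Q c) t b x)" .
  qed
  have co: "(\<Sum>v\<in>J. g (i, j, l) v * y v) = coeff (\<Sum>c\<in>\<Gamma>. cpoly b y c j * Q c i) l"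
    if "(i, j, l) \<in> cells m n L" for i j l y
  proof -
    have "(\<Sum>v\<in>J. g (i, j, l) v * y v) =
        (\<Sum>c\<in>\<Gamma>. \<Sum>j'<n. \<Sum>d\<in>{1..b}. if j' = j \<and> d \<le> l then coeff (Q c i) (l - d) * y (c, j', d) else 0)"
      unfolding J_def sum.cartesian_product by (rule sum.cong) (auto simp: g_def)
    also have "\<dots> = (\<Sum>c\<in>\<Gamma>. \<Sum>j'<n. if j' = j then \<Sum>d\<in>{1..b}. (if d \<le> l then coeff (Q c i) (l - d) * y (c, j, d) else 0) else 0)"
      by (intro sum.cong refl) auto
    also have "\<dots> = (\<Sum>c\<in>\<Gamma>. \<Sum>d\<in>{1..b}. (if d \<le> l then coeff (Q c i) (l - d) * y (c, j, d) else 0))"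
      using that by (simp add: cells_def)
    finally show ?thesis by (simp add: coeff_sum coeff_cpoly_mult)
  qed
  have B: "{y \<in> supp_on J. \<forall>u\<in>cells m n L. (\<Sum>v\<in>J. g u v * y v) = 0} =
     {y \<in> supp_on J. \<forall>i<m. \<forall>j<n. (\<Sum>c\<in>\<Gamma>. cpoly b y c j * Q c i) = 0}"
  proof (intro Collect_cong conj_cong refl)
    fix y :: "'c \<times> nat \<times> nat \<Rightarrow> 'a"
    \<comment> \<open>Coefficients outside the range of the system vanish by themselves, at 0
      because \<open>cpoly\<close> is divisible by \<open>X\<close>, above \<open>L\<close> by
      degree. So finitely many equations express that the polynomial is zero.\<close>
    have "coeff (\<Sum>c\<in>\<Gamma>. cpoly b y c j * Q c i) l = 0" if "i < m" "l \<notin> {1..L}" for i j l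
      unfolding coeff_sum coeff_cpoly_mult
    proof (intro sum.neutral ballI)
      fix c d assume c: "c \<in> \<Gamma>" and d: "d \<in> {1..b}"
      show "(if d \<le> l then coeff (Q c i) (l - d) * y (c, j, d) else 0) = 0"
        using that d deg[OF c that(1)] by (auto simp: L_def coeff_eq_0)
    qed
    then have "(\<forall>l\<in>{1..L}. coeff (\<Sum>c\<in>\<Gamma>. cpoly b y c j * Q c i) l = 0) \<longleftrightarrow> (\<Sum>c\<in>\<Gamma>. cpoly b y c j * Q c i) = 0"
      if "i < m" for i j using that by (auto simp: poly_eq_iff)
    moreover have "(\<forall>u\<in>cells m n L. (\<Sum>v\<in>J. g u v * y v) = 0) \<longleftrightarrow>
      (\<forall>i<m. \<forall>j<n. \<forall>l\<in>{1..L}. coeff (\<Sum>c\<in>\<Gamma>. cpoly b y c j * Q c i) l = 0)"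
      using co unfolding cells_def by auto
    ultimately show "(\<forall>u\<in>cells m n L. (\<Sum>v\<in>J. g u v * y v) = 0) \<longleftrightarrow>
      (\<forall>i<m. \<forall>j<n. (\<Sum>c\<in>\<Gamma>. cpoly b y c j * Q c i) = 0)" by auto
  qed
  show ?thesis
    using card_kernel_transpose[OF finite_cells finJ, of m n L g] unfolding A B cardJ card_cells
    by (simp only: L_def J_def)
qed

text \<open>A single nonzero \<open>q\<close> has no nontrivial relation, so the condition has
  density exactly \<open>k^(-n b)\<close>.\<close>

lemma card_near:
  fixes q :: "nat \<Rightarrow> 'a::{field,finite} poly"
  assumes deg: "\<And>i. i < m \<Longrightarrow> degree (q i) \<le> t" and q0: "i0 < m" "q i0 \<noteq> 0"
  shows "card {x \<in> supp_on (cells m n (t + b)). near m n q t b x} * CARD('a) ^ (n * b) = CARD('a) ^ (m * n * (t + b))"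
proof -
  have "{y \<in> supp_on ({()} \<times> {..<n} \<times> {1..b}). \<forall>i<m. \<forall>j<n. (\<Sum>c\<in>{()}. cpoly b y c j * q i) = 0} = {\<lambda>_. 0}"
  proof (intro equalityI subsetI)
    fix y :: "unit \<times> nat \<times> nat \<Rightarrow> 'a"
    assume y: "y \<in> {y \<in> supp_on ({()} \<times> {..<n} \<times> {1..b}). \<forall>i<m. \<forall>j<n. (\<Sum>c\<in>{()}. cpoly b y c j * q i) = 0}"
    then have "cpoly b y () j = 0" if "j < n" for j using that q0 by auto
    then have "y ((), j, d) = 0" if "j < n" "d \<in> {1..b}" for j d
      using that coeff_cpoly[of b y "()" j d] by simp
    then show "y \<in> {\<lambda>_. 0}" using y by (auto simp: supp_on_def fun_eq_iff)
  qed (auto simp: supp_on_def cpoly_def)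
  then show ?thesis
    using card_near_family[of "{()}" m "\<lambda>_. q" t n b] deg by simp
qed

section \<open>Correlation of two vectors and the second moment\<close>

abbreviation relations :: "nat \<Rightarrow> nat \<Rightarrow> nat \<Rightarrow> (nat \<Rightarrow> 'a::comm_ring_1 poly) \<Rightarrow> (nat \<Rightarrow> 'a poly)
    \<Rightarrow> (bool \<times> nat \<times> nat \<Rightarrow> 'a) set" where
  "relations m n b q q' \<equiv> {y \<in> supp_on (UNIV \<times> {..<n} \<times> {1..b}). \<forall>i<m. \<forall>j<n.
            (\<Sum>c\<in>UNIV. cpoly b y c j * (if c then q else q') i) = 0}"

text \<open>The trivial relation contributes \<open>card Qs\<close>. In a nontrivial one,
  \<open>C_j q + C'_j q' = 0\<close> for every column \<open>j\<close>, there are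
  \<open>k^(n b)\<close> choices for the \<open>C_j\<close>; each \<open>C'_j\<close> then divides
  \<open>C_j * q i0\<close> for a fixed nonzero entry \<open>q i0\<close>, or is 0, which leaves at
  most \<open>\<tau>\<close> choices per column; and some \<open>C'_j\<close> is nonzero and
  determines \<open>q'\<close>. Hence the size of \<open>Qs\<close> does not enter the second
  term.\<close>

lemma sum_card_near_pairs:
  fixes q :: "nat \<Rightarrow> 'a::{field,finite} poly" and Qs :: "(nat \<Rightarrow> 'a poly) set"
  assumes Qs: "finite Qs" "Qs \<subseteq> polyvecs m"
    and deg: "\<And>q i. q \<in> Qs \<Longrightarrow> i < m \<Longrightarrow> degree (q i) \<le> t"
    and nz: "\<And>q. q \<in> Qs \<Longrightarrow> \<exists>i<m. q i \<noteq> 0" and q: "q \<in> Qs"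
    and \<tau>: "\<And>f :: 'a poly. f \<noteq> 0 \<Longrightarrow> degree f \<le> b + t \<Longrightarrow> card {d. d dvd f} \<le> \<tau>"
  shows "(\<Sum>q'\<in>Qs. card (relations m n b q q')) \<le> card Qs + CARD('a) ^ (n * b) * \<tau> ^ n"
proof -
  define F where "F = (supp_on (UNIV \<times> {..<n} \<times> {1..b}) :: (bool \<times> nat \<times> nat \<Rightarrow> 'a) set)"
  define Y where "Y q' = {y \<in> F. \<forall>i<m. \<forall>j<n. cpoly b y True j * q i + cpoly b y False j * q' i = 0}" for q'
  have Y: "relations m n b q q' = Y q'" for q'
    by (simp add: Y_def F_def UNIV_bool add.commute)
  have finF: "finite F" by (simp add: F_def finite_supp_on)
  have finY: "finite (Y q')" for q' using finF by (simp add: Y_def)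
  obtain i0 where i0: "i0 < m" "q i0 \<noteq> 0" using nz q by blast
  define G where "G = (supp_on ({True} \<times> {..<n} \<times> {1..b}) :: (bool \<times> nat \<times> nat \<Rightarrow> 'a) set)"
  have finG: "finite G" and cardG: "card G = CARD('a) ^ (n * b)"
    by (simp_all add: G_def finite_supp_on card_supp_on card_cartesian_product)
  \<comment> \<open>The possible values of \<open>C'_j\<close>. If \<open>C_j = 0\<close>, every
    polynomial divides the product, but \<open>C'_j\<close> must be 0 because \<open>q'\<close> is
    nonzero.\<close>
  define D where "D z j = (if cpoly b z True j = 0 then {0} else {d. d dvd cpoly b z True j * q i0})" for z j
  have finD: "finite (D z j)" for z j
    using i0 by (simp add: D_def finite_poly_divisors)
  have cardD: "card (D z j) \<le> \<tau>" for z j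
  proof -
    have "card {d::'a poly. d dvd 1} \<le> \<tau>" by (rule \<tau>) auto
    moreover have "0 < card {d::'a poly. d dvd 1}" by (auto simp: card_gt_0_iff finite_poly_divisors intro!: exI[of _ 1])
    ultimately have "1 \<le> \<tau>" by linarith
    moreover have "degree (cpoly b z True j * q i0) \<le> b + t"
      using degree_mult_le[of "cpoly b z True j" "q i0"] degree_cpoly[of b z True j] deg[OF q i0(1)] by linarith
    ultimately show ?thesis using i0 by (auto simp: D_def intro!: \<tau>)
  qed
  \<comment> \<open>Keeps both families of polynomials and forgets \<open>q'\<close>; its
    injectivity on \<open>P\<close> is the recovery of \<open>q'\<close>.\<close>
  define \<phi> where "\<phi> = (\<lambda>(q' :: nat \<Rightarrow> 'a poly, y :: bool \<times> nat \<times> nat \<Rightarrow> 'a).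
    (\<lambda>u. if fst u then y u else 0, restrict (cpoly b y False) {..<n}))"
  define P where "P = (SIGMA q' : Qs. Y q' - {\<lambda>_. 0})"
  have cp: "cpoly b (\<lambda>u. if fst u then y u else 0) True j = cpoly b y True j" for y :: "bool \<times> nat \<times> nat \<Rightarrow> 'a" and j
    by (simp add: cpoly_def)
  have "inj_on \<phi> P"
  proof (rule inj_onI)
    fix p1 p2 assume "p1 \<in> P" "p2 \<in> P" "\<phi> p1 = \<phi> p2"
    then obtain q1 y1 q2 y2 where p: "p1 = (q1, y1)" "p2 = (q2, y2)" "q1 \<in> Qs" "q2 \<in> Qs" "y1 \<in> Y q1" "y2 \<in> Y q2" "y1 \<noteq> (\<lambda>_. 0)"
      and eq: "\<phi> (q1, y1) = \<phi> (q2, y2)" by (auto simp: P_def)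
    have F: "y1 \<in> F" "y2 \<in> F" using p by (auto simp: Y_def)
    have T: "y1 (True, j, d) = y2 (True, j, d)" for j d
    proof -
      have "(\<lambda>u. if fst u then y1 u else 0) = (\<lambda>u. if fst u then y2 u else 0)"
        using eq by (simp add: \<phi>_def)
      from fun_cong[OF this, of "(True, j, d)"] show ?thesis by simp
    qed
    have Fc: "cpoly b y1 False j = cpoly b y2 False j" if "j < n" for j
    proof -
      have "restrict (cpoly b y1 False) {..<n} = restrict (cpoly b y2 False) {..<n}"
        using eq by (simp add: \<phi>_def)
      from fun_cong[OF this, of j] show ?thesis using that by simp
    qed
    have "y1 (c, j, d) = y2 (c, j, d)" for c j d
    proof (cases "c \<or> j \<ge> n \<or> d \<notin> {1..b}")
      case True
      then show ?thesis using T F unfolding F_def supp_on_def by (cases c) auto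
    next
      case False
      then show ?thesis using Fc[of j] coeff_cpoly[of b y1 False j d] coeff_cpoly[of b y2 False j d] by auto
    qed
    then have y: "y1 = y2" by auto
    have ex: "\<exists>j<n. cpoly b y1 False j \<noteq> 0"
    proof (rule ccontr)
      assume "\<not> ?thesis"
      then have F0: "cpoly b y1 False j = 0" if "j < n" for j using that by blast
      then have "cpoly b y1 True j = 0" if "j < n" for j
        using p(5) i0 that by (auto simp: Y_def)
      then have C0: "cpoly b y1 c j = 0" if "j < n" for c j using F0 that by (cases c) auto
      have "y1 (c, j, d) = 0" for c j d
      proof (cases "j < n \<and> d \<in> {1..b}")
        case True
        then show ?thesis using C0[of j c] coeff_cpoly[of b y1 c j d] by auto
      next
        case False
        then show ?thesis using F unfolding F_def supp_on_def by auto
      qed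
      then have "y1 = (\<lambda>_. 0)" by auto
      then show False using p by simp
    qed
    then obtain j where j: "j < n" "cpoly b y1 False j \<noteq> 0" by blast
    have "q1 i = q2 i" for i
    proof (cases "i < m")
      case True
      then have "cpoly b y1 True j * q i + cpoly b y1 False j * q1 i = 0"
        "cpoly b y1 True j * q i + cpoly b y1 False j * q2 i = 0"
        using p(5,6) j unfolding y Y_def by blast+
      then have "cpoly b y1 False j * q1 i = cpoly b y1 False j * q2 i" by (metis add_left_cancel)
      then show ?thesis using j by simp
    next
      case False
      moreover have "q1 \<in> polyvecs m" "q2 \<in> polyvecs m" using p(3,4) Qs by auto
      ultimately show ?thesis by (simp add: polyvecs_def)
    qed
    then show "p1 = p2" using p y by auto
  qed
  moreover have "\<phi> ` P \<subseteq> (SIGMA z : G. Pi\<^sub>E {..<n} (D z))"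
  proof
    fix u assume "u \<in> \<phi> ` P"
    then obtain q' y where u: "u = \<phi> (q', y)" "q' \<in> Qs" "y \<in> Y q'" by (auto simp: P_def)
    define z where "z = (\<lambda>u. if fst u then y u else 0)"
    have "z \<in> G" using u by (auto simp: z_def G_def Y_def F_def supp_on_def)
    moreover have "cpoly b y False j \<in> D z j" if j: "j < n" for j
    proof (cases "cpoly b z True j = 0")
      case True
      obtain i1 where "i1 < m" "q' i1 \<noteq> 0" using nz u by blast
      then have "cpoly b y True j * q i1 + cpoly b y False j * q' i1 = 0"
        using u(3) j unfolding Y_def by blast
      moreover have "cpoly b y True j = 0" using True cp[of y j] by (simp add: z_def)
      ultimately show ?thesis using True \<open>q' i1 \<noteq> 0\<close> by (simp add: D_def)
    next
      case False
      have "cpoly b y True j * q i0 + cpoly b y False j * q' i0 = 0"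
        using u(3) i0 j unfolding Y_def by blast
      then have "cpoly b z True j * q i0 + cpoly b y False j * q' i0 = 0"
        using cp[of y j] by (simp add: z_def)
      then have "cpoly b z True j * q i0 = cpoly b y False j * (- q' i0)"
        by (simp only: mult_minus_right eq_neg_iff_add_eq_0)
      then show ?thesis using False by (simp add: D_def)
    qed
    ultimately show "u \<in> (SIGMA z : G. Pi\<^sub>E {..<n} (D z))"
      using u by (auto simp: \<phi>_def z_def)
  qed
  ultimately have "card P \<le> card (SIGMA z : G. Pi\<^sub>E {..<n} (D z))"
    using finG finD by (intro card_inj_on_le[of \<phi>]) (auto intro!: finite_SigmaI finite_PiE)
  also have "\<dots> = (\<Sum>z\<in>G. \<Prod>j<n. card (D z j))"
    using finG finD by (subst card_SigmaI) (auto simp: card_PiE intro!: finite_PiE)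
  also have "\<dots> \<le> (\<Sum>z\<in>G. \<Prod>j<n. \<tau>)"
    by (intro sum_mono prod_mono) (auto simp: cardD)
  also have "\<dots> = CARD('a) ^ (n * b) * \<tau> ^ n" by (simp add: cardG)
  finally have P: "card P \<le> CARD('a) ^ (n * b) * \<tau> ^ n" .
  have "(\<Sum>q'\<in>Qs. card (Y q')) \<le> (\<Sum>q'\<in>Qs. 1 + card (Y q' - {\<lambda>_. 0}))"
  proof (rule sum_mono)
    fix q' show "card (Y q') \<le> 1 + card (Y q' - {\<lambda>_. 0})"
      using finY[of q'] by (auto simp: card_Diff_singleton_if)
  qed
  also have "\<dots> = card Qs + card P"
    unfolding P_def sum.distrib using Qs finY by (subst card_SigmaI) auto
  finally show ?thesis using P unfolding Y by linarith
qed

text \<open>Second moment method: the number of \<open>q \<in> Qs\<close> near \<open>x\<close> has small variance, so it rarely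
  vanishes.\<close>

lemma card_not_near:
  fixes Qs :: "(nat \<Rightarrow> 'a::{field,finite} poly) set"
  assumes Qs: "finite Qs" "Qs \<subseteq> polyvecs m"
    and deg: "\<And>q i. q \<in> Qs \<Longrightarrow> i < m \<Longrightarrow> degree (q i) \<le> t"
    and nz: "\<And>q. q \<in> Qs \<Longrightarrow> \<exists>i<m. q i \<noteq> 0"
    and \<tau>: "\<And>f :: 'a poly. f \<noteq> 0 \<Longrightarrow> degree f \<le> b + t \<Longrightarrow> card {d. d dvd f} \<le> \<tau>"
  shows "card {x \<in> supp_on (cells m n (t + b)). \<forall>q\<in>Qs. \<not> near m n q t b x} * card Qs
     \<le> CARD('a) ^ (m * n * (t + b)) * CARD('a) ^ (n * b) * \<tau> ^ n"
proof (cases "Qs = {}")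
  case False
  define X where "X = (supp_on (cells m n (t + b)) :: 'a cellfun set)"
  define K where "K = real CARD('a) ^ (m * n * (t + b))"
  define u where "u = real CARD('a) ^ (n * b)"
  define N where "N x = (\<Sum>q\<in>Qs. if near m n q t b x then 1 else 0 :: real)" for x
  define \<mu> where "\<mu> = card Qs / u"
  define Z where "Z = {x \<in> X. \<forall>q\<in>Qs. \<not> near m n q t b x}"
  have finX: "finite X" by (simp add: X_def finite_supp_on)
  have k0: "CARD('a) > 0" by (simp add: card_gt_0_iff)
  have u0: "u > 0" and K0: "K > 0" using k0 by (simp_all add: u_def K_def)
  have Qs0: "real (card Qs) > 0" using False Qs by (simp add: card_gt_0_iff)
  have cardX: "card X = K" by (simp add: X_def K_def card_supp_on card_cells)
  have "(\<Sum>x\<in>X. N x) = (\<Sum>q\<in>Qs. \<Sum>x\<in>X. if near m n q t b x then 1 else 0)"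
    unfolding N_def by (rule sum.swap)
  also have "\<dots> = (\<Sum>q\<in>Qs. K / u)"
  proof (rule sum.cong[OF refl])
    fix q assume q: "q \<in> Qs"
    obtain i0 where i0: "i0 < m" "q i0 \<noteq> 0" using nz q by blast
    have "real (card {x \<in> X. near m n q t b x}) * u = K"
      using arg_cong[OF card_near[of m q t i0 n b], of real] deg[OF q] i0
      by (simp add: X_def u_def K_def)
    then show "(\<Sum>x\<in>X. if near m n q t b x then 1 else 0) = K / u"
      using finX u0 by (simp add: sum.If_cases Collect_conj_eq field_simps)
  qed
  finally have S1: "(\<Sum>x\<in>X. N x) = card Qs * (K / u)" by simp
  have "(\<Sum>x\<in>X. (N x)\<^sup>2) = (\<Sum>x\<in>X. \<Sum>q\<in>Qs. \<Sum>q'\<in>Qs. if near m n q t b x \<and> near m n q' t b x then 1 else 0)"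
    unfolding N_def power2_eq_square sum_product by (intro sum.cong refl) auto
  also have "\<dots> = (\<Sum>q\<in>Qs. \<Sum>q'\<in>Qs. \<Sum>x\<in>X. if near m n q t b x \<and> near m n q' t b x then 1 else 0)"
    by (subst sum.swap) (intro sum.cong refl sum.swap)
  also have "\<dots> = (\<Sum>q\<in>Qs. \<Sum>q'\<in>Qs. K / u\<^sup>2 * card (relations m n b q q'))"
  proof (intro sum.cong refl)
    fix q q' assume q: "q \<in> Qs" "q' \<in> Qs"
    let ?c = "card (relations m n b q q')"
    have all: "(\<forall>c\<in>UNIV. near m n (if c then q else q') t b x) \<longleftrightarrow> near m n q t b x \<and> near m n q' t b x" for x
      by (simp add: all_bool_eq conj_commute)
    have "card {x \<in> X. near m n q t b x \<and> near m n q' t b x} * CARD('a) ^ (2 * (n * b)) = ?c * CARD('a) ^ (m * n * (t + b))"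
      using card_near_family[of "UNIV :: bool set" m "\<lambda>c. if c then q else q'" t n b] deg q
      unfolding all card_UNIV_bool X_def by simp
    then have "real (card {x \<in> X. near m n q t b x \<and> near m n q' t b x} * CARD('a) ^ (2 * (n * b))) = real (?c * CARD('a) ^ (m * n * (t + b)))"
      by (rule arg_cong)
    then have "real (card {x \<in> X. near m n q t b x \<and> near m n q' t b x}) * u\<^sup>2 = ?c * K"
      by (simp add: u_def K_def power_mult[symmetric] mult.commute)
    then have "real (card {x \<in> X. near m n q t b x \<and> near m n q' t b x}) = K / u\<^sup>2 * ?c"
      using u0 by (simp add: field_simps)
    then show "(\<Sum>x\<in>X. if near m n q t b x \<and> near m n q' t b x then 1 else 0) = K / u\<^sup>2 * ?c"
      using finX by (simp add: sum.If_cases Collect_conj_eq)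
  qed
  also have "\<dots> \<le> (\<Sum>q\<in>Qs. K / u\<^sup>2 * (card Qs + u * \<tau> ^ n))"
    unfolding sum_distrib_left[symmetric]
  proof (intro sum_mono mult_left_mono)
    fix q assume "q \<in> Qs"
    then have "(\<Sum>q'\<in>Qs. card (relations m n b q q')) \<le> card Qs + CARD('a) ^ (n * b) * \<tau> ^ n"
      using Qs deg nz \<tau> by (intro sum_card_near_pairs[where t = t]) auto
    from of_nat_mono[OF this, where 'a = real]
    show "(\<Sum>q'\<in>Qs. real (card (relations m n b q q'))) \<le> card Qs + u * \<tau> ^ n"
      by (simp add: u_def)
  qed (use K0 in auto)
  finally have S2: "(\<Sum>x\<in>X. (N x)\<^sup>2) \<le> card Qs * (K / u\<^sup>2 * (card Qs + u * \<tau> ^ n))" by simp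
  \<comment> \<open>Chebyshev: the count \<open>N\<close> is 0 on \<open>Z\<close>, so each point of
    \<open>Z\<close> deviates from the mean by exactly \<open>\<mu>\<close>.\<close>
  have "card Z * \<mu>\<^sup>2 = (\<Sum>x\<in>Z. (N x - \<mu>)\<^sup>2)"
    by (simp add: Z_def N_def)
  also have "\<dots> \<le> (\<Sum>x\<in>X. (N x - \<mu>)\<^sup>2)"
    using finX by (intro sum_mono2) (auto simp: Z_def)
  also have "\<dots> = (\<Sum>x\<in>X. (N x)\<^sup>2) - 2 * \<mu> * (\<Sum>x\<in>X. N x) + K * \<mu>\<^sup>2"
    by (simp add: power2_diff sum.distrib sum_subtractf cardX mult.assoc mult.left_commute[of \<mu>]
        flip: sum_distrib_left sum_distrib_right)
  also have "\<dots> \<le> card Qs * (K / u\<^sup>2 * (card Qs + u * \<tau> ^ n)) - 2 * \<mu> * (card Qs * (K / u)) + K * \<mu>\<^sup>2"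
    using S1 S2 by simp
  \<comment> \<open>The trivial relations contribute what independent events would, and this cancels
    against the square of the mean. Only the divisor term is left in the variance.\<close>
  also have "\<dots> = card Qs * K * \<tau> ^ n / u"
    using u0 by (simp add: \<mu>_def field_simps power2_eq_square)
  finally have "card Z * (card Qs / u)\<^sup>2 \<le> card Qs * K * \<tau> ^ n / u" unfolding \<mu>_def .
  then have "card Z * card Qs \<le> K * u * \<tau> ^ n"
    using u0 Qs0 by (simp add: field_simps power2_eq_square)
  then have "real (card Z * card Qs) \<le> real (CARD('a) ^ (m * n * (t + b)) * CARD('a) ^ (n * b) * \<tau> ^ n)"
    by (simp add: K_def u_def)
  then show ?thesis unfolding Z_def X_def of_nat_le_iff .
qed simp

section \<open>Extensions of truncated matrices\<close>

definition agree :: "nat \<Rightarrow> nat \<Rightarrow> nat \<Rightarrow> 'a cellfun \<Rightarrow> 'a cellfun \<Rightarrow> bool" where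
  "agree m n f x y \<longleftrightarrow> (\<forall>i<m. \<forall>j<n. \<forall>l\<in>{1..f}. x (i, j, l) = y (i, j, l))"

lemma agree_cells: "agree m n f x y \<longleftrightarrow> (\<forall>u\<in>cells m n f. x u = y u)"
  by (auto simp: agree_def cells_def)

lemma agree_sym: "agree m n f x y \<Longrightarrow> agree m n f y x"
  and agree_trans: "agree m n f x y \<Longrightarrow> agree m n f y z \<Longrightarrow> agree m n f x z"
  and agree_mono: "f' \<le> f \<Longrightarrow> agree m n f x y \<Longrightarrow> agree m n f' x y"
  by (auto simp: agree_def)

lemma cells_mono: "f \<le> L \<Longrightarrow> cells m n f \<subseteq> cells m n L"
  by (auto simp: cells_def)

lemma qrow_cong:
  assumes "agree m n f x y" "x \<in> supp_on (cells m n L)" "y \<in> supp_on (cells m n L')" "j < n" "l \<le> f"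
  shows "qrow m q t x j l = qrow m q t y j l"
  unfolding qrow_def
proof (intro sum.cong refl)
  fix i s assume i: "i \<in> {..<m}"
  show "coeff (q i) (t - s) * x (i, j, l - s) = coeff (q i) (t - s) * y (i, j, l - s)"
  proof (cases "l - s = 0")
    case True
    then show ?thesis using assms by (simp add: supp_on_def cells_def)
  next
    case False
    then have "l - s \<in> {1..f}" using assms(5) by auto
    then show ?thesis using assms(1,4) i by (simp add: agree_def)
  qed
qed

lemma near_mono: "b' \<le> b \<Longrightarrow> near m n q t b x \<Longrightarrow> near m n q t b' x"
  by (auto simp: near_def)

text \<open>Replacing row \<open>i0\<close> of \<open>A\<close> by the entries of \<open>q A\<close> is a triangular change of coordinates if
  \<open>q i0\<close> has maximal degree \<open>t\<close>; it turns \<open>near\<close> into the vanishing of some coordinates.\<close>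

definition rowsub :: "nat \<Rightarrow> nat \<Rightarrow> nat \<Rightarrow> (nat \<Rightarrow> 'a::comm_ring poly) \<Rightarrow> nat \<Rightarrow> nat
    \<Rightarrow> 'a cellfun \<Rightarrow> 'a cellfun" where
  "rowsub m n L q t i0 x = (\<lambda>(i, j, l). if (i, j, l) \<notin> cells m n L then 0
     else if i = i0 then qrow m q t x j l else x (i, j, l))"

lemma rowsub_in: "rowsub m n L q t i0 x \<in> supp_on (cells m n L)"
  by (auto simp: rowsub_def supp_on_def)

text \<open>Induction on the depth: once all rows agree at smaller depths and the other rows at
  depth \<open>l\<close>, the difference of the new entries is \<open>coeff (q i0) t\<close> times
  the difference of the old ones, and this coefficient is nonzero.\<close>

lemma rowsub_agree:
  fixes q :: "nat \<Rightarrow> 'a::field poly"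
  assumes i0: "i0 < m" "coeff (q i0) t \<noteq> 0"
    and x: "x \<in> supp_on (cells m n L)" and y: "y \<in> supp_on (cells m n L)" and f: "f \<le> L"
  shows "agree m n f (rowsub m n L q t i0 x) (rowsub m n L q t i0 y) \<longleftrightarrow> agree m n f x y"
proof
  assume "agree m n f x y"
  then show "agree m n f (rowsub m n L q t i0 x) (rowsub m n L q t i0 y)"
    using qrow_cong[OF _ x y] by (auto simp: agree_def rowsub_def cells_def)
next
  assume A: "agree m n f (rowsub m n L q t i0 x) (rowsub m n L q t i0 y)"
  have "x (i, j, l) = y (i, j, l)" if "i < m" "j < n" "1 \<le> l" "l \<le> f" for i j l
    using that
  proof (induction l arbitrary: i rule: less_induct)
    case (less l)
    have other: "x (i, j, l) = y (i, j, l)" if "i < m" "i \<noteq> i0" for i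
      using A that less.prems f unfolding agree_def rowsub_def cells_def by force
    have "qrow m q t x j l = qrow m q t y j l"
      using A i0 less.prems f unfolding agree_def rowsub_def cells_def by force
    then have "(\<Sum>i<m. \<Sum>s\<le>t. coeff (q i) (t - s) * (x (i, j, l - s) - y (i, j, l - s))) = 0"
      by (simp add: qrow_def right_diff_distrib sum_subtractf)
    also have "(\<Sum>i<m. \<Sum>s\<le>t. coeff (q i) (t - s) * (x (i, j, l - s) - y (i, j, l - s))) =
        (\<Sum>i<m. coeff (q i) t * (x (i, j, l) - y (i, j, l)))"
    proof (rule sum.cong[OF refl])
      fix i assume i: "i \<in> {..<m}"
      have z: "x (i, j, l - s) = y (i, j, l - s)" if "s > 0" for s
      proof (cases "l - s = 0")
        case True
        then show ?thesis using x y by (simp add: supp_on_def cells_def)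
      next
        case False
        then show ?thesis using less i that by (intro less.IH) auto
      qed
      have "(\<Sum>s\<le>t. coeff (q i) (t - s) * (x (i, j, l - s) - y (i, j, l - s))) =
        (\<Sum>s\<in>{0}. coeff (q i) (t - s) * (x (i, j, l - s) - y (i, j, l - s)))"
        by (rule sum.mono_neutral_right) (auto simp: z)
      then show "(\<Sum>s\<le>t. coeff (q i) (t - s) * (x (i, j, l - s) - y (i, j, l - s))) =
        coeff (q i) t * (x (i, j, l) - y (i, j, l))" by simp
    qed
    also have "\<dots> = (\<Sum>i\<in>{i0}. coeff (q i) t * (x (i, j, l) - y (i, j, l)))"
      using i0 other by (intro sum.mono_neutral_right) auto
    finally have "x (i0, j, l) = y (i0, j, l)" using i0 by simp
    then show ?case using other less.prems by (cases "i = i0") auto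
  qed
  then show "agree m n f x y" by (auto simp: agree_def)
qed

lemma supp_on_cells_eqI:
  assumes "x \<in> supp_on (cells m n L)" "y \<in> supp_on (cells m n L)" "agree m n L x y"
  shows "x = y"
proof
  fix u show "x u = y u"
    using assms unfolding agree_cells supp_on_def mem_Collect_eq by (cases "u \<in> cells m n L") metis+
qed

lemma bij_rowsub:
  fixes q :: "nat \<Rightarrow> 'a::{field,finite} poly"
  assumes i0: "i0 < m" "coeff (q i0) t \<noteq> 0"
  shows "bij_betw (rowsub m n L q t i0) (supp_on (cells m n L)) (supp_on (cells m n L))"
proof -
  have "inj_on (rowsub m n L q t i0) (supp_on (cells m n L))"
  proof (rule inj_onI)
    fix x y assume xy: "x \<in> supp_on (cells m n L)" "y \<in> supp_on (cells m n L)"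
      "rowsub m n L q t i0 x = rowsub m n L q t i0 y"
    then have "agree m n L x y" using rowsub_agree[where q = q and t = t, OF i0 xy(1,2), of L] by (simp add: agree_def)
    then show "x = y" using supp_on_cells_eqI xy by blast
  qed
  moreover have "rowsub m n L q t i0 ` supp_on (cells m n L) \<subseteq> supp_on (cells m n L)"
    by (auto simp: rowsub_in)
  ultimately show ?thesis
    unfolding bij_betw_def by (simp add: endo_inj_surj finite_supp_on)
qed

text \<open>In the coordinates of \<open>rowsub\<close> both conditions prescribe values: everything
  down to depth \<open>t + c\<close>, and row \<open>i0\<close> down to depth \<open>t + b\<close>.
  The other \<open>m - 1\<close> rows are free at depths \<open>t + c + 1\<close> to
  \<open>t + b\<close>. The prescriptions are compatible because \<open>D\<close> is already near
  \<open>q\<close> to precision \<open>c\<close>.\<close>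

lemma card_near_extensions:
  fixes q :: "nat \<Rightarrow> 'a::{field,finite} poly"
  assumes i0: "i0 < m" "coeff (q i0) t \<noteq> 0"
    and D: "D \<in> supp_on (cells m n (t + b))" "near m n q t c D" and c: "c \<le> b"
  shows "card {y \<in> supp_on (cells m n (t + b)). near m n q t b y \<and> agree m n (t + c) y D}
    = CARD('a) ^ ((m - 1) * n * (b - c))"
proof -
  define L where "L = t + b"
  define \<phi> where "\<phi> = rowsub m n L q t i0"
  define K where "K = cells m n (t + c) \<union> {i0} \<times> {..<n} \<times> {t+c+1..L}"
  define w where "w = (\<lambda>(i, j, l). if l \<le> t + c then \<phi> D (i, j, l) else 0)"
  have bij: "bij_betw \<phi> (supp_on (cells m n L)) (supp_on (cells m n L))"
    unfolding \<phi>_def by (rule bij_rowsub[where q = q and t = t, OF i0])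
  have DL: "D \<in> supp_on (cells m n L)" using D by (simp add: L_def)
  have near: "near m n q t c' y \<longleftrightarrow> (\<forall>j<n. \<forall>l\<in>{t+1..t+c'}. \<phi> y (i0, j, l) = 0)" if "c' \<le> b" for y c'
    unfolding near_def \<phi>_def rowsub_def using that i0 by (auto simp: cells_def L_def)
  have eq: "near m n q t b y \<and> agree m n (t + c) y D \<longleftrightarrow> (\<forall>u\<in>K. \<phi> y u = w u)"
    if y: "y \<in> supp_on (cells m n L)" for y
  proof -
    have "agree m n (t + c) y D \<longleftrightarrow> agree m n (t + c) (\<phi> y) (\<phi> D)"
      unfolding \<phi>_def using c by (subst rowsub_agree[where t = t and q = q, OF i0 y DL]) (auto simp: L_def)
    also have "\<dots> \<longleftrightarrow> (\<forall>u\<in>cells m n (t + c). \<phi> y u = w u)"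
      unfolding agree_cells by (rule ball_cong) (auto simp: w_def cells_def)
    finally have 1: "agree m n (t + c) y D \<longleftrightarrow> (\<forall>u\<in>cells m n (t + c). \<phi> y u = w u)" .
    have 2: "near m n q t b y \<longleftrightarrow> (\<forall>u\<in>{i0} \<times> {..<n} \<times> {t+c+1..L}. \<phi> y u = w u)"
      if *: "\<forall>u\<in>cells m n (t + c). \<phi> y u = w u"
    proof -
      have z: "\<phi> y (i0, j, l) = 0" if "j < n" "l \<in> {t+1..t+c}" for j l
      proof -
        have "\<phi> y (i0, j, l) = \<phi> D (i0, j, l)"
          using bspec[OF *, of "(i0, j, l)"] that i0 by (simp add: w_def cells_def)
        then show ?thesis using near[OF c, of D] D(2) that by auto
      qed
      have split: "{t+1..t+b} = {t+1..t+c} \<union> {t+c+1..L}" using c by (auto simp: L_def)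
      have "near m n q t b y \<longleftrightarrow> (\<forall>j<n. \<forall>l\<in>{t+c+1..L}. \<phi> y (i0, j, l) = 0)"
        unfolding near[OF order_refl] split ball_Un using z by blast
      then show ?thesis by (auto simp: w_def)
    qed
    show ?thesis unfolding 1 K_def ball_Un using 2 by blast
  qed
  have "bij_betw \<phi> {y \<in> supp_on (cells m n L). near m n q t b y \<and> agree m n (t + c) y D}
     {z \<in> supp_on (cells m n L). \<forall>u\<in>K. z u = w u}"
  proof (rule bij_betw_subset[OF bij])
    show "\<phi> ` {y \<in> supp_on (cells m n L). near m n q t b y \<and> agree m n (t + c) y D} =
      {z \<in> supp_on (cells m n L). \<forall>u\<in>K. z u = w u}"
    proof (intro equalityI subsetI)
      fix z assume z: "z \<in> {z \<in> supp_on (cells m n L). \<forall>u\<in>K. z u = w u}"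
      then obtain y where "y \<in> supp_on (cells m n L)" "z = \<phi> y"
        using bij unfolding bij_betw_def by blast
      then show "z \<in> \<phi> ` {y \<in> supp_on (cells m n L). near m n q t b y \<and> agree m n (t + c) y D}"
        using z eq by blast
    qed (use eq bij_betw_apply[OF bij] in auto)
  qed auto
  then have "card {y \<in> supp_on (cells m n L). near m n q t b y \<and> agree m n (t + c) y D} =
     card {z \<in> supp_on (cells m n L). \<forall>u\<in>K. z u = w u}" by (rule bij_betw_same_card)
  also have "\<dots> = CARD('a) ^ card (cells m n L - K)"
    using i0 c by (intro card_supp_on_prescribed) (auto simp: K_def cells_def L_def)
  also have "cells m n L - K = ({..<m} - {i0}) \<times> {..<n} \<times> {t+c+1..L}"
    using c by (auto simp: K_def cells_def L_def)
  also have "card \<dots> = (m - 1) * n * (b - c)"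
    using i0 by (simp add: card_cartesian_product L_def)
  finally show ?thesis by (simp add: L_def)
qed

text \<open>If the set is nonempty, one of its elements replaces \<open>D\<close> as the centre, and
  that element is near \<open>q\<close> to precision \<open>c\<close>.\<close>

lemma card_near_extensions_le:
  fixes q :: "nat \<Rightarrow> 'a::{field,finite} poly"
  assumes i0: "i0 < m" "coeff (q i0) t \<noteq> 0" and c: "c \<le> b"
  shows "card {y \<in> supp_on (cells m n (t + b)). near m n q t b y \<and> agree m n (t + c) y D}
    \<le> CARD('a) ^ ((m - 1) * n * (b - c))"
proof (cases "\<exists>y \<in> supp_on (cells m n (t + b)). near m n q t b y \<and> agree m n (t + c) y D")
  case True
  then obtain z where z: "z \<in> supp_on (cells m n (t + b))" "near m n q t b z" "agree m n (t + c) z D" by blast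
  have "agree m n (t + c) y D \<longleftrightarrow> agree m n (t + c) y z" for y
    using z(3) agree_sym agree_trans by blast
  then show ?thesis
    using card_near_extensions[where q = q and t = t, OF i0 z(1) near_mono[OF c z(2)] c] by simp
next
  case False
  then have "{y \<in> supp_on (cells m n (t + b)). near m n q t b y \<and> agree m n (t + c) y D} = {}" by blast
  then show ?thesis by (simp only: card.empty)
qed

lemma card_agree_extensions:
  fixes C :: "'a::{zero,finite} cellfun"
  assumes "f \<le> L"
  shows "card {x \<in> supp_on (cells m n L). agree m n f x C} = CARD('a) ^ (m * n * (L - f))"
proof -
  have "card {x \<in> supp_on (cells m n L). \<forall>u\<in>cells m n f. x u = C u} = CARD('a) ^ card (cells m n L - cells m n f)"
    by (rule card_supp_on_prescribed) (simp_all add: cells_mono assms)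
  also have "card (cells m n L - cells m n f) = m * n * (L - f)"
    by (subst card_Diff_subset) (auto simp: cells_mono assms card_cells diff_mult_distrib2)
  finally show ?thesis by (simp add: agree_cells)
qed

text \<open>One stage of the Cantor construction inside the ball of \<open>C\<close> at depth
  \<open>E\<close>. At precision \<open>b0\<close> the planes of \<open>Qs\<close> fill almost all
  of it; \<open>b1\<close> is the precision wanted in the end. Each filled ball of depth
  \<open>t + b0\<close> selects one \<open>q\<close> and keeps its subballs of depth
  \<open>t + b1\<close> near that \<open>q\<close>. Accordingly the children are spread with full
  dimension \<open>m n\<close> down to depth \<open>t + b0\<close>, and with the dimension
  \<open>(m - 1) n\<close> of a plane below it.\<close>

lemma children_exist:
  fixes Qs :: "(nat \<Rightarrow> 'a::{field,finite} poly) set"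
  assumes top: "\<And>q. q \<in> Qs \<Longrightarrow> \<exists>i<m. coeff (q i) t \<noteq> 0"
    and E: "E \<le> t + b0" and b: "b0 \<le> b1"
    and bad: "real (card {x \<in> supp_on (cells m n (t + b0)). \<forall>q\<in>Qs. \<not> near m n q t b0 x})
          \<le> \<eta> * real CARD('a) ^ (m * n * (t + b0 - E))"
  shows "\<exists>Ch \<subseteq> supp_on (cells m n (t + b1)).
      (\<forall>y\<in>Ch. agree m n E y C \<and> (\<exists>q\<in>Qs. near m n q t b1 y)) \<and>
      real (card Ch) \<ge> (1 - \<eta>) * real CARD('a) ^ (m * n * (t + b0 - E)) * real CARD('a) ^ ((m - 1) * n * (b1 - b0)) \<and>
      (\<forall>f D. E \<le> f \<longrightarrow> f \<le> t + b0 \<longrightarrow> card {y \<in> Ch. agree m n f y D} \<le>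
           CARD('a) ^ (m * n * (t + b0 - f)) * CARD('a) ^ ((m - 1) * n * (b1 - b0))) \<and>
      (\<forall>c D. b0 \<le> c \<longrightarrow> c \<le> b1 \<longrightarrow> card {y \<in> Ch. agree m n (t + c) y D} \<le> CARD('a) ^ ((m - 1) * n * (b1 - c)))"
proof -
  let ?k = "CARD('a)"
  define X0 X1 where "X0 = (supp_on (cells m n (t + b0)) :: 'a cellfun set)"
    and "X1 = (supp_on (cells m n (t + b1)) :: 'a cellfun set)"
  have fin: "finite X0" "finite X1" by (simp_all add: X0_def X1_def finite_supp_on)
  \<comment> \<open>Padding by zeros makes a point of depth \<open>t + b0\<close> one of depth
    \<open>t + b1\<close>, so it can be the centre in \<open>card_near_extensions\<close>.\<close>
  have X01: "X0 \<subseteq> X1" using cells_mono[of "t + b0" "t + b1" m n] b by (auto simp: X0_def X1_def supp_on_def)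
  define G where "G = {x \<in> X0. agree m n E x C \<and> (\<exists>q\<in>Qs. near m n q t b0 x)}"
  have finG: "finite G" using fin by (simp add: G_def)
  \<comment> \<open>One fixed choice makes \<open>Ext x\<close> the set of extensions along a single
    plane: all these sets have the same size and obey the plane's count at depths below
    \<open>t + b0\<close>.\<close>
  define ch where "ch x = (SOME q. q \<in> Qs \<and> near m n q t b0 x)" for x
  have ch: "ch x \<in> Qs" "near m n (ch x) t b0 x" if "x \<in> G" for x
    using that someI_ex[of "\<lambda>q. q \<in> Qs \<and> near m n q t b0 x"] by (auto simp: G_def ch_def)
  define Ext where "Ext x = {y \<in> X1. near m n (ch x) t b1 y \<and> agree m n (t + b0) y x}" for x
  define Ch where "Ch = (\<Union>x\<in>G. Ext x)"
  have finE: "finite (Ext x)" for x using fin by (simp add: Ext_def)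
  have disj: "Ext x \<inter> Ext x' = {}" if "x \<in> G" "x' \<in> G" "x \<noteq> x'" for x x'
  proof (rule ccontr)
    assume "\<not> ?thesis"
    then obtain y where "agree m n (t + b0) y x" "agree m n (t + b0) y x'" by (auto simp: Ext_def)
    then have "agree m n (t + b0) x x'" using agree_sym agree_trans by blast
    then show False using that supp_on_cells_eqI[of x m n "t + b0" x'] by (auto simp: G_def X0_def)
  qed
  have cardE: "card (Ext x) = ?k ^ ((m - 1) * n * (b1 - b0))" if x: "x \<in> G" for x
  proof -
    obtain i0 where i0: "i0 < m" "coeff (ch x i0) t \<noteq> 0" using top ch[OF x] by blast
    have "x \<in> supp_on (cells m n (t + b1))" using x X01 by (auto simp: G_def X1_def)
    from card_near_extensions[where q = "ch x" and t = t, OF i0 this ch(2)[OF x] b] show ?thesis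
      by (simp add: Ext_def X1_def)
  qed
  have cardCh: "card Ch = card G * ?k ^ ((m - 1) * n * (b1 - b0))"
    unfolding Ch_def using finG finE disj by (subst card_UN_disjoint) (auto simp: cardE)
  have "real (card G) \<ge> (1 - \<eta>) * real ?k ^ (m * n * (t + b0 - E))"
  proof -
    let ?B = "{x \<in> X0. \<forall>q\<in>Qs. \<not> near m n q t b0 x}"
    have "card {x \<in> X0. agree m n E x C} \<le> card (G \<union> ?B)"
      by (rule card_mono) (use fin finG in \<open>auto simp: G_def\<close>)
    also have "\<dots> \<le> card G + card ?B" by (rule card_Un_le)
    finally have "?k ^ (m * n * (t + b0 - E)) \<le> card G + card ?B"
      using E by (simp add: X0_def card_agree_extensions)
    from of_nat_mono[OF this, where 'a = real] show ?thesis
      using bad by (simp add: X0_def left_diff_distrib)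
  qed
  then have C1: "real (card Ch) \<ge> (1 - \<eta>) * real ?k ^ (m * n * (t + b0 - E)) * real ?k ^ ((m - 1) * n * (b1 - b0))"
    unfolding cardCh of_nat_mult of_nat_power by (rule mult_right_mono) simp
  have C2: "card {y \<in> Ch. agree m n f y D} \<le> ?k ^ (m * n * (t + b0 - f)) * ?k ^ ((m - 1) * n * (b1 - b0))"
    if f: "E \<le> f" "f \<le> t + b0" for f D
  proof -
    let ?G = "{x \<in> X0. agree m n f x D} \<inter> G"
    have "{y \<in> Ch. agree m n f y D} \<subseteq> (\<Union>x\<in>?G. Ext x)"
    proof
      fix y assume y: "y \<in> {y \<in> Ch. agree m n f y D}"
      then obtain x where x: "x \<in> G" "y \<in> Ext x" by (auto simp: Ch_def)
      then have "agree m n (t + b0) y x" by (simp add: Ext_def)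
      then have "agree m n f x y" using agree_mono[OF f(2)] agree_sym by blast
      then have "agree m n f x D" using y agree_trans by blast
      then show "y \<in> (\<Union>x\<in>?G. Ext x)" using x by (auto simp: G_def)
    qed
    then have "card {y \<in> Ch. agree m n f y D} \<le> card (\<Union>x\<in>?G. Ext x)"
      using finG finE by (intro card_mono) auto
    also have "\<dots> \<le> (\<Sum>x\<in>?G. card (Ext x))" using finG by (intro card_UN_le) auto
    also have "\<dots> = card ?G * ?k ^ ((m - 1) * n * (b1 - b0))" by (simp add: cardE)
    also have "card ?G \<le> card {x \<in> X0. agree m n f x D}" using fin by (intro card_mono) auto
    also have "\<dots> = ?k ^ (m * n * (t + b0 - f))" using f by (simp add: X0_def card_agree_extensions)
    finally show ?thesis by simp
  qed
  \<comment> \<open>Children agreeing beyond depth \<open>t + b0\<close> have the same parent, hence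
    the same chosen \<open>q\<close>.\<close>
  have C3: "card {y \<in> Ch. agree m n (t + c) y D} \<le> ?k ^ ((m - 1) * n * (b1 - c))"
    if c: "b0 \<le> c" "c \<le> b1" for c D
  proof (cases "\<exists>y\<in>Ch. agree m n (t + c) y D")
    case True
    then obtain y where y: "y \<in> Ch" "agree m n (t + c) y D" by blast
    then obtain x where x: "x \<in> G" "y \<in> Ext x" by (auto simp: Ch_def)
    obtain i0 where i0: "i0 < m" "coeff (ch x i0) t \<noteq> 0" using top ch[OF x(1)] by blast
    have "{y \<in> Ch. agree m n (t + c) y D} \<subseteq> {y \<in> X1. near m n (ch x) t b1 y \<and> agree m n (t + c) y D}"
    proof
      fix y' assume y': "y' \<in> {y \<in> Ch. agree m n (t + c) y D}"
      then obtain x' where x': "x' \<in> G" "y' \<in> Ext x'" by (auto simp: Ch_def)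
      have "agree m n (t + c) y' y" using y' y agree_sym agree_trans by blast
      then have "agree m n (t + b0) y' y" using agree_mono[of "t + b0" "t + c"] c by auto
      moreover have "agree m n (t + b0) y' x'" "agree m n (t + b0) y x" using x x' by (auto simp: Ext_def)
      ultimately have "agree m n (t + b0) x' x" using agree_sym agree_trans by blast
      then have "x' = x" using x x' supp_on_cells_eqI[of x' m n "t + b0" x] by (auto simp: G_def X0_def)
      then show "y' \<in> {y \<in> X1. near m n (ch x) t b1 y \<and> agree m n (t + c) y D}"
        using x' y' by (auto simp: Ext_def)
    qed
    then have "card {y \<in> Ch. agree m n (t + c) y D} \<le> card {y \<in> X1. near m n (ch x) t b1 y \<and> agree m n (t + c) y D}"
      using fin by (intro card_mono) auto
    also have "\<dots> \<le> ?k ^ ((m - 1) * n * (b1 - c))"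
      unfolding X1_def by (rule card_near_extensions_le[where q = "ch x" and t = t, OF i0 c(2)])
    finally show ?thesis .
  next
    case False
    then have "{y \<in> Ch. agree m n (t + c) y D} = {}" by blast
    then show ?thesis by (simp only: card.empty)
  qed
  have C0: "Ch \<subseteq> X1" "\<forall>y\<in>Ch. agree m n E y C \<and> (\<exists>q\<in>Qs. near m n q t b1 y)"
  proof -
    show "Ch \<subseteq> X1" by (auto simp: Ch_def Ext_def)
    show "\<forall>y\<in>Ch. agree m n E y C \<and> (\<exists>q\<in>Qs. near m n q t b1 y)"
    proof
      fix y assume "y \<in> Ch"
      then obtain x where x: "x \<in> G" "y \<in> Ext x" by (auto simp: Ch_def)
      then have "agree m n E y x" using agree_mono[OF E] by (auto simp: Ext_def)
      moreover have "agree m n E x C" using x by (simp add: G_def)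
      ultimately have "agree m n E y C" by (rule agree_trans)
      then show "agree m n E y C \<and> (\<exists>q\<in>Qs. near m n q t b1 y)" using x ch[OF x(1)] by (auto simp: Ext_def)
    qed
  qed
  show ?thesis
    by (rule exI[of _ Ch]) (use C0 C1 C2 C3 in \<open>auto simp: X1_def\<close>)
qed

section \<open>The matrix space\<close>

lemma laurent_D: "c \<in> laurent \<Longrightarrow> \<exists>N. \<forall>d>N. c d = 0"
  by (simp add: laurent_def)

lemma laurent_zero [simp]: "(\<lambda>_. 0) \<in> laurent"
  by (simp add: laurent_def)

lemma laurent_diff:
  fixes a b :: "int \<Rightarrow> 'a::ab_group_add"
  assumes "a \<in> laurent" "b \<in> laurent" shows "(\<lambda>d. a d - b d) \<in> laurent"
proof -
  obtain N M where "\<forall>d>N. a d = 0" "\<forall>d>M. b d = 0" using assms laurent_D by meson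
  then have "\<forall>d > max N M. a d - b d = 0" by auto
  then show ?thesis unfolding laurent_def by blast
qed

lemma laurent_sum:
  fixes a :: "'i \<Rightarrow> int \<Rightarrow> 'a::comm_monoid_add"
  assumes "finite I" "\<And>i. i \<in> I \<Longrightarrow> a i \<in> laurent" shows "(\<lambda>d. \<Sum>i\<in>I. a i d) \<in> laurent"
  using assms
proof (induction I rule: finite_induct)
  case (insert x F)
  then obtain N M where "\<forall>d>N. a x d = 0" "\<forall>d>M. (\<Sum>i\<in>F. a i d) = 0" using laurent_D by (meson insertCI)
  then have "\<forall>d > max N M. (\<Sum>i\<in>insert x F. a i d) = 0" using insert.hyps by auto
  then show ?case unfolding laurent_def by blast
qed simp

lemma laurent_pmul:
  assumes "c \<in> laurent" shows "pmul p c \<in> laurent"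
proof -
  obtain N where N: "\<forall>d>N. c d = 0" using assms laurent_D by blast
  have "\<forall>d>N + int (degree p). pmul p c d = 0"
    unfolding pmul_def using N by (intro allI impI sum.neutral ballI) auto
  then show ?thesis unfolding laurent_def by blast
qed

lemma laurent_ls_of_poly: "ls_of_poly p \<in> laurent"
proof -
  have "\<forall>d>int (degree p). ls_of_poly p d = 0" by (auto simp: ls_of_poly_def intro!: coeff_eq_0)
  then show ?thesis unfolding laurent_def by blast
qed

lemma laurent_leading:
  assumes "c \<in> laurent" "c \<noteq> (\<lambda>_. 0)"
  obtains g where "c g \<noteq> 0" "\<And>d. c d \<noteq> 0 \<Longrightarrow> d \<le> g"
proof -
  obtain N where N: "\<forall>d>N. c d = 0" using assms laurent_D by blast
  obtain d0 where d0: "c d0 \<noteq> 0" using assms by auto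
  define M where "M = Max {d \<in> {d0..N}. c d \<noteq> 0}"
  have fin: "finite {d \<in> {d0..N}. c d \<noteq> 0}" by (rule finite_subset[of _ "{d0..N}"]) auto
  have d0N: "d0 \<le> N" using N d0 by (meson not_le)
  have "M \<in> {d \<in> {d0..N}. c d \<noteq> 0}" unfolding M_def by (rule Max_in[OF fin]) (use d0 d0N in auto)
  moreover have "d \<le> M" if "c d \<noteq> 0" for d
  proof (cases "d0 \<le> d")
    case True
    then have "d \<in> {d \<in> {d0..N}. c d \<noteq> 0}" using that N by (auto simp: not_less[symmetric])
    then show ?thesis unfolding M_def by (rule Max_ge[OF fin])
  next
    case False
    have "d0 \<in> {d \<in> {d0..N}. c d \<noteq> 0}" using d0 d0N by auto
    then have "d0 \<le> M" unfolding M_def by (rule Max_ge[OF fin])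
    then show ?thesis using False by simp
  qed
  ultimately show ?thesis using that by blast
qed

lemma card_field_gt_1: "real CARD('a::{field,finite}) > 1"
  using card_field_ge_2[where 'a = 'a] by linarith

lemma labs_leading:
  fixes c :: "int \<Rightarrow> 'a::zero"
  assumes "c g \<noteq> 0" "\<And>d. c d \<noteq> 0 \<Longrightarrow> d \<le> g"
  shows "labs c = real CARD('a) powi g"
proof -
  have "(GREATEST d. c d \<noteq> 0) = g" using assms by (rule Greatest_equality)
  then show ?thesis using assms unfolding labs_def by auto
qed

lemma labs_nonneg: "labs c \<ge> 0"
  by (simp add: labs_def)

lemma labs_less_iff:
  fixes c :: "int \<Rightarrow> 'a::{field,finite}"
  assumes "c \<in> laurent"
  shows "labs c < real CARD('a) powi e \<longleftrightarrow> (\<forall>d\<ge>e. c d = 0)"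
proof (cases "c = (\<lambda>_. 0)")
  case True
  then show ?thesis using card_field_gt_1[where 'a = 'a] by (simp add: labs_def)
next
  case False
  obtain g where g: "c g \<noteq> 0" "\<And>d. c d \<noteq> 0 \<Longrightarrow> d \<le> g"
    using laurent_leading[OF assms False] by blast
  have "labs c = real CARD('a) powi g" by (rule labs_leading) (use g in auto)
  then have "labs c < real CARD('a) powi e \<longleftrightarrow> g < e"
    using card_field_gt_1[where 'a = 'a] power_int_strict_increasing power_int_increasing
    by (metis less_imp_le not_less)
  also have "\<dots> \<longleftrightarrow> (\<forall>d\<ge>e. c d = 0)" using g by (meson leD le_less_trans not_le)
  finally show ?thesis .
qed

lemma labs_cases:
  fixes c :: "int \<Rightarrow> 'a::{field,finite}"
  assumes "c \<in> laurent"
  shows "labs c = 0 \<or> (\<exists>g. labs c = real CARD('a) powi g)"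
  unfolding labs_def by auto

lemma mat_space_laurent: "A \<in> mat_space m n \<Longrightarrow> A i j \<in> laurent"
  unfolding mat_space_def by (cases "i < m \<and> j < n") auto

lemma matnorm_eq: "matnorm m n A = Max ((\<lambda>(i, j). labs (A i j)) ` ({..<m} \<times> {..<n}))"
proof -
  have "{labs (A i j) | i j. i < m \<and> j < n} = (\<lambda>(i, j). labs (A i j)) ` ({..<m} \<times> {..<n})" by auto
  then show ?thesis by (simp add: matnorm_def)
qed

lemma matnorm_less_iff:
  assumes "m \<ge> 1" "n \<ge> 1"
  shows "matnorm m n A < r \<longleftrightarrow> (\<forall>i<m. \<forall>j<n. labs (A i j) < r)"
  unfolding matnorm_eq using assms by (subst Max_less_iff) (auto simp: lessThan_empty_iff)

text \<open>\<open>magree m n e A B\<close> says that \<open>B\<close> lies in the open ball of radius \<open>k^e\<close> about \<open>A\<close>.\<close>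

definition magree :: "nat \<Rightarrow> nat \<Rightarrow> int \<Rightarrow> 'a lmat \<Rightarrow> 'a lmat \<Rightarrow> bool" where
  "magree m n e A B \<longleftrightarrow> (\<forall>i<m. \<forall>j<n. \<forall>d\<ge>e. A i j d = B i j d)"

lemma magree_refl [simp]: "magree m n e A A"
  and magree_sym: "magree m n e A B \<Longrightarrow> magree m n e B A"
  and magree_trans: "magree m n e A B \<Longrightarrow> magree m n e B C \<Longrightarrow> magree m n e A C"
  and magree_mono: "e \<le> e' \<Longrightarrow> magree m n e A B \<Longrightarrow> magree m n e' A B"
  by (auto simp: magree_def)

lemma matdist_less_iff:
  fixes A B :: "'a::{field,finite} lmat"
  assumes "m \<ge> 1" "n \<ge> 1" "A \<in> mat_space m n" "B \<in> mat_space m n"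
  shows "matdist m n A B < real CARD('a) powi e \<longleftrightarrow> magree m n e A B"
  unfolding matdist_def matnorm_less_iff[OF assms(1,2)] magree_def
  using assms mat_space_laurent laurent_diff by (subst labs_less_iff) (blast, auto)

lemma matdist_cases:
  fixes A B :: "'a::{field,finite} lmat"
  assumes "m \<ge> 1" "n \<ge> 1" "A \<in> mat_space m n" "B \<in> mat_space m n"
  shows "matdist m n A B = 0 \<or> (\<exists>g. matdist m n A B = real CARD('a) powi g)"
proof -
  let ?S = "(\<lambda>(i, j). labs (\<lambda>d. A i j d - B i j d)) ` ({..<m} \<times> {..<n})"
  have "Max ?S \<in> ?S" by (rule Max_in) (use assms in \<open>auto simp: lessThan_empty_iff\<close>)
  then obtain i j where "Max ?S = labs (\<lambda>d. A i j d - B i j d)" by auto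
  moreover have "(\<lambda>d. A i j d - B i j d) \<in> laurent"
    using assms mat_space_laurent laurent_diff by blast
  ultimately show ?thesis using labs_cases[of "\<lambda>d. A i j d - B i j d"]
    by (simp add: matdist_def matnorm_eq)
qed

lemma matdist_nonneg:
  fixes A B :: "'a::{field,finite} lmat"
  assumes "m \<ge> 1" "n \<ge> 1" "A \<in> mat_space m n" "B \<in> mat_space m n"
  shows "0 \<le> matdist m n A B"
  using matdist_cases[OF assms] card_field_gt_1[where 'a = 'a] by auto

lemma matdist_zero_iff:
  fixes A B :: "'a::{field,finite} lmat"
  assumes "m \<ge> 1" "n \<ge> 1" "A \<in> mat_space m n" "B \<in> mat_space m n"
  shows "matdist m n A B = 0 \<longleftrightarrow> A = B"
proof
  assume "matdist m n A B = 0"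
  then have "magree m n e A B" for e
    using matdist_less_iff[OF assms, of e] card_field_gt_1[where 'a = 'a] by simp
  then have "A i j d = B i j d" if "i < m" "j < n" for i j d using that unfolding magree_def by blast
  moreover have "A i j = B i j" if "\<not> (i < m \<and> j < n)" for i j
    using that assms by (simp add: mat_space_def)
  ultimately show "A = B" by (intro ext) metis
next
  assume "A = B"
  then have "magree m n e A B" for e by simp
  then have "matdist m n A B < real CARD('a) powi e" for e
    using matdist_less_iff[OF assms, of e] by blast
  then show "matdist m n A B = 0" using matdist_cases[OF assms] by (metis less_irrefl)
qed

lemma lsnorm_less_iff: "n \<ge> 1 \<Longrightarrow> lsnorm n v < r \<longleftrightarrow> (\<forall>j<n. labs (v j) < r)"
  unfolding lsnorm_def by (subst Max_less_iff) (auto simp: lessThan_empty_iff)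

lemma lsnorm_nonneg: "n \<ge> 1 \<Longrightarrow> lsnorm n v \<ge> 0"
  unfolding lsnorm_def by (rule order_trans[OF labs_nonneg[of "v 0"] Max_ge]) auto

text \<open>Subtracting a polynomial vector can remove all coefficients at nonnegative powers and
  changes no others. Being strictly above an infimum only asks for one witness.\<close>

lemma vdist_less_iff:
  fixes v :: "nat \<Rightarrow> int \<Rightarrow> 'a::{field,finite}"
  assumes n: "n \<ge> 1" and v: "\<And>j. j < n \<Longrightarrow> v j \<in> laurent"
  shows "vdist n v < real CARD('a) powi r \<longleftrightarrow> (\<forall>j<n. \<forall>d. r \<le> d \<and> d < 0 \<longrightarrow> v j d = 0)"
proof -
  let ?f = "\<lambda>p. lsnorm n (\<lambda>j d. v j d - ls_of_poly (p j) d)"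
  have "(\<lambda>_. 0) \<in> (polyvecs n :: (nat \<Rightarrow> 'a poly) set)" by (simp add: polyvecs_def)
  then have ne: "?f ` polyvecs n \<noteq> {}" by blast
  have bdd: "bdd_below (?f ` polyvecs n)" by (rule bdd_belowI2[of _ 0]) (rule lsnorm_nonneg[OF n])
  have "vdist n v < real CARD('a) powi r \<longleftrightarrow> (\<exists>p\<in>polyvecs n. ?f p < real CARD('a) powi r)"
    unfolding vdist_def by (subst cInf_less_iff[OF ne bdd]) auto
  also have "\<dots> \<longleftrightarrow> (\<exists>p\<in>polyvecs n. \<forall>j<n. \<forall>d\<ge>r. v j d = ls_of_poly (p j) d)"
    using v by (intro bex_cong refl) (simp add: lsnorm_less_iff[OF n] labs_less_iff laurent_diff laurent_ls_of_poly)
  also have "\<dots> \<longleftrightarrow> (\<forall>j<n. \<forall>d. r \<le> d \<and> d < 0 \<longrightarrow> v j d = 0)"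
  proof
    assume "\<exists>p\<in>polyvecs n. \<forall>j<n. \<forall>d\<ge>r. v j d = ls_of_poly (p j) d"
    then show "\<forall>j<n. \<forall>d. r \<le> d \<and> d < 0 \<longrightarrow> v j d = 0" by (auto simp: ls_of_poly_def)
  next
    assume *: "\<forall>j<n. \<forall>d. r \<le> d \<and> d < 0 \<longrightarrow> v j d = 0"
    have "\<exists>p. \<forall>d\<ge>0. v j d = ls_of_poly p d" if "j < n" for j
    proof -
      have "v j \<in> laurent" using v that by blast
      then obtain N where N: "\<forall>d>N. v j d = 0" using laurent_D by blast
      have "v j d = ls_of_poly (\<Sum>e\<le>nat N. monom (v j (int e)) e) d" if "d \<ge> 0" for d
        using that N by (auto simp: ls_of_poly_def coeff_sum coeff_monom)
      then show ?thesis by blast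
    qed
    then obtain P where P: "\<And>j d. j < n \<Longrightarrow> d \<ge> 0 \<Longrightarrow> v j d = ls_of_poly (P j) d" by metis
    have "(\<lambda>j. if j < n then P j else 0) \<in> polyvecs n" by (simp add: polyvecs_def)
    moreover have "\<forall>j<n. \<forall>d\<ge>r. v j d = ls_of_poly (if j < n then P j else 0) d"
    proof (intro allI impI)
      fix j d assume "j < n" "r \<le> d"
      then show "v j d = ls_of_poly (if j < n then P j else 0) d"
        using P[of j d] * by (cases "d \<ge> 0") (auto simp: ls_of_poly_def)
    qed
    ultimately show "\<exists>p\<in>polyvecs n. \<forall>j<n. \<forall>d\<ge>r. v j d = ls_of_poly (p j) d"
      by (intro bexI[of _ "\<lambda>j. if j < n then P j else 0"])
  qed
  finally show ?thesis .
qed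

section \<open>Matrices and their digit arrays\<close>

definition trunc :: "nat \<Rightarrow> nat \<Rightarrow> nat \<Rightarrow> 'a::zero lmat \<Rightarrow> 'a cellfun" where
  "trunc m n L A = (\<lambda>(i, j, l). if (i, j, l) \<in> cells m n L then A i j (- int l) else 0)"

definition embed :: "'a::zero cellfun \<Rightarrow> 'a lmat" where
  "embed x = (\<lambda>i j d. if d < 0 then x (i, j, nat (- d)) else 0)"

lemma trunc_in [simp]: "trunc m n L A \<in> supp_on (cells m n L)"
  by (auto simp: trunc_def supp_on_def)

text \<open>No depth bound is imposed on \<open>x\<close>, since the limit point of the Cantor
  construction has infinitely many digits.\<close>

lemma embed_in_mat_space:
  assumes "\<And>i j l. \<not> (i < m \<and> j < n) \<Longrightarrow> x (i, j, l) = 0"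
  shows "embed x \<in> mat_space m n"
proof -
  have "embed x i j \<in> laurent" for i j
    unfolding laurent_def embed_def by (auto intro!: exI[of _ 0])
  then show ?thesis using assms by (auto simp: mat_space_def embed_def fun_eq_iff)
qed

lemma embed_in:
  assumes "x \<in> supp_on (cells m n L)" shows "embed x \<in> mat_space m n"
  by (rule embed_in_mat_space) (use assms in \<open>simp add: supp_on_def cells_def\<close>)

lemma agree_trunc_iff:
  assumes "f \<le> L" "f \<le> L'"
  shows "agree m n f (trunc m n L A) (trunc m n L' B) \<longleftrightarrow> (\<forall>i<m. \<forall>j<n. \<forall>d. - int f \<le> d \<and> d < 0 \<longrightarrow> A i j d = B i j d)"
proof
  assume *: "agree m n f (trunc m n L A) (trunc m n L' B)"
  show "\<forall>i<m. \<forall>j<n. \<forall>d. - int f \<le> d \<and> d < 0 \<longrightarrow> A i j d = B i j d"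
  proof (intro allI impI)
    fix i j d assume d: "i < m" "j < n" "- int f \<le> d \<and> d < 0"
    then have l: "nat (- d) \<in> {1..f}" by auto
    then have "(i, j, nat (- d)) \<in> cells m n L" "(i, j, nat (- d)) \<in> cells m n L'"
      using d assms by (auto simp: cells_def)
    moreover have "trunc m n L A (i, j, nat (- d)) = trunc m n L' B (i, j, nat (- d))"
      using * l d unfolding agree_def by blast
    ultimately show "A i j d = B i j d" using d by (simp add: trunc_def)
  qed
next
  assume "\<forall>i<m. \<forall>j<n. \<forall>d. - int f \<le> d \<and> d < 0 \<longrightarrow> A i j d = B i j d"
  then show "agree m n f (trunc m n L A) (trunc m n L' B)"
    using assms unfolding agree_def trunc_def cells_def by auto
qed

lemma embed_magree_iff:
  assumes "x \<in> supp_on (cells m n L)" "f \<le> L" "\<forall>i<m. \<forall>j<n. \<forall>d\<ge>0. B i j d = 0"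
  shows "magree m n (- int f) B (embed x) \<longleftrightarrow> agree m n f (trunc m n L B) x"
proof
  assume "magree m n (- int f) B (embed x)"
  then show "agree m n f (trunc m n L B) x"
    using assms(2) unfolding magree_def agree_def trunc_def cells_def embed_def by force
next
  assume *: "agree m n f (trunc m n L B) x"
  show "magree m n (- int f) B (embed x)"
    unfolding magree_def
  proof (intro allI impI)
    fix i j d assume d: "i < m" "j < n" "- int f \<le> d"
    show "B i j d = embed x i j d"
    proof (cases "d < 0")
      case True
      then have l: "nat (- d) \<in> {1..f}" using d by auto
      then have "(i, j, nat (- d)) \<in> cells m n L" using d assms(2) by (auto simp: cells_def)
      moreover have "trunc m n L B (i, j, nat (- d)) = x (i, j, nat (- d))" using * l d unfolding agree_def by blast
      ultimately show ?thesis using True by (simp add: trunc_def embed_def)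
    qed (use assms d in \<open>simp add: embed_def\<close>)
  qed
qed

lemma trunc_embed:
  assumes "x \<in> supp_on (cells m n L)" "L \<le> L'" shows "trunc m n L' (embed x) = x"
proof
  fix u :: "nat \<times> nat \<times> nat"
  obtain i j l where u: "u = (i, j, l)" by (cases u)
  have "x (i, j, l) = 0" if "(i, j, l) \<notin> cells m n L'"
    using assms that cells_mono[OF assms(2), of m n] by (auto simp: supp_on_def)
  then show "trunc m n L' (embed x) u = x u" by (auto simp: u trunc_def embed_def cells_def)
qed

text \<open>For \<open>d \<ge> 1\<close> the coefficient of \<open>X^(-d)\<close> of
  \<open>q A\<close> involves only coefficients of \<open>A\<close> at \<open>X^(-d)\<close> down to
  \<open>X^(-t-d)\<close>. The integer part of \<open>A\<close> drops out and truncation at depth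
  \<open>L\<close> loses nothing.\<close>

lemma vecmat_qrow:
  assumes q: "\<And>i. i < m \<Longrightarrow> degree (q i) \<le> t" and L: "t + d \<le> L" and d: "d \<ge> 1" and j: "j < n"
  shows "vecmat m n q A j (- int d) = qrow m q t (trunc m n L A) j (t + d)"
proof -
  have "pmul (q i) (A i j) (- int d) = (\<Sum>s\<le>t. coeff (q i) (t - s) * trunc m n L A (i, j, t + d - s))"
    if i: "i < m" for i
  proof -
    have "pmul (q i) (A i j) (- int d) = (\<Sum>e\<le>t. coeff (q i) e * A i j (- int d - int e))"
      unfolding pmul_def using q[OF i] by (intro sum.mono_neutral_left) (auto simp: coeff_eq_0)
    also have "\<dots> = (\<Sum>s\<le>t. coeff (q i) (t - s) * A i j (- int d - int (t - s)))"
      by (rule sum.reindex_bij_witness[where i = "\<lambda>s. t - s" and j = "\<lambda>s. t - s"]) auto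
    also have "\<dots> = (\<Sum>s\<le>t. coeff (q i) (t - s) * trunc m n L A (i, j, t + d - s))"
    proof (intro sum.cong refl)
      fix s assume "s \<in> {..t}"
      then have "(i, j, t + d - s) \<in> cells m n L" "- int d - int (t - s) = - int (t + d - s)"
        using i j L d by (auto simp: cells_def)
      then show "coeff (q i) (t - s) * A i j (- int d - int (t - s)) = coeff (q i) (t - s) * trunc m n L A (i, j, t + d - s)"
        by (simp add: trunc_def)
    qed
    finally show ?thesis .
  qed
  then show ?thesis using j by (simp add: vecmat_def qrow_def)
qed

lemma vdist_vecmat_less_iff:
  fixes q :: "nat \<Rightarrow> 'a::{field,finite} poly"
  assumes n: "n \<ge> 1" and A: "A \<in> mat_space m n"
    and q: "\<And>i. i < m \<Longrightarrow> degree (q i) \<le> t" and L: "t + b \<le> L"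
  shows "vdist n (vecmat m n q A) < real CARD('a) powi (- int b) \<longleftrightarrow> near m n q t b (trunc m n L A)"
proof -
  have "vecmat m n q A j \<in> laurent" if "j < n" for j
    unfolding vecmat_def using that A by (simp add: laurent_sum laurent_pmul mat_space_laurent)
  then have "vdist n (vecmat m n q A) < real CARD('a) powi (- int b) \<longleftrightarrow>
    (\<forall>j<n. \<forall>d. - int b \<le> d \<and> d < 0 \<longrightarrow> vecmat m n q A j d = 0)"
    by (rule vdist_less_iff[OF n])
  also have "\<dots> \<longleftrightarrow> (\<forall>j<n. \<forall>l\<in>{t+1..t+b}. qrow m q t (trunc m n L A) j l = 0)"
  proof (intro all_cong1 imp_cong refl iffI allI impI ballI)
    fix j l assume j: "j < n" and *: "\<forall>d. - int b \<le> d \<and> d < 0 \<longrightarrow> vecmat m n q A j d = 0" and l: "l \<in> {t+1..t+b}"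
    have "qrow m q t (trunc m n L A) j (t + (l - t)) = vecmat m n q A j (- int (l - t))"
      using q L l j by (intro vecmat_qrow[symmetric]) auto
    then show "qrow m q t (trunc m n L A) j l = 0" using * l by auto
  next
    fix j d assume j: "j < n" and *: "\<forall>l\<in>{t+1..t+b}. qrow m q t (trunc m n L A) j l = 0" and d: "- int b \<le> d \<and> d < 0"
    have "vecmat m n q A j (- int (nat (- d))) = qrow m q t (trunc m n L A) j (t + nat (- d))"
      using q L d j by (intro vecmat_qrow) auto
    moreover have "t + nat (- d) \<in> {t+1..t+b}" using d by auto
    ultimately show "vecmat m n q A j d = 0" using * d by auto
  qed
  finally show ?thesis by (simp add: near_def)
qed

section \<open>Degree and norm of polynomial vectors\<close>

definition vdeg :: "nat \<Rightarrow> (nat \<Rightarrow> 'a::zero poly) \<Rightarrow> nat" where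
  "vdeg m q = Max ((\<lambda>i. degree (q i)) ` {..<m})"

lemma degree_le_vdeg: "i < m \<Longrightarrow> degree (q i) \<le> vdeg m q"
  unfolding vdeg_def by (intro Max_ge) auto

lemma vdeg_attained:
  assumes "i < m" "q i \<noteq> 0"
  shows "\<exists>i<m. coeff (q i) (vdeg m q) \<noteq> 0"
proof -
  have "vdeg m q \<in> (\<lambda>i. degree (q i)) ` {..<m}" unfolding vdeg_def using assms by (intro Max_in) auto
  then obtain i' where i': "i' < m" "degree (q i') = vdeg m q" by auto
  show ?thesis
  \<comment> \<open>The zero polynomial also has degree 0, so the maximum may be attained at a zero
    entry; then all degrees are 0 and the given entry is a nonzero constant.\<close>
  proof (cases "q i' = 0")
    case True
    then have "vdeg m q = 0" using i' by simp
    then have "degree (q i) = vdeg m q" using degree_le_vdeg[of i m q] assms by simp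
    then show ?thesis using assms leading_coeff_0_iff by metis
  next
    case False
    then show ?thesis using i' leading_coeff_0_iff by metis
  qed
qed

lemma vnorm_eq:
  fixes q :: "nat \<Rightarrow> 'a::{field,finite} poly"
  assumes "i < m" "q i \<noteq> 0"
  shows "vnorm m q = real CARD('a) ^ vdeg m q"
proof -
  obtain i' where i': "i' < m" "coeff (q i') (vdeg m q) \<noteq> 0" using vdeg_attained assms by blast
  then have "degree (q i') = vdeg m q" using degree_le_vdeg[of i' m q] le_degree by (metis le_antisym)
  then have "real CARD('a) ^ vdeg m q \<in> (\<lambda>i. pabs (q i)) ` {..<m}"
    using i' by (auto simp: pabs_def intro!: image_eqI[of _ _ i'])
  moreover have "pabs (q i) \<le> real CARD('a) ^ vdeg m q" if "i < m" for i
    using degree_le_vdeg[OF that, of q] card_field_gt_1[where 'a = 'a] by (auto simp: pabs_def)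
  ultimately show ?thesis unfolding vnorm_def by (intro Max_eqI) auto
qed

lemma finite_polyvecs_vdeg_le: "finite {q :: nat \<Rightarrow> 'a::{zero,finite} poly. q \<in> polyvecs m \<and> vdeg m q \<le> t}"
proof (rule finite_subset)
  let ?D = "{p :: 'a poly. degree p \<le> t}"
  show "{q. q \<in> polyvecs m \<and> vdeg m q \<le> t} \<subseteq> {q. \<forall>i. (i \<in> {..<m} \<longrightarrow> q i \<in> ?D) \<and> (i \<notin> {..<m} \<longrightarrow> q i = 0)}"
  proof (intro subsetI CollectI allI conjI impI)
    fix q :: "nat \<Rightarrow> 'a poly" and i assume q: "q \<in> {q. q \<in> polyvecs m \<and> vdeg m q \<le> t}"
    show "degree (q i) \<le> t" if "i \<in> {..<m}" using degree_le_vdeg[of i m q] that q by simp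
    show "q i = 0" if "i \<notin> {..<m}" using that q by (simp add: polyvecs_def)
  qed
  show "finite {q. \<forall>i. (i \<in> {..<m} \<longrightarrow> q i \<in> ?D) \<and> (i \<notin> {..<m} \<longrightarrow> q i = (0 :: 'a poly))}"
    by (intro finite_set_of_finite_funs finite_degree_le) auto
qed

lemma polyvecs_nonzero: "q \<in> polyvecs m \<Longrightarrow> q \<noteq> (\<lambda>_. 0) \<Longrightarrow> \<exists>i<m. q i \<noteq> 0"
  unfolding polyvecs_def fun_eq_iff by (metis (mono_tags) mem_Collect_eq not_less)

section \<open>Hausdorff content\<close>

definition mball :: "nat \<Rightarrow> nat \<Rightarrow> int \<Rightarrow> 'a::zero lmat \<Rightarrow> 'a lmat set" where
  "mball m n e C = {A \<in> mat_space m n. magree m n e A C}"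

text \<open>Unlike Hausdorff measure this puts no bound on the size of the covering balls; for \<open>s > 0\<close> the
  null sets are the same, and for \<open>s = m n\<close> it is the Haar outer measure.\<close>

definition hcontent :: "nat \<Rightarrow> nat \<Rightarrow> real \<Rightarrow> 'a::{field,finite} lmat set \<Rightarrow> ennreal" where
  "hcontent m n s E = (INF (C, r) \<in> {(C, r). (\<forall>i. C i \<in> mat_space m n) \<and> E \<subseteq> (\<Union>i. mball m n (r i) (C i))}.
     (\<Sum>i. ennreal (real CARD('a) powr (s * real_of_int (r i)))))"

lemma hcontent_le:
  fixes C :: "nat \<Rightarrow> 'a::{field,finite} lmat"
  assumes "\<And>i. C i \<in> mat_space m n" "E \<subseteq> (\<Union>i. mball m n (r i) (C i))"
  shows "hcontent m n s E \<le> (\<Sum>i. ennreal (real CARD('a) powr (s * real_of_int (r i))))"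
  unfolding hcontent_def by (rule INF_lower2[of "(C, r)"]) (use assms in auto)

lemma hcontent_lessE:
  fixes E :: "'a::{field,finite} lmat set"
  assumes "hcontent m n s E < a"
  obtains C r where "\<And>i. C i \<in> mat_space m n" "E \<subseteq> (\<Union>i. mball m n (r i) (C i))"
    "(\<Sum>i. ennreal (real CARD('a) powr (s * real_of_int (r i)))) < a"
  using assms unfolding hcontent_def INF_less_iff by auto

lemma hcontent_mono: "E \<subseteq> F \<Longrightarrow> hcontent m n s E \<le> hcontent m n s F"
  unfolding hcontent_def by (rule INF_superset_mono) auto

lemma ennreal_zeroI:
  assumes "\<And>e::real. e > 0 \<Longrightarrow> x \<le> ennreal e" shows "x = 0"
proof -
  have "x \<le> 0" by (rule ennreal_le_epsilon) (use assms in simp)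
  then show ?thesis by simp
qed

lemma suminf_eps_half: "e > 0 \<Longrightarrow> (\<Sum>i. ennreal (e * (1/2) ^ Suc i)) = ennreal e"
  by (rule suminf_ennreal_eq) (use sums_mult[OF power_half_series, of e] in \<open>simp_all del: power_Suc\<close>)

lemma hcontent_UN_less:
  assumes "\<And>i::nat. hcontent m n s (E i) < a i"
  shows "hcontent m n s (\<Union>i. E i) \<le> (\<Sum>i. a i)"
proof -
  have "\<forall>i. \<exists>C r. (\<forall>j. C j \<in> mat_space m n) \<and> E i \<subseteq> (\<Union>j. mball m n (r j) (C j)) \<and>
      (\<Sum>j. ennreal (real CARD('a) powr (s * real_of_int (r j)))) < a i"
    by (rule allI, rule hcontent_lessE[OF assms]) blast
  from choice[OF this] obtain C where
    "\<forall>i. \<exists>r. (\<forall>j. C i j \<in> mat_space m n) \<and> E i \<subseteq> (\<Union>j. mball m n (r j) (C i j)) \<and>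
      (\<Sum>j. ennreal (real CARD('a) powr (s * real_of_int (r j)))) < a i" ..
  from choice[OF this] obtain r where C: "\<And>i j. C i j \<in> mat_space m n" "\<And>i. E i \<subseteq> (\<Union>j. mball m n (r i j) (C i j))"
      "\<And>i. (\<Sum>j. ennreal (real CARD('a) powr (s * real_of_int (r i j)))) < a i"
    by blast
  define f where "f = (\<lambda>(i, j). ennreal (real CARD('a) powr (s * real_of_int (r i j))))"
  have "hcontent m n s (\<Union>i. E i) \<le> (\<Sum>p. ennreal (real CARD('a) powr (s * real_of_int (case prod_decode p of (i, j) \<Rightarrow> r i j))))"
  proof (rule hcontent_le[where C = "\<lambda>p. case prod_decode p of (i, j) \<Rightarrow> C i j"])
    show "(case prod_decode p of (i, j) \<Rightarrow> C i j) \<in> mat_space m n" for p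
      using C(1) by (simp split: prod.split)
    show "(\<Union>i. E i) \<subseteq> (\<Union>p. mball m n (case prod_decode p of (i, j) \<Rightarrow> r i j) (case prod_decode p of (i, j) \<Rightarrow> C i j))"
    proof
      fix A assume "A \<in> (\<Union>i. E i)"
      then obtain i j where "A \<in> mball m n (r i j) (C i j)" using C(2) by blast
      then show "A \<in> (\<Union>p. mball m n (case prod_decode p of (i, j) \<Rightarrow> r i j) (case prod_decode p of (i, j) \<Rightarrow> C i j))"
        by (intro UN_I[of "prod_encode (i, j)"]) auto
    qed
  qed
  also have "\<dots> = (\<Sum>p. f (prod_decode p))"
    by (simp add: f_def case_prod_unfold)
  also have "\<dots> = (\<Sum>i. \<Sum>j. f (i, j))"
    by (rule suminf_ennreal_2dimen[where f = f, unfolded comp_def]) simp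
  also have "\<dots> \<le> (\<Sum>i. a i)"
    using C(3) by (intro suminf_le) (auto simp: f_def less_imp_le)
  finally show ?thesis .
qed

lemma hcontent_UN_le:
  assumes "\<And>i::nat. hcontent m n s (E i) \<le> ennreal (b i)" "\<And>i. b i \<ge> 0"
  shows "hcontent m n s (\<Union>i. E i) \<le> (\<Sum>i. ennreal (b i))"
proof (rule ennreal_le_epsilon)
  fix e :: real assume e: "e > 0"
  have "hcontent m n s (E i) < ennreal (b i + e * (1/2) ^ Suc i)" for i
    by (rule le_less_trans[OF assms(1)]) (use e assms(2) in \<open>simp add: ennreal_less_iff\<close>)
  then have "hcontent m n s (\<Union>i. E i) \<le> (\<Sum>i. ennreal (b i + e * (1/2) ^ Suc i))"
    by (rule hcontent_UN_less)
  also have "\<dots> = (\<Sum>i. ennreal (b i) + ennreal (e * (1/2) ^ Suc i))"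
    using e assms(2) by (simp del: power_Suc)
  also have "\<dots> = (\<Sum>i. ennreal (b i)) + (\<Sum>i. ennreal (e * (1/2) ^ Suc i))"
    by (rule suminf_add[symmetric]) auto
  also have "\<dots> = (\<Sum>i. ennreal (b i)) + ennreal e" by (simp only: suminf_eps_half[OF e])
  finally show "hcontent m n s (\<Union>i. E i) \<le> (\<Sum>i. ennreal (b i)) + ennreal e" .
qed

lemma hcontent_null_UN:
  assumes "countable I" "\<And>i. i \<in> I \<Longrightarrow> hcontent m n s (E i) = 0" "I \<noteq> {}"
  shows "hcontent m n s (\<Union>i\<in>I. E i) = 0"
proof -
  have "(\<Union>i\<in>I. E i) = (\<Union>j. E (from_nat_into I j))"
    by (subst range_from_nat_into[OF assms(3,1), symmetric]) (simp add: image_image)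
  also have "hcontent m n s \<dots> \<le> (\<Sum>j::nat. ennreal 0)"
    using assms by (intro hcontent_UN_le) (auto simp: from_nat_into)
  finally show ?thesis by simp
qed

lemma small_radius:
  assumes "s > 0" "e > 0"
  shows "\<exists>r::int. real CARD('a::{field,finite}) powr (s * real_of_int r) \<le> e"
proof -
  let ?k = "real CARD('a)"
  define r where "r = \<lfloor>log ?k e / s\<rfloor>"
  have "s * real_of_int r \<le> log ?k e"
    using mult_left_mono[OF of_int_floor_le[of "log ?k e / s"], of s] assms unfolding r_def by simp
  then have "?k powr (s * real_of_int r) \<le> ?k powr log ?k e"
    using card_field_gt_1[where 'a = 'a] by simp
  also have "\<dots> = e" using card_field_gt_1[where 'a = 'a] assms by simp
  finally show ?thesis by blast
qed

lemma zero_in_mat_space: "(\<lambda>_ _ _. 0) \<in> mat_space m n"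
  by (simp add: mat_space_def)

text \<open>A cover is an infinite sequence of balls, so the ball is padded with balls of
  geometrically decreasing cost of total at most \<open>\<epsilon>\<close>; \<open>s > 0\<close>
  makes such cheap balls available.\<close>

lemma hcontent_ball:
  fixes C :: "'a::{field,finite} lmat"
  assumes s: "s > 0" and C: "C \<in> mat_space m n"
  shows "hcontent m n s (mball m n e C) \<le> ennreal (real CARD('a) powr (s * real_of_int e))"
proof (rule ennreal_le_epsilon)
  fix \<epsilon> :: real assume \<epsilon>: "\<epsilon> > 0"
  have "\<exists>r::int. real CARD('a) powr (s * real_of_int r) \<le> \<epsilon> * (1/2) ^ Suc i" for i
    by (rule small_radius) (use s \<epsilon> in auto)
  then obtain r :: "nat \<Rightarrow> int" where r: "\<And>i. real CARD('a) powr (s * real_of_int (r i)) \<le> \<epsilon> * (1/2) ^ Suc i"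
    by metis
  define r' where "r' i = (case i of 0 \<Rightarrow> e | Suc i \<Rightarrow> r i)" for i
  let ?f = "\<lambda>i. ennreal (real CARD('a) powr (s * real_of_int (r' i)))"
  have "hcontent m n s (mball m n e C) \<le> (\<Sum>i. ?f i)"
  proof (rule hcontent_le[where C = "\<lambda>_. C"])
    show "mball m n e C \<subseteq> (\<Union>i. mball m n (r' i) C)" by (intro subsetI UN_I[of 0]) (auto simp: r'_def)
  qed (use C in simp)
  also have "\<dots> = (\<Sum>i. ?f (i + 1)) + (\<Sum>i<1. ?f i)"
    by (rule suminf_offset) simp
  also have "(\<Sum>i<1. ?f i) = ennreal (real CARD('a) powr (s * real_of_int e))" by (simp add: r'_def)
  also have "(\<Sum>i. ?f (i + 1)) \<le> (\<Sum>i. ennreal (\<epsilon> * (1/2) ^ Suc i))"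
    using r by (intro suminf_le) (auto simp: r'_def simp del: power_Suc intro!: ennreal_leI)
  also have "\<dots> = ennreal \<epsilon>" by (rule suminf_eps_half[OF \<epsilon>])
  finally show "hcontent m n s (mball m n e C) \<le> ennreal (real CARD('a) powr (s * real_of_int e)) + ennreal \<epsilon>"
    by (simp add: add.commute)
qed

lemma hcontent_finite_balls:
  fixes G :: "'a::{field,finite} lmat set"
  assumes s: "s > 0" and G: "finite G" "G \<subseteq> mat_space m n"
  shows "hcontent m n s (\<Union>C\<in>G. mball m n e C) \<le> ennreal (real (card G) * real CARD('a) powr (s * real_of_int e))"
proof -
  let ?c = "real CARD('a) powr (s * real_of_int e)"
  obtain h where h: "bij_betw h {..<card G} G"
    using ex_bij_betw_nat_finite[OF G(1)] by (auto simp: atLeast0LessThan)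
  define E where "E i = (if i < card G then mball m n e (h i) else {})" for i
  have hG: "h i \<in> G" if "i < card G" for i using bij_betw_apply[OF h, of i] that by simp
  have "(\<Union>C\<in>h ` {..<card G}. mball m n e C) = (\<Union>i<card G. mball m n e (h i))"
    by (simp add: image_image)
  then have "(\<Union>C\<in>G. mball m n e C) = (\<Union>i<card G. mball m n e (h i))"
    by (simp only: bij_betw_imp_surj_on[OF h])
  also have "\<dots> = (\<Union>i. E i)" by (auto simp: E_def split: if_splits)
  also have "hcontent m n s \<dots> \<le> (\<Sum>i. ennreal (if i < card G then ?c else 0))"
  proof (rule hcontent_UN_le)
    fix i
    have "hcontent m n s ({} :: 'a lmat set) \<le> ennreal \<epsilon>" if \<epsilon>: "\<epsilon> > 0" for \<epsilon>
    proof -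
      obtain r :: int where "real CARD('a) powr (s * real_of_int r) \<le> \<epsilon>" using small_radius[OF s \<epsilon>] by blast
      then have "hcontent m n s (mball m n r (\<lambda>_ _ _. 0 :: 'a)) \<le> ennreal \<epsilon>"
        by (rule order_trans[OF hcontent_ball[OF s zero_in_mat_space] ennreal_leI])
      then show ?thesis by (rule order_trans[OF hcontent_mono, rotated]) simp
    qed
    then have "hcontent m n s ({} :: 'a lmat set) = 0" by (rule ennreal_zeroI)
    then show "hcontent m n s (E i) \<le> ennreal (if i < card G then ?c else 0)"
    proof (cases "i < card G")
      case True
      then have "h i \<in> mat_space m n" using G hG by blast
      then show ?thesis using True hcontent_ball[OF s] by (simp add: E_def)
    qed (simp add: E_def)
  qed auto
  also have "\<dots> = (\<Sum>i<card G. ennreal (if i < card G then ?c else 0))"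
    by (rule suminf_finite) auto
  also have "\<dots> = ennreal (real (card G) * ?c)"
    by (simp add: ennreal_of_nat_eq_real_of_nat ennreal_mult)
  finally show ?thesis .
qed

section \<open>Comparison of content with Haar and Hausdorff measure\<close>

lemma haar_outer_eq_0:
  fixes E :: "'a::{field,finite} lmat set"
  assumes mn: "m \<ge> 1" "n \<ge> 1" and "hcontent m n (real (m * n)) E = 0"
  shows "haar_outer m n E = 0"
proof (rule ennreal_zeroI)
  fix e :: real assume "e > 0"
  then have "hcontent m n (real (m * n)) E < ennreal e" using assms by simp
  then obtain C :: "nat \<Rightarrow> 'a lmat" and r where C: "\<And>i. C i \<in> mat_space m n"
     "E \<subseteq> (\<Union>i. mball m n (r i) (C i))"
     "(\<Sum>i. ennreal (real CARD('a) powr (real (m * n) * real_of_int (r i)))) < ennreal e"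
    by (rule hcontent_lessE) blast
  have "mball m n (r i) (C i) = {A \<in> mat_space m n. matdist m n A (C i) < real CARD('a) powi r i}" for i
    using matdist_less_iff[OF mn _ C(1)] by (auto simp: mball_def)
  moreover have "real CARD('a) powr (real (m * n) * real_of_int r) = real CARD('a) powi (int (m * n) * r)" for r
    using powr_real_of_int'[of "real CARD('a)" "int (m * n) * r"] card_field_gt_1[where 'a = 'a] by simp
  ultimately have "haar_outer m n E \<le> (\<Sum>i. ennreal (real CARD('a) powr (real (m * n) * real_of_int (r i))))"
    unfolding haar_outer_def using C by (intro INF_lower2[of "(C, r)"]) auto
  then show "haar_outer m n E \<le> ennreal e" using C(3) by simp
qed

lemma mdiam_nonneg:
  fixes U :: "'a::{field,finite} lmat set"
  assumes mn: "m \<ge> 1" "n \<ge> 1" and U: "U \<subseteq> mat_space m n"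
    and d: "\<And>A B. A \<in> U \<Longrightarrow> B \<in> U \<Longrightarrow> matdist m n A B \<le> \<delta>"
  shows "A \<in> U \<Longrightarrow> B \<in> U \<Longrightarrow> matdist m n A B \<le> mdiam m n U" "mdiam m n U \<ge> 0"
    "\<delta> \<ge> 0 \<Longrightarrow> mdiam m n U \<le> \<delta>"
proof -
  let ?S = "{matdist m n A B | A B. A \<in> U \<and> B \<in> U}"
  have bdd: "bdd_above ?S" by (rule bdd_aboveI[of _ \<delta>]) (use d in auto)
  show le: "matdist m n A B \<le> mdiam m n U" if "A \<in> U" "B \<in> U" for A B
    using that cSup_upper[OF _ bdd, of "matdist m n A B"] by (auto simp: mdiam_def)
  show "mdiam m n U \<ge> 0"
  proof (cases "U = {}")
    case False
    then obtain A where A: "A \<in> U" by blast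
    then show ?thesis using le[OF A A] matdist_nonneg[OF mn, of A A] U by auto
  qed (simp add: mdiam_def)
  show "mdiam m n U \<le> \<delta>" if "\<delta> \<ge> 0"
  proof (cases "U = {}")
    case False
    then have "?S \<noteq> {}" by blast
    then have "Sup ?S \<le> \<delta>" by (rule cSup_least) (use d in auto)
    then show ?thesis using False by (simp add: mdiam_def)
  qed (use that in \<open>simp add: mdiam_def\<close>)
qed

text \<open>A cover of total cost below \<open>\<delta> powr s\<close> consists of balls of radius
  at most \<open>\<delta>\<close>, so for null sets the size restriction takes care of
  itself.\<close>

lemma hausdorff_eq_0:
  fixes E :: "'a::{field,finite} lmat set"
  assumes mn: "m \<ge> 1" "n \<ge> 1" and s: "s > 0" and E: "hcontent m n s E = 0"
  shows "hausdorff m n s E = 0"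
proof -
  let ?k = "real CARD('a)"
  have k1: "?k > 1" by (rule card_field_gt_1)
  have "hausdorff_pre m n s \<delta> E = 0" if \<delta>: "\<delta> > 0" for \<delta>
  proof (rule ennreal_zeroI)
    fix e :: real assume e: "e > 0"
    define e' where "e' = min e (\<delta> powr s)"
    have e': "e' > 0" "e' \<le> e" "e' \<le> \<delta> powr s" using e \<delta> by (auto simp: e'_def)
    then have "hcontent m n s E < ennreal e'" using E by simp
    then obtain C :: "nat \<Rightarrow> 'a lmat" and r where C: "\<And>i. C i \<in> mat_space m n"
       "E \<subseteq> (\<Union>i. mball m n (r i) (C i))"
       "(\<Sum>i. ennreal (?k powr (s * real_of_int (r i)))) < ennreal e'"
      by (rule hcontent_lessE) blast
    have rd: "?k powr real_of_int (r i) \<le> \<delta>" for i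
    proof -
      have "(\<Sum>i\<in>{i}. ennreal (?k powr (s * real_of_int (r i)))) \<le> (\<Sum>i. ennreal (?k powr (s * real_of_int (r i))))"
        by (rule sum_le_suminf) auto
      then have "ennreal (?k powr (s * real_of_int (r i))) \<le> (\<Sum>i. ennreal (?k powr (s * real_of_int (r i))))"
        by (simp only: sum.insert finite.emptyI empty_iff not_False_eq_True sum.empty add_0_right)
      then have "ennreal (?k powr (s * real_of_int (r i))) < ennreal e'" using C(3) by (rule le_less_trans)
      then have "?k powr (s * real_of_int (r i)) < e'" by (rule ennreal_less_iff[THEN iffD1, rotated]) simp
      then have "(?k powr real_of_int (r i)) powr s \<le> \<delta> powr s"
        using e'(3) by (simp add: powr_powr mult.commute)
      moreover have "\<delta> powr s < (?k powr real_of_int (r i)) powr s" if "\<not> ?thesis"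
        using that s \<delta> by (intro powr_less_mono2) auto
      ultimately show ?thesis by linarith
    qed
    have dist: "matdist m n A B \<le> ?k powr real_of_int (r i)"
      if "A \<in> mball m n (r i) (C i)" "B \<in> mball m n (r i) (C i)" for A B i
    proof -
      have "magree m n (r i) A B" "A \<in> mat_space m n" "B \<in> mat_space m n"
        using that magree_trans magree_sym by (auto simp: mball_def) blast
      then have "matdist m n A B < ?k powi r i" using matdist_less_iff[OF mn] by blast
      then show ?thesis using powr_real_of_int'[of ?k "r i"] k1 by simp
    qed
    have diam: "0 \<le> mdiam m n (mball m n (r i) (C i))" "mdiam m n (mball m n (r i) (C i)) \<le> ?k powr real_of_int (r i)" for i
      using mdiam_nonneg(2,3)[OF mn, of "mball m n (r i) (C i)" "?k powr real_of_int (r i)"] dist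
      by (auto simp: mball_def)
    have "hausdorff_pre m n s \<delta> E \<le> (\<Sum>i. ennreal (mdiam m n (mball m n (r i) (C i)) powr s))"
      unfolding hausdorff_pre_def
    proof (rule INF_lower, safe)
      show "\<And>i A. A \<in> mball m n (r i) (C i) \<Longrightarrow> A \<in> mat_space m n" by (simp add: mball_def)
      show "\<And>i A B. A \<in> mball m n (r i) (C i) \<Longrightarrow> B \<in> mball m n (r i) (C i) \<Longrightarrow> matdist m n A B \<le> \<delta>"
        using dist rd order_trans by blast
      show "\<And>A. A \<in> E \<Longrightarrow> A \<in> (\<Union>i. mball m n (r i) (C i))" using C(2) by blast
    qed
    also have "\<dots> \<le> (\<Sum>i. ennreal (?k powr (s * real_of_int (r i))))"
    proof (intro suminf_le ennreal_leI summableI)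
      fix i
      have "mdiam m n (mball m n (r i) (C i)) powr s \<le> (?k powr real_of_int (r i)) powr s"
        using diam s by (intro powr_mono2) auto
      then show "mdiam m n (mball m n (r i) (C i)) powr s \<le> ?k powr (s * real_of_int (r i))"
        by (simp add: powr_powr mult.commute)
    qed
    also have "\<dots> \<le> ennreal e" using C(3) e' by (meson ennreal_leI less_imp_le order_trans)
    finally show "hausdorff_pre m n s \<delta> E \<le> ennreal e" .
  qed
  then show ?thesis unfolding hausdorff_def by simp
qed

lemma hcontent_eq_0:
  fixes E :: "'a::{field,finite} lmat set"
  assumes mn: "m \<ge> 1" "n \<ge> 1" and s: "0 \<le> s" "s \<le> s'" "0 < s'" and H: "hausdorff m n s E = 0"
  shows "hcontent m n s' E = 0"
proof (rule ennreal_zeroI)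
  let ?k = "real CARD('a)"
  have k1: "?k > 1" by (rule card_field_gt_1)
  fix e0 :: real assume e0: "e0 > 0"
  define e where "e = e0 / (?k powr s' + 1)"
  have den: "?k powr s' + 1 > 0" using powr_ge_zero[of ?k s'] by linarith
  have e: "e > 0" "?k powr s' * e + e = e0"
  proof -
    have "e * (?k powr s' + 1) = e0" using den unfolding e_def by simp
    then show "?k powr s' * e + e = e0" by (simp add: algebra_simps)
  qed (use e0 den in \<open>simp add: e_def\<close>)
  have "hausdorff_pre m n s 1 E \<le> hausdorff m n s E"
    unfolding hausdorff_def by (rule SUP_upper) simp
  then have "hausdorff_pre m n s 1 E < ennreal e" using H e by simp
  then obtain U where "U \<in> {U. (\<forall>i. U i \<subseteq> mat_space m n \<and> (\<forall>A\<in>U i. \<forall>B\<in>U i. matdist m n A B \<le> 1)) \<and> E \<subseteq> (\<Union>i. U i)}"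
      and U4: "(\<Sum>i. ennreal (mdiam m n (U i) powr s)) < ennreal e"
    unfolding hausdorff_pre_def INF_less_iff by (elim bexE)
  then have U0: "\<forall>i. U i \<subseteq> mat_space m n \<and> (\<forall>A\<in>U i. \<forall>B\<in>U i. matdist m n A B \<le> 1)" "E \<subseteq> (\<Union>i. U i)"
    by simp_all
  have U: "\<And>i. U i \<subseteq> mat_space m n" "\<And>i A B. A \<in> U i \<Longrightarrow> B \<in> U i \<Longrightarrow> matdist m n A B \<le> 1"
      "E \<subseteq> (\<Union>i. U i)" "(\<Sum>i. ennreal (mdiam m n (U i) powr s)) < ennreal e"
    using U0(1) by blast (use U0 U4 in blast)+
  have diam: "matdist m n A B \<le> mdiam m n (U i)" if "A \<in> U i" "B \<in> U i" for i A B
    by (rule mdiam_nonneg(1)[where \<delta> = 1, OF mn U(1)[of i]]) (use that U(2)[where i = i] in auto)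
  have diam0: "mdiam m n (U i) \<ge> 0" for i
    by (rule mdiam_nonneg(2)[where \<delta> = 1, OF mn U(1)[of i]]) (use U(2)[where i = i] in auto)
  have diam1: "mdiam m n (U i) \<le> 1" for i
    by (rule mdiam_nonneg(3)[where \<delta> = 1, OF mn U(1)[of i]]) (use U(2)[where i = i] in auto)
  have "\<exists>C r. C \<in> mat_space m n \<and> U i \<subseteq> mball m n r C \<and>
      ?k powr (s' * real_of_int r) \<le> ?k powr s' * mdiam m n (U i) powr s + e * (1/2) ^ Suc i" for i
  proof -
    let ?D = "mdiam m n (U i)"
    have nn: "?k powr s' * ?D powr s \<ge> 0" "e * (1/2) ^ Suc i > 0" using e by auto
    obtain r0 :: int where r0: "?k powr (s' * real_of_int r0) \<le> e * (1/2) ^ Suc i"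
      using small_radius[OF s(3) nn(2), where 'a = 'a] by blast
    have le0: "?k powr (s' * real_of_int r0) \<le> ?k powr s' * ?D powr s + e * (1/2) ^ Suc i"
      using r0 nn by linarith
    consider "U i = {}" | A where "A \<in> U i" "?D = 0" | A where "A \<in> U i" "?D > 0"
      using diam0[of i] by force
    then show ?thesis
    proof cases
      case 1
      show ?thesis
      proof (intro exI conjI)
        show "U i \<subseteq> mball m n r0 (\<lambda>_ _ _. 0)" using 1 by simp
      qed (rule zero_in_mat_space le0)+
    next
      case 2
      have "U i \<subseteq> mball m n r0 A"
      proof
        fix B assume B: "B \<in> U i"
        then have "matdist m n B A = 0" using diam[OF B 2(1)] 2 U(1) matdist_nonneg[OF mn, of B A] by force
        then have "B = A" using matdist_zero_iff[OF mn, of B A] U(1) B 2 by blast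
        then show "B \<in> mball m n r0 A" using U(1) B by (auto simp: mball_def)
      qed
      moreover have "A \<in> mat_space m n" using 2 U(1) by blast
      ultimately show ?thesis using le0 by blast
    next
      case 3
      \<comment> \<open>Balls are open, hence the \<open>+ 1\<close>: \<open>k^r\<close> exceeds the
        diameter but is at most \<open>k\<close> times as large.\<close>
      define r where "r = \<lfloor>log ?k ?D\<rfloor> + 1"
      have r: "log ?k ?D < real_of_int r" "real_of_int r \<le> log ?k ?D + 1" unfolding r_def by linarith+
      have Dk: "?k powr log ?k ?D = ?D" using k1 3 by simp
      have "?D < ?k powr real_of_int r" using r(1) k1 Dk powr_less_mono[of "log ?k ?D" "real_of_int r" ?k] by simp
      then have Dr: "?D < ?k powi r" using powr_real_of_int'[of ?k r] k1 by simp
      have "U i \<subseteq> mball m n r A"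
      proof
        fix B assume B: "B \<in> U i"
        then have "matdist m n B A < ?k powi r" using diam[OF B 3(1)] Dr by linarith
        then have "magree m n r B A" using matdist_less_iff[OF mn, of B A r] U(1) B 3 by blast
        then show "B \<in> mball m n r A" using U(1) B by (auto simp: mball_def)
      qed
      moreover have "?k powr (s' * real_of_int r) \<le> ?k powr (s' * (log ?k ?D + 1))"
        using r(2) k1 s by (intro powr_mono mult_left_mono) auto
      then have "?k powr (s' * real_of_int r) \<le> ?k powr s' * ?D powr s'"
        using Dk k1 by (simp add: distrib_left powr_add powr_powr mult.commute[of s' "log _ _"] flip: powr_powr) (simp add: mult.commute)
      moreover have "?D \<le> 1" using diam1[of i] by simp
      then have "?D powr s' \<le> ?D powr s" using 3 s by (intro powr_mono') auto
      then have "?k powr s' * ?D powr s' \<le> ?k powr s' * ?D powr s" by (intro mult_left_mono) auto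
      ultimately have "?k powr (s' * real_of_int r) \<le> ?k powr s' * ?D powr s + e * (1/2) ^ Suc i"
        using nn by linarith
      moreover have "A \<in> mat_space m n" using 3 U(1) by blast
      ultimately show ?thesis using \<open>U i \<subseteq> mball m n r A\<close> by blast
    qed
  qed
  then have "\<forall>i. \<exists>C r. C \<in> mat_space m n \<and> U i \<subseteq> mball m n r C \<and>
      ?k powr (s' * real_of_int r) \<le> ?k powr s' * mdiam m n (U i) powr s + e * (1/2) ^ Suc i" ..
  from choice[OF this] obtain C where "\<forall>i. \<exists>r. C i \<in> mat_space m n \<and> U i \<subseteq> mball m n r (C i) \<and>
      ?k powr (s' * real_of_int r) \<le> ?k powr s' * mdiam m n (U i) powr s + e * (1/2) ^ Suc i" ..
  from choice[OF this] obtain r where C: "\<And>i. C i \<in> mat_space m n" "\<And>i. U i \<subseteq> mball m n (r i) (C i)"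
      "\<And>i. ?k powr (s' * real_of_int (r i)) \<le> ?k powr s' * mdiam m n (U i) powr s + e * (1/2) ^ Suc i"
    by blast
  have "hcontent m n s' E \<le> (\<Sum>i. ennreal (?k powr (s' * real_of_int (r i))))"
    by (rule hcontent_le[OF C(1) order_trans[OF U(3) UN_mono[OF subset_refl C(2)]]])
  also have "\<dots> \<le> (\<Sum>i. ennreal (?k powr s') * ennreal (mdiam m n (U i) powr s) + ennreal (e * (1/2) ^ Suc i))"
  proof (intro suminf_le summableI)
    fix i
    have "ennreal (?k powr (s' * real_of_int (r i))) \<le> ennreal (?k powr s' * mdiam m n (U i) powr s + e * (1/2) ^ Suc i)"
      by (rule ennreal_leI[OF C(3)])
    then show "ennreal (?k powr (s' * real_of_int (r i))) \<le>
        ennreal (?k powr s') * ennreal (mdiam m n (U i) powr s) + ennreal (e * (1/2) ^ Suc i)"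
      using e by (simp add: ennreal_mult ennreal_plus del: power_Suc)
  qed
  also have "\<dots> = (\<Sum>i. ennreal (?k powr s') * ennreal (mdiam m n (U i) powr s)) + (\<Sum>i. ennreal (e * (1/2) ^ Suc i))"
    by (rule suminf_add[symmetric]) auto
  also have "\<dots> = ennreal (?k powr s') * (\<Sum>i. ennreal (mdiam m n (U i) powr s)) + ennreal e"
    by (simp only: suminf_eps_half[OF e(1)] ennreal_suminf_cmult)
  also have "\<dots> \<le> ennreal (?k powr s') * ennreal e + ennreal e"
    using U(4) by (intro add_right_mono mult_left_mono) auto
  also have "\<dots> = ennreal e0"
    using e by (simp add: flip: ennreal_mult ennreal_plus)
  finally show "hcontent m n s' E \<le> ennreal e0" .
qed

section \<open>Exponent of convergence and ubiquity\<close>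

text \<open>The zero vector is left out because it has \<open>vdeg\<close> 0 while its norm is not
  \<open>k^0\<close>.\<close>

definition level :: "nat \<Rightarrow> (nat \<Rightarrow> 'a::zero poly) set \<Rightarrow> nat \<Rightarrow> (nat \<Rightarrow> 'a poly) set" where
  "level m S t = {q \<in> S. q \<noteq> (\<lambda>_. 0) \<and> vdeg m q = t}"

lemma finite_level: "S \<subseteq> polyvecs m \<Longrightarrow> finite (level m S t :: (nat \<Rightarrow> 'a::{zero,finite} poly) set)"
  by (rule finite_subset[OF _ finite_polyvecs_vdeg_le[of m t]]) (auto simp: level_def)

lemma vnorm_zero: "m \<ge> 1 \<Longrightarrow> vnorm m (\<lambda>_. 0) = 0"
  by (auto simp: vnorm_def pabs_def image_constant_conv lessThan_empty_iff)

lemma vnorm_powr: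
  fixes q :: "nat \<Rightarrow> 'a::{field,finite} poly"
  assumes "q \<in> polyvecs m" "q \<noteq> (\<lambda>_. 0)"
  shows "vnorm m q powr w = real CARD('a) powr (w * real (vdeg m q))"
proof -
  obtain i where "i < m" "q i \<noteq> 0" using polyvecs_nonzero[OF assms] by blast
  then have "vnorm m q = real CARD('a) ^ vdeg m q" by (rule vnorm_eq)
  also have "\<dots> = real CARD('a) powr real (vdeg m q)"
    using card_field_gt_1[where 'a = 'a] by (simp add: powr_realpow)
  finally show ?thesis by (simp add: powr_powr mult.commute)
qed

lemma card_polyvecs_vdeg_le:
  "card {q :: nat \<Rightarrow> 'a::{zero,finite} poly. q \<in> polyvecs m \<and> vdeg m q \<le> t} \<le> CARD('a) ^ (m * (t + 1))"
proof -
  let ?A = "{q :: nat \<Rightarrow> 'a poly. q \<in> polyvecs m \<and> vdeg m q \<le> t}"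
  let ?h = "\<lambda>(q :: nat \<Rightarrow> 'a poly) (i, e). coeff (q i) e"
  have "inj_on ?h ?A"
  proof (rule inj_onI)
    fix q q' assume "?h q = ?h q'"
    then have "coeff (q i) e = coeff (q' i) e" for i e by (metis case_prod_conv)
    then show "q = q'" by (simp add: fun_eq_iff poly_eq_iff)
  qed
  moreover have "?h ` ?A \<subseteq> supp_on ({..<m} \<times> {..t})"
  proof
    fix f assume "f \<in> ?h ` ?A"
    then obtain q where q: "f = ?h q" "q \<in> polyvecs m" "vdeg m q \<le> t" by blast
    have "coeff (q i) e = 0" if "\<not> (i < m \<and> e \<le> t)" for i e
    proof (cases "i < m")
      case True
      then show ?thesis using degree_le_vdeg[OF True, of q] q that by (intro coeff_eq_0) auto
    next
      case False
      then show ?thesis using q by (simp add: polyvecs_def)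
    qed
    then show "f \<in> supp_on ({..<m} \<times> {..t})" using q by (auto simp: supp_on_def)
  qed
  moreover have "finite (supp_on ({..<m} \<times> {..t}) :: (nat \<times> nat \<Rightarrow> 'a) set)" by (simp add: finite_supp_on)
  ultimately have "card ?A \<le> card (supp_on ({..<m} \<times> {..t}) :: (nat \<times> nat \<Rightarrow> 'a) set)"
    by (rule card_inj_on_le)
  also have "\<dots> = CARD('a) ^ (m * (t + 1))" by (simp add: card_supp_on card_cartesian_product)
  finally show ?thesis .
qed

text \<open>Grouping by degree compares the sum with a geometric series of ratio
  \<open>k powr (u - w)\<close>.\<close>

lemma summable_of_level_bound:
  fixes S :: "(nat \<Rightarrow> 'a::{field,finite} poly) set"
  assumes m: "m \<ge> 1" and S: "S \<subseteq> polyvecs m"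
    and D: "D \<ge> 0" "\<And>t. real (card (level m S t)) \<le> D * real CARD('a) powr (u * real t)" and w: "u < w"
  shows "(\<lambda>q. vnorm m q powr (- w)) summable_on S"
proof (rule nonneg_bdd_above_summable_on)
  let ?k = "real CARD('a)"
  have k1: "?k > 1" by (rule card_field_gt_1)
  define c where "c = ?k powr (u - w)"
  have c: "0 \<le> c" "c < 1" using k1 w powr_less_mono[of "u - w" 0 ?k] by (auto simp: c_def)
  show "bdd_above (sum (\<lambda>q. vnorm m q powr - w) ` {F. F \<subseteq> S \<and> finite F})"
  proof (rule bdd_aboveI2)
    fix F assume F: "F \<in> {F. F \<subseteq> S \<and> finite F}"
    define F' where "F' = F - {\<lambda>_. 0}"
    define N where "N = Max (insert 0 (vdeg m ` F'))"
    have F': "finite F'" "F' \<subseteq> S" using F by (auto simp: F'_def)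
    have img: "vdeg m ` F' \<subseteq> {..N}" unfolding N_def using F' by (auto intro: Max_ge)
    \<comment> \<open>The zero vector contributes \<open>0 powr (- w) = 0\<close>, whatever the sign
      of \<open>w\<close>.\<close>
    have "(\<Sum>q\<in>F. vnorm m q powr - w) = (\<Sum>q\<in>F'. vnorm m q powr - w)"
      using F by (intro sum.mono_neutral_right) (auto simp: F'_def vnorm_zero[OF m])
    also have "\<dots> = (\<Sum>t\<le>N. \<Sum>q\<in>{q \<in> F'. vdeg m q = t}. vnorm m q powr - w)"
      by (rule sum.group[symmetric]) (use F' img in auto)
    also have "\<dots> \<le> (\<Sum>t\<le>N. D * c ^ t)"
    proof (rule sum_mono)
      fix t
      have "(\<Sum>q\<in>{q \<in> F'. vdeg m q = t}. vnorm m q powr - w) = (\<Sum>q\<in>{q \<in> F'. vdeg m q = t}. ?k powr (- w * real t))"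
      proof (rule sum.cong[OF refl])
        fix q assume q: "q \<in> {q \<in> F'. vdeg m q = t}"
        then have "q \<in> polyvecs m" "q \<noteq> (\<lambda>_. 0)" using F' S by (auto simp: F'_def)
        then show "vnorm m q powr - w = ?k powr (- w * real t)" using q vnorm_powr[of q m "- w"] by simp
      qed
      also have "\<dots> = card {q \<in> F'. vdeg m q = t} * ?k powr (- w * real t)" by simp
      also have "\<dots> \<le> card (level m S t) * ?k powr (- w * real t)"
        using F' finite_level[OF S, of t]
        by (intro mult_right_mono of_nat_mono card_mono) (auto simp: level_def F'_def)
      also have "\<dots> \<le> D * ?k powr (u * real t) * ?k powr (- w * real t)"
        using D(2)[of t] by (intro mult_right_mono) auto
      also have "\<dots> = D * c ^ t"
        using k1 by (simp add: c_def powr_realpow[symmetric] powr_powr powr_add[symmetric] algebra_simps)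
      finally show "(\<Sum>q\<in>{q \<in> F'. vdeg m q = t}. vnorm m q powr - w) \<le> D * c ^ t" .
    qed
    also have "\<dots> = D * (\<Sum>t\<le>N. c ^ t)" by (simp add: sum_distrib_left)
    also have "(\<Sum>t\<le>N. c ^ t) \<le> (\<Sum>t. c ^ t)"
      using c by (intro sum_le_suminf) (auto intro: summable_geometric)
    finally show "(\<Sum>q\<in>F. vnorm m q powr - w) \<le> D * (\<Sum>t. c ^ t)"
      using D(1) by (simp add: mult_left_mono)
  qed
qed simp

text \<open>These two facts give the infimum \<open>conv_exp\<close> its meaning. At most
  \<open>k^(m (t + 1))\<close> vectors have degree at most \<open>t\<close>, so large exponents
  converge; for \<open>v < 0\<close> infinitely many terms are at least 1.\<close>

lemma conv_exp_bounds:
  fixes S :: "(nat \<Rightarrow> 'a::{field,finite} poly) set"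
  assumes m: "m \<ge> 1" and S: "S \<subseteq> polyvecs m" "infinite S"
  shows conv_exp_nonempty: "{v. (\<lambda>q. vnorm m q powr (- v)) summable_on S} \<noteq> {}"
    and conv_exp_lower: "\<And>v. (\<lambda>q. vnorm m q powr (- v)) summable_on S \<Longrightarrow> v \<ge> 0"
proof -
  let ?k = "real CARD('a)"
  have k1: "?k > 1" by (rule card_field_gt_1)
  have "(\<lambda>q. vnorm m q powr (- (real m + 1))) summable_on S"
  proof (rule summable_of_level_bound[OF m S(1)])
    fix t
    have "card (level m S t) \<le> card {q :: nat \<Rightarrow> 'a poly. q \<in> polyvecs m \<and> vdeg m q \<le> t}"
      using finite_polyvecs_vdeg_le[where 'a = 'a] S by (intro card_mono) (auto simp: level_def)
    also have "\<dots> \<le> CARD('a) ^ (m * (t + 1))" by (rule card_polyvecs_vdeg_le)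
    finally have "real (card (level m S t)) \<le> real (CARD('a) ^ (m * (t + 1)))" by (rule of_nat_mono)
    also have "\<dots> = ?k powr real m * ?k powr (real m * real t)"
      using k1 by (simp add: powr_realpow[symmetric] powr_add[symmetric] algebra_simps)
    finally show "real (card (level m S t)) \<le> ?k powr real m * ?k powr (real m * real t)" .
  qed auto
  then show "{v. (\<lambda>q. vnorm m q powr (- v)) summable_on S} \<noteq> {}" by blast
  fix v assume v: "(\<lambda>q. vnorm m q powr (- v)) summable_on S"
  show "v \<ge> 0"
  proof (rule ccontr)
    assume neg: "\<not> ?thesis"
    define I where "I = infsum (\<lambda>q. vnorm m q powr (- v)) S"
    have "infinite (S - {\<lambda>_. 0})" using S by simp
    then obtain F where F: "finite F" "card F = nat \<lceil>I\<rceil> + 1" "F \<subseteq> S - {\<lambda>_. 0}"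
      using infinite_arbitrarily_large by blast
    have "real (card F) = (\<Sum>q\<in>F. 1)" by simp
    also have "\<dots> \<le> (\<Sum>q\<in>F. vnorm m q powr (- v))"
    proof (rule sum_mono)
      fix q assume "q \<in> F"
      then have "q \<in> polyvecs m" "q \<noteq> (\<lambda>_. 0)" using F S by auto
      from vnorm_powr[OF this, of "- v"] show "1 \<le> vnorm m q powr (- v)"
        using k1 neg by (simp add: ge_one_powr_ge_zero mult_nonpos_nonneg)
    qed
    also have "\<dots> \<le> I" unfolding I_def by (rule finite_sum_le_infsum) (use v F in auto)
    finally show False using F by linarith
  qed
qed

lemma conv_exp_nonneg:
  fixes S :: "(nat \<Rightarrow> 'a::{field,finite} poly) set"
  assumes "m \<ge> 1" and "S \<subseteq> polyvecs m" "infinite S"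
  shows "conv_exp m S \<ge> 0"
  unfolding conv_exp_def using conv_exp_nonempty[OF assms] conv_exp_lower[OF assms]
  by (intro cInf_greatest) auto

lemma summable_above_conv_exp:
  fixes S :: "(nat \<Rightarrow> 'a::{field,finite} poly) set"
  assumes m: "m \<ge> 1" and S: "S \<subseteq> polyvecs m" "infinite S" and w: "conv_exp m S < w"
  shows "(\<lambda>q. vnorm m q powr (- w)) summable_on S"
proof -
  have bdd: "bdd_below {v. (\<lambda>q. vnorm m q powr (- v)) summable_on S}"
    by (rule bdd_belowI[of _ 0]) (use conv_exp_lower[OF m S] in auto)
  obtain v where v: "v < w" "(\<lambda>q. vnorm m q powr (- v)) summable_on S"
    using w unfolding conv_exp_def cInf_less_iff[OF conv_exp_nonempty[OF m S] bdd] by blast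
  show ?thesis
  proof (rule summable_on_comparison_test[OF v(2)])
    fix q assume q: "q \<in> S"
    show "vnorm m q powr - w \<le> vnorm m q powr - v"
    proof (cases "q = (\<lambda>_. 0)")
      case False
      then have "q \<in> polyvecs m" using q S by auto
      from vnorm_powr[OF this False] show ?thesis
        using v(1) card_field_gt_1[where 'a = 'a] by (simp add: mult_right_mono)
    qed (simp add: vnorm_zero[OF m])
  qed simp
qed

text \<open>If all levels from \<open>T\<close> on were small, a larger constant would cover the
  earlier ones too, and the series would converge at an exponent strictly between \<open>u\<close>
  and \<open>conv_exp m S\<close>. Only arbitrarily large \<open>t\<close> can be expected, since
  \<open>S\<close> may have gaps.\<close>

lemma large_levels:
  fixes S :: "(nat \<Rightarrow> 'a::{field,finite} poly) set"
  assumes m: "m \<ge> 1" and S: "S \<subseteq> polyvecs m" "infinite S" and u: "u < conv_exp m S"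
  shows "\<exists>t\<ge>T. real (card (level m S t)) > real CARD('a) powr (u * real t)"
proof (rule ccontr)
  let ?k = "real CARD('a)"
  assume "\<not> ?thesis"
  then have small: "real (card (level m S t)) \<le> ?k powr (u * real t)" if "t \<ge> T" for t
    using that by (meson not_le)
  have k1: "?k > 1" by (rule card_field_gt_1)
  define f where "f t = real (card (level m S t)) / ?k powr (u * real t)" for t
  define D where "D = 1 + (\<Sum>t<T. f t)"
  have f0: "f t \<ge> 0" for t by (simp add: f_def)
  have "f t \<le> D" for t
  proof (cases "t < T")
    case True
    then have "f t \<le> (\<Sum>t<T. f t)" using f0 by (intro member_le_sum) auto
    then show ?thesis by (simp add: D_def)
  next
    case False
    then have "f t \<le> 1" using small[of t] k1 by (simp add: f_def)
    then show ?thesis using sum_nonneg[of "{..<T}" f] f0 by (simp add: D_def)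
  qed
  then have le: "real (card (level m S t)) \<le> D * ?k powr (u * real t)" for t
    using k1 by (simp add: f_def pos_divide_le_eq)
  have D0: "D \<ge> 0" using sum_nonneg[of "{..<T}" f] f0 by (simp add: D_def)
  obtain w where w: "u < w" "w < conv_exp m S" using dense[OF u] by blast
  have "(\<lambda>q. vnorm m q powr (- w)) summable_on S"
    by (rule summable_of_level_bound[OF m S(1) D0 le w(1)])
  moreover have "bdd_below {v. (\<lambda>q. vnorm m q powr (- v)) summable_on S}"
    by (rule bdd_belowI[of _ 0]) (use conv_exp_lower[OF m S] in auto)
  ultimately have "conv_exp m S \<le> w" unfolding conv_exp_def by (intro cInf_lower) auto
  then show False using w by simp
qed

text \<open>By \<open>card_not_near\<close> the proportion of missed arrays is at most
  \<open>k^(n b) * \<tau>^n\<close> over the size of the level. That size exceeds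
  \<open>k powr (u t)\<close> with \<open>u > n a\<close>, so the quotient decays. The alternative
  \<open>a \<le> 0\<close> means precision 0, where any \<open>q\<close> succeeds; it serves the
  case \<open>v(S) = 0\<close>, where no \<open>a \<ge> 0\<close> has
  \<open>n a < v(S)\<close>.\<close>

lemma ubiquity:
  fixes S :: "(nat \<Rightarrow> 'a::{field,finite} poly) set"
  assumes m: "m \<ge> 1" and S: "S \<subseteq> polyvecs m" "infinite S"
    and a: "a \<le> 0 \<or> real n * a < conv_exp m S" and \<eta>: "\<eta> > 0"
  shows "\<exists>t\<ge>T. level m S t \<noteq> {} \<and>
     real (card {x \<in> supp_on (cells m n (t + nat \<lceil>a * real t\<rceil>)). \<forall>q\<in>level m S t. \<not> near m n q t (nat \<lceil>a * real t\<rceil>) x})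
       \<le> \<eta> * real CARD('a) ^ (m * n * (t + nat \<lceil>a * real t\<rceil>))"
proof (cases "a \<le> 0")
  case True
  \<comment> \<open>The exponent \<open>-1\<close> only serves to find a nonempty level beyond
    \<open>T\<close>.\<close>
  have "(- 1 :: real) < conv_exp m S" using conv_exp_nonneg[OF m S] by linarith
  from large_levels[OF m S this, of T] obtain t where t: "t \<ge> T" "real (card (level m S t)) > real CARD('a) powr (- 1 * real t)"
    by blast
  have ne: "level m S t \<noteq> {}"
  proof
    assume "level m S t = {}"
    with t show False by (simp add: not_less)
  qed
  have "\<lceil>a * real t\<rceil> \<le> 0" using True by (simp add: mult_nonpos_nonneg)
  then have "nat \<lceil>a * real t\<rceil> = 0" by simp
  then have "{x \<in> supp_on (cells m n (t + nat \<lceil>a * real t\<rceil>)). \<forall>q\<in>level m S t. \<not> near m n q t (nat \<lceil>a * real t\<rceil>) x} = {}"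
    using ne by (auto simp: near_def)
  then show ?thesis using t ne \<eta> by (intro exI[of _ t]) (simp only: card.empty, simp)
next
  case False
  let ?k = "real CARD('a)"
  have k1: "?k > 1" by (rule card_field_gt_1)
  have a0: "a > 0" and na: "real n * a < conv_exp m S" using a False by auto
  obtain u where u: "real n * a < u" "u < conv_exp m S" using dense[OF na] by blast
  define \<delta> where "\<delta> = u - real n * a"
  \<comment> \<open>Half of the gap \<open>\<delta>\<close> pays for the divisor bound, applied in
    \<open>n\<close> columns to polynomials of degree at most \<open>t + b\<close>, about
    \<open>(1 + a) t\<close>. The other half gives the decay that beats \<open>\<eta>\<close>.
    Taking \<open>n + 1\<close> keeps the denominator positive.\<close>
  define \<epsilon> where "\<epsilon> = \<delta> / 2 / ((real n + 1) * (1 + a))"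
  have \<delta>: "\<delta> > 0" using u by (simp add: \<delta>_def)
  have \<epsilon>: "\<epsilon> > 0" "\<epsilon> * real n * (1 + a) \<le> \<delta> / 2"
  proof -
    show "\<epsilon> > 0" using \<delta> a0 by (simp add: \<epsilon>_def)
    have "(real n + 1) * (1 + a) > 0" using a0 by simp
    then have "\<epsilon> * ((real n + 1) * (1 + a)) = \<delta> / 2" unfolding \<epsilon>_def
      by (metis less_irrefl nonzero_eq_divide_eq)
    then have "\<epsilon> * (real n + 1) * (1 + a) = \<delta> / 2" by (simp only: mult.assoc)
    moreover have "\<epsilon> * real n * (1 + a) \<le> \<epsilon> * (real n + 1) * (1 + a)"
      using \<open>\<epsilon> > 0\<close> a0 by (intro mult_right_mono mult_left_mono) auto
    ultimately show "\<epsilon> * real n * (1 + a) \<le> \<delta> / 2" by linarith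
  qed
  obtain C where C: "C > 0" "\<And>f :: 'a poly. f \<noteq> 0 \<Longrightarrow> real (card {d. d dvd f}) \<le> C * ?k powr (\<epsilon> * real (degree f))"
    using divisor_bound[OF \<epsilon>(1), where 'a = 'a] by blast
  \<comment> \<open>Collects the divisor constant and the loss from rounding \<open>a t\<close> up
    to \<open>b\<close>.\<close>
  define M where "M = C ^ n * ?k powr (\<epsilon> * real n + real n)"
  have M0: "M > 0" using C k1 by (simp add: M_def)
  obtain T' :: nat where T': "M * ?k powr (- (\<delta> / 2) * real t) \<le> \<eta>" if "t \<ge> T'" for t
  proof -
    obtain N :: nat where N: "log ?k (M / \<eta>) / (\<delta> / 2) \<le> real N" using real_arch_simple by blast
    have "M * ?k powr (- (\<delta> / 2) * real t) \<le> \<eta>" if "t \<ge> N" for t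
    proof -
      have "log ?k (M / \<eta>) / (\<delta> / 2) \<le> real t" using N that by linarith
      then have "log ?k (M / \<eta>) \<le> \<delta> / 2 * real t" using \<delta> by (simp add: field_simps)
      then have "?k powr log ?k (M / \<eta>) \<le> ?k powr (\<delta> / 2 * real t)" using k1 by simp
      then have "M / \<eta> \<le> ?k powr (\<delta> / 2 * real t)" using k1 M0 \<eta> by simp
      then have "M \<le> \<eta> * ?k powr (\<delta> / 2 * real t)" using \<eta> by (simp add: field_simps)
      then have "M * ?k powr (- (\<delta> / 2 * real t)) \<le> \<eta> * ?k powr (\<delta> / 2 * real t) * ?k powr (- (\<delta> / 2 * real t))"
        by (rule mult_right_mono) simp
      also have "\<dots> = \<eta>" using k1 by (simp add: powr_minus)
      finally show ?thesis by simp
    qed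
    then show ?thesis using that by blast
  qed
  obtain t where t: "t \<ge> max T T'" "real (card (level m S t)) > ?k powr (u * real t)"
    using large_levels[OF m S u(2), of "max T T'"] by blast
  define b where "b = nat \<lceil>a * real t\<rceil>"
  have b: "real b \<le> a * real t + 1"
  proof -
    have "0 \<le> a * real t" using a0 by simp
    then have "\<lceil>a * real t\<rceil> \<ge> 0" by linarith
    then have "real b = real_of_int \<lceil>a * real t\<rceil>" by (simp add: b_def)
    then show ?thesis by linarith
  qed
  define \<tau> where "\<tau> = nat \<lfloor>C * ?k powr (\<epsilon> * real (b + t))\<rfloor>"
  have cnn: "C * ?k powr (\<epsilon> * real (b + t)) \<ge> 0" using C by simp
  have \<tau>le: "real \<tau> \<le> C * ?k powr (\<epsilon> * real (b + t))"
    using cnn unfolding \<tau>_def by (simp add: of_nat_nat)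
  have \<tau>: "card {d. d dvd f} \<le> \<tau>" if "f \<noteq> 0" "degree f \<le> b + t" for f :: "'a poly"
  proof -
    have "real (card {d. d dvd f}) \<le> C * ?k powr (\<epsilon> * real (degree f))" using C that by blast
    also have "\<dots> \<le> C * ?k powr (\<epsilon> * real (b + t))"
      using C \<epsilon> k1 that by (intro mult_left_mono powr_mono) auto
    finally show ?thesis unfolding \<tau>_def by (simp add: le_nat_floor)
  qed
  let ?Z = "{x \<in> supp_on (cells m n (t + b)). \<forall>q\<in>level m S t. \<not> near m n q t b x}"
  let ?N = "real (card (level m S t))"
  have N0: "?N > 0" using t(2) powr_ge_zero[of ?k "u * real t"] by linarith
  have ne: "level m S t \<noteq> {}" using N0 by auto
  have lev: "q \<in> polyvecs m" "q \<noteq> (\<lambda>_. 0)" "vdeg m q = t" if "q \<in> level m S t" for q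
    using that S by (auto simp: level_def)
  have "card ?Z * card (level m S t) \<le> CARD('a) ^ (m * n * (t + b)) * CARD('a) ^ (n * b) * \<tau> ^ n"
  proof (rule card_not_near)
    show "degree (q i) \<le> t" if "q \<in> level m S t" "i < m" for q i
      using degree_le_vdeg[OF that(2), of q] lev[OF that(1)] by simp
    show "\<exists>i<m. q i \<noteq> 0" if "q \<in> level m S t" for q
      using polyvecs_nonzero lev[OF that] by blast
  qed (use finite_level[OF S(1)] lev \<tau> in auto)
  from of_nat_mono[OF this, where 'a = real]
  have "real (card ?Z) * ?N \<le> ?k ^ (m * n * (t + b)) * (?k ^ (n * b) * real \<tau> ^ n)" by (simp add: mult.assoc)
  also have "?k ^ (n * b) * real \<tau> ^ n \<le> \<eta> * ?N"
  proof -
    have "?k ^ (n * b) * real \<tau> ^ n \<le> ?k ^ (n * b) * (C * ?k powr (\<epsilon> * real (b + t))) ^ n"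
      using \<tau>le k1 by (intro mult_left_mono power_mono) auto
    also have "\<dots> = C ^ n * ?k powr (real n * real b + real n * (\<epsilon> * real (b + t)))"
      using k1 by (simp add: power_mult_distrib powr_realpow[symmetric] powr_powr powr_add mult_ac)
    also have "\<dots> \<le> C ^ n * ?k powr ((\<epsilon> * real n + real n) + (- (\<delta> / 2) * real t) + u * real t)"
    proof (intro mult_left_mono powr_mono)
      have "real n * real b \<le> real n * (a * real t + 1)" using b by (intro mult_left_mono) auto
      moreover have "real n * (\<epsilon> * real (b + t)) \<le> real n * (\<epsilon> * ((1 + a) * real t + 1))"
        using b \<epsilon>(1) by (intro mult_left_mono) (auto simp: algebra_simps)
      moreover have "\<epsilon> * real n * (1 + a) * real t \<le> \<delta> / 2 * real t"
        using \<epsilon>(2) by (rule mult_right_mono) simp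
      moreover have "real n * (\<epsilon> * ((1 + a) * real t + 1)) = \<epsilon> * real n * (1 + a) * real t + \<epsilon> * real n"
        by (simp add: algebra_simps)
      moreover have "\<delta> * real t = u * real t - real n * a * real t" by (simp add: \<delta>_def algebra_simps)
      ultimately show "real n * real b + real n * (\<epsilon> * real (b + t))
         \<le> (\<epsilon> * real n + real n) + (- (\<delta> / 2) * real t) + u * real t" by (simp add: algebra_simps)
    qed (use C k1 in auto)
    also have "\<dots> = M * ?k powr (- (\<delta> / 2) * real t) * ?k powr (u * real t)"
      unfolding M_def by (simp only: powr_add mult_ac)
    also have "\<dots> \<le> \<eta> * ?k powr (u * real t)"
      using T'[of t] t by (intro mult_right_mono) auto
    also have "\<dots> \<le> \<eta> * ?N" using t(2) \<eta> by (intro mult_left_mono) auto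
    finally show ?thesis .
  qed
  finally have "real (card ?Z) * ?N \<le> (\<eta> * ?k ^ (m * n * (t + b))) * ?N"
    using k1 by (simp add: mult_ac mult_left_mono)
  then have "real (card ?Z) \<le> \<eta> * ?k ^ (m * n * (t + b))" using N0 by (rule mult_right_le_imp_le)
  then show ?thesis using t(1) ne unfolding b_def by (intro exI[of _ t]) auto
qed

lemma order_at_infinityD:
  fixes S :: "(nat \<Rightarrow> 'a::{field,finite} poly) set"
  assumes S: "S \<subseteq> polyvecs m" and \<psi>: "\<forall>q\<in>polyvecs m. \<exists>r::int. \<psi> q = real CARD('a) powi r"
    and ord: "order_at_infinity m S \<psi> l" and \<epsilon>: "\<epsilon> > 0"
  shows "\<exists>T. \<forall>t\<ge>T. \<forall>q\<in>level m S t. real CARD('a) powr (- (l + \<epsilon>) * real t) < \<psi> q \<and>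
           \<psi> q < real CARD('a) powr (- (l - \<epsilon>) * real t)"
proof -
  let ?k = "real CARD('a)"
  have k1: "?k > 1" by (rule card_field_gt_1)
  obtain R where R: "\<And>q. q \<in> S \<Longrightarrow> vnorm m q > R \<Longrightarrow> \<bar>(- ln (\<psi> q)) / ln (vnorm m q) - l\<bar> < \<epsilon>"
    using ord \<epsilon> unfolding order_at_infinity_def by blast
  obtain T0 where T0: "R < ?k ^ T0" using real_arch_pow[OF k1] by blast
  have "?k powr (- (l + \<epsilon>) * real t) < \<psi> q \<and> \<psi> q < ?k powr (- (l - \<epsilon>) * real t)"
    if t: "t \<ge> max 1 T0" and q: "q \<in> level m S t" for t q
  proof -
    have q': "q \<in> S" "q \<in> polyvecs m" "q \<noteq> (\<lambda>_. 0)" "vdeg m q = t" using q S by (auto simp: level_def)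
    obtain i where "i < m" "q i \<noteq> 0" using polyvecs_nonzero[OF q'(2,3)] by blast
    then have "vnorm m q = ?k ^ vdeg m q" by (rule vnorm_eq)
    then have vn: "vnorm m q = ?k powr real t" using q'(4) k1 by (simp add: powr_realpow)
    have "?k ^ T0 \<le> ?k ^ t" using t k1 by (intro power_increasing) auto
    then have "R < ?k ^ t" using T0 by linarith
    then have "vnorm m q > R" using vn k1 by (simp add: powr_realpow)
    from R[OF q'(1) this] have *: "\<bar>(- ln (\<psi> q)) / (real t * ln ?k) - l\<bar> < \<epsilon>"
      using vn k1 by (simp add: ln_powr)
    \<comment> \<open>This is where \<open>t \<ge> 1\<close> enters: at \<open>t = 0\<close> the
      logarithm of the norm vanishes.\<close>
    have pos: "real t * ln ?k > 0" using t k1 by simp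
    obtain r :: int where "\<psi> q = ?k powi r" using \<psi> q'(2) by blast
    then have \<psi>0: "\<psi> q > 0" using k1 by simp
    have "- ln (\<psi> q) < (l + \<epsilon>) * (real t * ln ?k)" "(l - \<epsilon>) * (real t * ln ?k) < - ln (\<psi> q)"
    proof -
      have "(- ln (\<psi> q)) / (real t * ln ?k) < l + \<epsilon>" "l - \<epsilon> < (- ln (\<psi> q)) / (real t * ln ?k)"
        using abs_diff_less_iff[THEN iffD1, OF *] by (simp_all only: add.commute)
      then show "- ln (\<psi> q) < (l + \<epsilon>) * (real t * ln ?k)" "(l - \<epsilon>) * (real t * ln ?k) < - ln (\<psi> q)"
        by (simp_all only: pos_divide_less_eq[OF pos] pos_less_divide_eq[OF pos])
    qed
    then have "(- (l + \<epsilon>) * real t) * ln ?k < ln (\<psi> q)" "ln (\<psi> q) < (- (l - \<epsilon>) * real t) * ln ?k"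
      by (simp_all add: algebra_simps)
    then have "exp ((- (l + \<epsilon>) * real t) * ln ?k) < \<psi> q" "\<psi> q < exp ((- (l - \<epsilon>) * real t) * ln ?k)"
      using \<psi>0 exp_less_mono[of _ "ln (\<psi> q)"] exp_less_mono[of "ln (\<psi> q)"] by simp_all
    then show ?thesis using k1 by (simp add: powr_def)
  qed
  then show ?thesis by blast
qed

section \<open>Full measure and the upper bound\<close>

text \<open>Matrices with polynomial entries: centres of countably many unit balls that cover the
  space.\<close>

definition int_mats :: "nat \<Rightarrow> nat \<Rightarrow> 'a::zero lmat set" where
  "int_mats m n = {P \<in> mat_space m n. \<forall>i j d. d < 0 \<longrightarrow> P i j d = 0}"

definition shift :: "'a::monoid_add lmat \<Rightarrow> 'a cellfun \<Rightarrow> 'a lmat" where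
  "shift P x = (\<lambda>i j d. P i j d + embed x i j d)"

lemma countable_int_mats: "countable (int_mats m n :: 'a::{zero,finite} lmat set)"
proof -
  let ?h = "\<lambda>(f :: 'a cellfun) i j d. if d \<ge> 0 then f (i, j, nat d) else 0"
  have "int_mats m n \<subseteq> (\<Union>N. ?h ` supp_on ({..<m} \<times> {..<n} \<times> {..N}))"
  proof
    fix P :: "'a lmat" assume P: "P \<in> int_mats m n"
    then have ms: "P \<in> mat_space m n" and neg: "\<And>i j d. d < 0 \<Longrightarrow> P i j d = 0" by (auto simp: int_mats_def)
    have "\<forall>u. \<exists>N::int. \<forall>d>N. P (fst u) (snd u) d = 0"
      using laurent_D mat_space_laurent[OF ms] by blast
    from choice[OF this] obtain M where M: "\<forall>u. \<forall>d > (M u :: int). P (fst u) (snd u) d = 0" ..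
    define N where "N = nat (Max (insert 0 (M ` ({..<m} \<times> {..<n}))))"
    have z: "P i j d = 0" if "\<not> (i < m \<and> j < n \<and> nat d \<le> N)" for i j d
    proof (cases "i < m \<and> j < n")
      case True
      then have "M (i, j) \<le> Max (insert 0 (M ` ({..<m} \<times> {..<n})))" by (intro Max_ge) auto
      then have "M (i, j) < d" using that True unfolding N_def by linarith
      then show ?thesis using M[rule_format, of "(i, j)" d] by simp
    next
      case False
      then have "P i j = (\<lambda>_. 0)" using ms by (simp add: mat_space_def)
      then show ?thesis by simp
    qed
    define f where "f = (\<lambda>(i, j, e). P i j (int e))"
    have "f \<in> supp_on ({..<m} \<times> {..<n} \<times> {..N})"
      using z by (auto simp: supp_on_def f_def)
    moreover have "P = ?h f" using neg by (auto simp: f_def fun_eq_iff)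
    ultimately show "P \<in> (\<Union>N. ?h ` supp_on ({..<m} \<times> {..<n} \<times> {..N}))" by blast
  qed
  moreover have "countable (\<Union>N. ?h ` supp_on ({..<m} \<times> {..<n} \<times> {..N}))"
    by (intro countable_UN[OF countableI_type] countable_image countable_finite finite_supp_on) auto
  ultimately show ?thesis by (rule countable_subset)
qed

lemma int_mats_nonempty: "int_mats m n \<noteq> {}"
proof -
  have "(\<lambda>_ _ _. 0) \<in> int_mats m n" by (simp add: int_mats_def mat_space_def)
  then show ?thesis by blast
qed

lemma mat_space_cover: "mat_space m n \<subseteq> (\<Union>P\<in>int_mats m n. mball m n 0 (P :: 'a::zero lmat))"
proof
  fix A :: "'a lmat" assume A: "A \<in> mat_space m n"
  define P where "P = (\<lambda>i j d. if d < 0 then 0 else A i j d)"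
  have "P i j \<in> laurent" for i j
  proof -
    obtain N where "\<forall>d>N. A i j d = 0" using laurent_D mat_space_laurent[OF A] by blast
    then have "\<forall>d>N. P i j d = 0" by (simp add: P_def)
    then show ?thesis unfolding laurent_def by blast
  qed
  then have "P \<in> int_mats m n" using A by (auto simp: int_mats_def mat_space_def P_def fun_eq_iff)
  moreover have "A \<in> mball m n 0 P" using A by (auto simp: mball_def magree_def P_def)
  ultimately show "A \<in> (\<Union>P\<in>int_mats m n. mball m n 0 P)" by blast
qed

lemma hcontent_null_local:
  fixes E :: "'a::{field,finite} lmat set"
  assumes "E \<subseteq> mat_space m n" "\<And>P. P \<in> int_mats m n \<Longrightarrow> hcontent m n s (E \<inter> mball m n 0 P) = 0"
  shows "hcontent m n s E = 0"
proof -
  have "E \<subseteq> (\<Union>P\<in>int_mats m n. E \<inter> mball m n 0 P)" using assms(1) mat_space_cover[of m n, where 'a = 'a] by blast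
  then have "hcontent m n s E \<le> hcontent m n s (\<Union>P\<in>int_mats m n. E \<inter> mball m n 0 P)" by (rule hcontent_mono)
  also have "\<dots> = 0" by (rule hcontent_null_UN[OF countable_int_mats assms(2) int_mats_nonempty])
  finally show ?thesis by simp
qed

lemma shift_in:
  fixes P :: "'a::field lmat"
  assumes P: "P \<in> mat_space m n" and x: "x \<in> supp_on (cells m n L)"
  shows "shift P x \<in> mat_space m n"
proof -
  have e: "embed x \<in> mat_space m n" by (rule embed_in[OF x])
  have "shift P x i j \<in> laurent" for i j
  proof -
    obtain N where "\<forall>d>N. P i j d = 0" using laurent_D mat_space_laurent[OF P] by blast
    then have "\<forall>d>max 0 N. shift P x i j d = 0" by (simp add: shift_def embed_def)
    then show ?thesis unfolding laurent_def by blast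
  qed
  then show ?thesis using P e by (auto simp: mat_space_def shift_def fun_eq_iff)
qed

lemma magree_shift_trunc:
  fixes P :: "'a::field lmat"
  assumes P: "P \<in> int_mats m n" and A: "A \<in> mball m n 0 P"
  shows "magree m n (- int L) A (shift P (trunc m n L A))"
  unfolding magree_def
proof (intro allI impI)
  fix i j d assume d: "i < m" "j < n" "- int L \<le> d"
  show "A i j d = shift P (trunc m n L A) i j d"
  proof (cases "d < 0")
    case True
    then have "(i, j, nat (- d)) \<in> cells m n L" using d by (auto simp: cells_def)
    then show ?thesis using True P by (simp add: shift_def embed_def trunc_def int_mats_def)
  next
    case False
    then show ?thesis using A d by (simp add: mball_def magree_def shift_def embed_def)
  qed
qed

text \<open>Turns counts into content: inside a unit ball, a digit array of depth \<open>L\<close>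
  is one ball of radius \<open>k^(-L)\<close>.\<close>

lemma hcontent_cylinders:
  fixes P :: "'a::{field,finite} lmat"
  assumes P: "P \<in> int_mats m n" and X: "X \<subseteq> supp_on (cells m n L)" and s: "s > 0"
    and E: "E \<subseteq> mball m n 0 P" "\<And>A. A \<in> E \<Longrightarrow> trunc m n L A \<in> X"
  shows "hcontent m n s E \<le> ennreal (real (card X) * real CARD('a) powr (- s * real L))"
proof -
  have finX: "finite X" using X finite_supp_on[OF finite_cells] by (rule finite_subset)
  have Pm: "P \<in> mat_space m n" using P by (simp add: int_mats_def)
  let ?G = "shift P ` X"
  have "E \<subseteq> (\<Union>C\<in>?G. mball m n (- int L) C)"
  proof
    fix A assume A: "A \<in> E"
    then have "A \<in> mball m n 0 P" "trunc m n L A \<in> X" using E by auto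
    moreover from this have "A \<in> mball m n (- int L) (shift P (trunc m n L A))"
      using magree_shift_trunc[OF P, of A L] by (simp add: mball_def)
    ultimately show "A \<in> (\<Union>C\<in>?G. mball m n (- int L) C)" by blast
  qed
  then have "hcontent m n s E \<le> hcontent m n s (\<Union>C\<in>?G. mball m n (- int L) C)" by (rule hcontent_mono)
  also have "\<dots> \<le> ennreal (real (card ?G) * real CARD('a) powr (s * real_of_int (- int L)))"
    by (rule hcontent_finite_balls[OF s]) (use finX X shift_in[OF Pm] in auto)
  also have "\<dots> \<le> ennreal (real (card X) * real CARD('a) powr (- s * real L))"
    using card_image_le[OF finX, of "shift P"] by (intro ennreal_leI mult_mono) auto
  finally show ?thesis .
qed

text \<open>A matrix outside \<open>W\<close> has no solution of degree \<open>T\<close> or more,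
  for some \<open>T\<close>. With \<open>l < a < v(S) / n\<close>, every \<open>q\<close> of large
  degree \<open>t\<close> has \<open>k powr (- a t) < \<psi> q\<close>, so such a matrix is missed
  by all neighbourhoods of the level that \<open>ubiquity\<close> provides, and the missed
  proportion can be made smaller than any \<open>\<eta>\<close>.\<close>

lemma complement_null:
  fixes S :: "(nat \<Rightarrow> 'a::{field,finite} poly) set"
  assumes m: "m \<ge> 1" and n: "n \<ge> 1" and S: "S \<subseteq> polyvecs m" "infinite S"
    and \<psi>: "\<forall>q\<in>polyvecs m. \<exists>r::int. \<psi> q = real CARD('a) powi r"
    and ord: "order_at_infinity m S \<psi> l" and l: "real n * l < conv_exp m S"
  shows "hcontent m n (real (m * n)) (mat_space m n - W_set m n S \<psi>) = 0"
proof -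
  let ?k = "real CARD('a)"
  have k1: "?k > 1" by (rule card_field_gt_1)
  define a where "a = (l + conv_exp m S / real n) / 2"
  have a: "l < a" "real n * a < conv_exp m S" using l n by (auto simp: a_def field_simps)
  obtain T0 where T0: "\<And>t q. t \<ge> T0 \<Longrightarrow> q \<in> level m S t \<Longrightarrow> ?k powr (- a * real t) < \<psi> q"
  proof -
    have "a - l > 0" using a by simp
    from order_at_infinityD[OF S(1) \<psi> ord this] show ?thesis using that by auto
  qed
  define E where "E T = {A \<in> mat_space m n. \<forall>q\<in>S. q \<noteq> (\<lambda>_. 0) \<and> vdeg m q \<ge> T \<longrightarrow> \<not> vdist n (vecmat m n q A) < \<psi> q}" for T
  have "mat_space m n - W_set m n S \<psi> \<subseteq> (\<Union>T\<in>UNIV. E T)"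
  proof
    fix A assume A: "A \<in> mat_space m n - W_set m n S \<psi>"
    define F where "F = {q \<in> S. vdist n (vecmat m n q A) < \<psi> q}"
    have fin: "finite F" using A by (auto simp: W_set_def F_def)
    define T where "T = Suc (Max (insert 0 (vdeg m ` F)))"
    have "\<not> vdist n (vecmat m n q A) < \<psi> q" if "q \<in> S" "vdeg m q \<ge> T" for q
    proof
      assume "vdist n (vecmat m n q A) < \<psi> q"
      then have "vdeg m q \<le> Max (insert 0 (vdeg m ` F))" using that fin by (intro Max_ge) (auto simp: F_def)
      then show False using that by (simp add: T_def)
    qed
    then have "A \<in> E T" using A by (auto simp: E_def)
    then show "A \<in> (\<Union>T\<in>UNIV. E T)" by blast
  qed
  then have "hcontent m n (real (m * n)) (mat_space m n - W_set m n S \<psi>) \<le> hcontent m n (real (m * n)) (\<Union>T\<in>UNIV. E T)"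
    by (rule hcontent_mono)
  also have "\<dots> = 0"
  proof (rule hcontent_null_UN)
    fix T
    show "hcontent m n (real (m * n)) (E T) = 0"
    proof (rule hcontent_null_local)
      show "E T \<subseteq> mat_space m n" by (auto simp: E_def)
      fix P :: "'a lmat" assume P: "P \<in> int_mats m n"
      show "hcontent m n (real (m * n)) (E T \<inter> mball m n 0 P) = 0"
      proof (rule ennreal_zeroI)
        fix \<eta> :: real assume \<eta>: "\<eta> > 0"
        from ubiquity[where a = a and n = n and T = "max T T0", OF m S disjI2[OF a(2)] \<eta>] obtain t where t: "t \<ge> max T T0" "level m S t \<noteq> {}"
          and "real (card {x \<in> supp_on (cells m n (t + nat \<lceil>a * real t\<rceil>)). \<forall>q\<in>level m S t. \<not> near m n q t (nat \<lceil>a * real t\<rceil>) x})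
            \<le> \<eta> * ?k ^ (m * n * (t + nat \<lceil>a * real t\<rceil>))" by blast
        moreover define b where "b = nat \<lceil>a * real t\<rceil>"
        moreover define X where "X = {x \<in> supp_on (cells m n (t + b)). \<forall>q\<in>level m S t. \<not> near m n q t b (x :: 'a cellfun)}"
        ultimately have X: "real (card X) \<le> \<eta> * ?k ^ (m * n * (t + b))" by simp
        have b: "a * real t \<le> real b" unfolding b_def by linarith
        have "hcontent m n (real (m * n)) (E T \<inter> mball m n 0 P) \<le> ennreal (real (card X) * ?k powr (- real (m * n) * real (t + b)))"
        proof (rule hcontent_cylinders[OF P])
          fix A assume A: "A \<in> E T \<inter> mball m n 0 P"
          then have Am: "A \<in> mat_space m n" by (simp add: E_def)
          have "\<not> near m n q t b (trunc m n (t + b) A)" if q: "q \<in> level m S t" for q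
          proof
            assume "near m n q t b (trunc m n (t + b) A)"
            moreover have "degree (q i) \<le> t" if "i < m" for i
              using degree_le_vdeg[OF that, of q] q by (simp add: level_def)
            ultimately have "vdist n (vecmat m n q A) < ?k powi (- int b)"
              using vdist_vecmat_less_iff[OF n Am, of q t b "t + b"] by blast
            also have "\<dots> = ?k powr (- real b)" using powr_real_of_int'[of ?k "- int b"] k1 by simp
            also have "\<dots> \<le> ?k powr (- a * real t)" using b k1 by simp
            also have "\<dots> < \<psi> q" using T0[OF _ q] t by simp
            finally have "vdist n (vecmat m n q A) < \<psi> q" .
            then show False using A q t by (auto simp: E_def level_def)
          qed
          then show "trunc m n (t + b) A \<in> X" by (simp add: X_def)
        qed (use m n in \<open>auto simp: X_def\<close>)
        also have "\<dots> \<le> ennreal \<eta>"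
        proof (rule ennreal_leI)
          have "real (card X) * ?k powr (- real (m * n) * real (t + b))
            \<le> \<eta> * ?k ^ (m * n * (t + b)) * ?k powr (- real (m * n) * real (t + b))"
            using X by (rule mult_right_mono) simp
          also have "\<dots> = \<eta> * (?k powr (real (m * n) * real (t + b)) * ?k powr (- real (m * n) * real (t + b)))"
            using k1 by (simp only: powr_realpow[symmetric] of_nat_mult mult.assoc) 
          also have "\<dots> = \<eta>" using k1 by (simp flip: powr_add)
          finally show "real (card X) * ?k powr (- real (m * n) * real (t + b)) \<le> \<eta>" .
        qed
        finally show "hcontent m n (real (m * n)) (E T \<inter> mball m n 0 P) \<le> ennreal \<eta>" .
      qed
    qed
  qed auto
  finally show ?thesis by simp
qed


text \<open>The convergence half of Borel-Cantelli, for content. The neighbourhood of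
  \<open>q\<close> costs \<open>k powr (n t - \<sigma> L)\<close> with
  \<open>L \<ge> (1 + l - \<epsilon>) t\<close>, hence at most the \<open>(-w)\<close>-th power of
  the norm of \<open>q\<close>; as \<open>w > v(S)\<close>, the tails of the series of costs tend to
  0.\<close>

lemma hcontent_W_upper:
  fixes S :: "(nat \<Rightarrow> 'a::{field,finite} poly) set"
  assumes m: "m \<ge> 1" and n: "n \<ge> 1" and S: "S \<subseteq> polyvecs m" "infinite S"
    and \<psi>: "\<forall>q\<in>polyvecs m. \<exists>r::int. \<psi> q = real CARD('a) powi r"
    and ord: "order_at_infinity m S \<psi> l" and l: "l \<ge> 0"
    and \<sigma>: "\<sigma> > 0" "(real n + conv_exp m S) < \<sigma> * (1 + l)"
  shows "hcontent m n (real n * (real m - 1) + \<sigma>) (W_set m n S \<psi>) = 0"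
proof (rule hcontent_null_local)
  let ?k = "real CARD('a)"
  have k1: "?k > 1" by (rule card_field_gt_1)
  define s where "s = real n * (real m - 1) + \<sigma>"
  have s0: "s > 0" using \<sigma> m unfolding s_def by (simp add: add_nonneg_pos)
  show "W_set m n S \<psi> \<subseteq> mat_space m n" by (auto simp: W_set_def)
  fix P :: "'a lmat" assume P: "P \<in> int_mats m n"
  obtain \<epsilon> where \<epsilon>: "\<epsilon> > 0" "real n + conv_exp m S < \<sigma> * (1 + l - \<epsilon>)"
  proof
    define \<epsilon> where "\<epsilon> = (\<sigma> * (1 + l) - (real n + conv_exp m S)) / (2 * \<sigma>)"
    show "\<epsilon> > 0" using \<sigma> by (simp add: \<epsilon>_def)
    have "\<sigma> * \<epsilon> = (\<sigma> * (1 + l) - (real n + conv_exp m S)) / 2" using \<sigma> by (simp add: \<epsilon>_def)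
    then show "real n + conv_exp m S < \<sigma> * (1 + l - \<epsilon>)" using \<sigma>(2) by (simp add: algebra_simps)
  qed
  define w where "w = \<sigma> * (1 + l - \<epsilon>) - real n"
  have w: "conv_exp m S < w" using \<epsilon> by (simp add: w_def)
  obtain T0 where T0: "\<And>t q. t \<ge> T0 \<Longrightarrow> q \<in> level m S t \<Longrightarrow> \<psi> q < ?k powr (- (l - \<epsilon>) * real t)"
    using order_at_infinityD[OF S(1) \<psi> ord \<epsilon>(1)] by blast
  have "\<forall>q. \<exists>r. q \<in> polyvecs m \<longrightarrow> \<psi> q = ?k powi r" using \<psi> by blast
  from choice[OF this] obtain R where R: "\<And>q. q \<in> polyvecs m \<Longrightarrow> \<psi> q = ?k powi (R q)" by blast
  define S' where "S' = S - {\<lambda>_. 0}"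
  have S': "infinite S'" "S' \<subseteq> polyvecs m" using S by (auto simp: S'_def)
  have "polyvecs m \<subseteq> (\<Union>t. {q :: nat \<Rightarrow> 'a poly. q \<in> polyvecs m \<and> vdeg m q \<le> t})" by auto
  with S'(2) have "S' \<subseteq> (\<Union>t. {q :: nat \<Rightarrow> 'a poly. q \<in> polyvecs m \<and> vdeg m q \<le> t})"
    by (rule order_trans)
  then have cS: "countable S'"
    by (rule countable_subset)
      (intro countable_UN[OF countableI_type] countable_finite finite_polyvecs_vdeg_le)
  define g where "g = from_nat_into S'"
  have g: "bij_betw g UNIV S'" unfolding g_def by (rule bij_betw_from_nat_into[OF cS S'(1)])
  have gin: "g i \<in> S'" for i using bij_betw_apply[OF g] by simp
  define t where "t i = vdeg m (g i)" for i
  \<comment> \<open>A value \<open>\<psi> (g i) \<ge> 1\<close> excludes no matrix;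
    \<open>nat\<close> then gives \<open>b i = 0\<close>, where \<open>near\<close> always
    holds.\<close>
  define b where "b i = nat (- R (g i))" for i
  define B where "B i = {A \<in> mball m n 0 P. near m n (g i) (t i) (b i) (trunc m n (t i + b i) A)}" for i
  define u where "u i = vnorm m (g i) powr (- w)" for i
  have "summable u"
  proof -
    have "(\<lambda>q. vnorm m q powr (- w)) summable_on S'"
      using summable_above_conv_exp[OF m S w] by (rule summable_on_subset) (auto simp: S'_def)
    then have "(\<lambda>i. vnorm m (g i) powr (- w)) summable_on UNIV"
      by (subst summable_on_reindex_bij_betw[OF g])
    then show ?thesis unfolding u_def by (rule summable_on_imp_summable)
  qed
  have u0: "u i \<ge> 0" for i by (simp add: u_def)
  have gp: "g i \<in> polyvecs m" "g i \<noteq> (\<lambda>_. 0)" "g i \<in> level m S (t i)" for i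
    using gin[of i] S' by (auto simp: S'_def level_def t_def)
  have deg: "degree (g i r) \<le> t i" if "r < m" for i r
    using degree_le_vdeg[OF that, of "g i"] by (simp add: t_def)
  have costB: "hcontent m n s (B i) \<le> ennreal (u i)" if ti: "t i \<ge> T0" for i
  proof -
    define L where "L = t i + b i"
    let ?X = "{x \<in> supp_on (cells m n L). near m n (g i) (t i) (b i) x}"
    have "hcontent m n s (B i) \<le> ennreal (real (card ?X) * ?k powr (- s * real L))"
      by (rule hcontent_cylinders[OF P _ s0]) (auto simp: B_def L_def)
    also have "real (card ?X) * ?k powr (- s * real L) \<le> u i"
    proof -
      obtain i0 where i0: "i0 < m" "g i i0 \<noteq> 0" using polyvecs_nonzero gp by blast
      have "card ?X * CARD('a) ^ (n * b i) = CARD('a) ^ (m * n * L)"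
        unfolding L_def by (rule card_near) (use deg i0 in auto)
      from arg_cong[OF this, of real] have "real (card ?X) * ?k ^ (n * b i) = ?k ^ (m * n * L)" by simp
      then have "real (card ?X) * ?k powr (real n * real (b i)) = ?k powr (real m * real n * real L)"
        using k1 by (simp add: powr_realpow[symmetric])
      then have "real (card ?X) * ?k powr (real n * real (b i)) * ?k powr (- (real n * real (b i))) =
          ?k powr (real m * real n * real L) * ?k powr (- (real n * real (b i)))" by simp
      then have cX: "real (card ?X) = ?k powr (real m * real n * real L - real n * real (b i))"
        using k1 by (simp add: mult.assoc flip: powr_add)
      have "?k powi R (g i) = ?k powr real_of_int (R (g i))" using powr_real_of_int'[of ?k "R (g i)"] k1 by simp
      then have "?k powr real_of_int (R (g i)) < ?k powr (- (l - \<epsilon>) * real (t i))"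
        using T0[OF ti gp(3)] R[OF gp(1), of i] by simp
      then have "real_of_int (R (g i)) < - (l - \<epsilon>) * real (t i)" using k1 by simp
      then have bt: "real (b i) \<ge> (l - \<epsilon>) * real (t i)" unfolding b_def by linarith
      have "real (card ?X) * ?k powr (- s * real L) = ?k powr (real n * real (t i) - \<sigma> * real L)"
        unfolding cX using k1 by (simp add: s_def L_def algebra_simps flip: powr_add)
      also have "\<dots> \<le> ?k powr (- w * real (t i))"
      proof -
        have "\<sigma> * ((1 + l - \<epsilon>) * real (t i)) \<le> \<sigma> * real L"
          using bt \<sigma>(1) by (intro mult_left_mono) (auto simp: L_def algebra_simps)
        then show ?thesis using k1 by (simp add: w_def algebra_simps)
      qed
      also have "\<dots> = u i" unfolding u_def t_def by (rule vnorm_powr[OF gp(1,2), symmetric])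
      finally show ?thesis .
    qed
    finally show ?thesis by (simp add: ennreal_leI)
  qed
  \<comment> \<open>The estimate on \<open>\<psi>\<close> starts at degree \<open>T0\<close>;
    dropping finitely many \<open>q\<close> does not affect a condition required infinitely
    often.\<close>
  have "finite {i. t i < T0}"
  proof (rule finite_imageD)
    show "inj_on g {i. t i < T0}" using g by (auto simp: bij_betw_def inj_on_def)
    show "finite (g ` {i. t i < T0})"
      by (rule finite_subset[OF _ finite_polyvecs_vdeg_le[of m T0]]) (use gp in \<open>auto simp: t_def\<close>)
  qed
  then obtain N0 where N0: "\<And>i. t i < T0 \<Longrightarrow> i < N0"
    using finite_nat_set_iff_bounded[of "{i. t i < T0}"] by auto
  show "hcontent m n (real n * (real m - 1) + \<sigma>) (W_set m n S \<psi> \<inter> mball m n 0 P) = 0"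
  proof (rule ennreal_zeroI, fold s_def)
    fix e :: real assume e: "e > 0"
    obtain N1 where N1: "\<And>N. N \<ge> N1 \<Longrightarrow> norm (\<Sum>i. u (i + N)) < e"
      using suminf_exist_split[OF e \<open>summable u\<close>] by blast
    define N where "N = max N0 N1"
    have "W_set m n S \<psi> \<inter> mball m n 0 P \<subseteq> (\<Union>i. B (i + N))"
    proof
      fix A assume A: "A \<in> W_set m n S \<psi> \<inter> mball m n 0 P"
      then have Am: "A \<in> mat_space m n" and inf: "infinite {q \<in> S. vdist n (vecmat m n q A) < \<psi> q}"
        by (auto simp: W_set_def)
      have "infinite ({q \<in> S. vdist n (vecmat m n q A) < \<psi> q} - insert (\<lambda>_. 0) (g ` {..<N}))"
        using inf by (intro Diff_infinite_finite) auto
      from infinite_imp_nonempty[OF this]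
      obtain q where "q \<in> {q \<in> S. vdist n (vecmat m n q A) < \<psi> q} - insert (\<lambda>_. 0) (g ` {..<N})"
        unfolding ex_in_conv[symmetric] ..
      then have q: "q \<in> S" "vdist n (vecmat m n q A) < \<psi> q" "q \<noteq> (\<lambda>_. 0)" "q \<notin> g ` {..<N}"
        by simp_all
      then have "q \<in> S'" by (simp add: S'_def)
      then obtain i where i: "q = g i" using g unfolding bij_betw_def by blast
      have iN: "i \<ge> N" using q(4) i by (meson imageI lessThan_iff not_le)
      have "near m n (g i) (t i) (b i) (trunc m n (t i + b i) A)"
      proof (cases "R (g i) > 0")
        case True
        then have "b i = 0" by (simp add: b_def)
        then show ?thesis by (simp add: near_def)
      next
        case False
        then have "R (g i) = - int (b i)" by (simp add: b_def)
        then have "vdist n (vecmat m n (g i) A) < ?k powi (- int (b i))" using q(2) i R[OF gp(1), of i] by simp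
        then show ?thesis
          using vdist_vecmat_less_iff[OF n Am, of "g i" "t i" "b i" "t i + b i"] deg by blast
      qed
      then have "A \<in> B (i - N + N)" using A iN by (simp add: B_def)
      then show "A \<in> (\<Union>i. B (i + N))" by blast
    qed
    then have "hcontent m n s (W_set m n S \<psi> \<inter> mball m n 0 P) \<le> hcontent m n s (\<Union>i. B (i + N))" by (rule hcontent_mono)
    also have "\<dots> \<le> (\<Sum>i. ennreal (u (i + N)))"
    proof (rule hcontent_UN_le)
      fix i
      have "t (i + N) \<ge> T0" using N0[of "i + N"] by (auto simp: N_def not_less[symmetric])
      then show "hcontent m n s (B (i + N)) \<le> ennreal (u (i + N))" by (rule costB)
    qed (rule u0)
    also have "\<dots> = ennreal (\<Sum>i. u (i + N))"
      using \<open>summable u\<close> u0 by (intro suminf_ennreal2) (auto simp: summable_iff_shift)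
    also have "\<dots> \<le> ennreal e" using N1[of N] by (intro ennreal_leI) (auto simp: N_def)
    finally show "hcontent m n s (W_set m n S \<psi> \<inter> mball m n 0 P) \<le> ennreal e" .
  qed
qed

section \<open>The lower bound\<close>

text \<open>The last conclusion says that the children are spread at least like an
  \<open>s\<close>-dimensional set at all depths from \<open>E\<close> to \<open>L\<close>, the
  input of \<open>good_child\<close>. Beyond depth \<open>t + b0\<close> they spread only like
  planes of dimension \<open>(m - 1) n < s\<close>, so the bound gets tighter until
  \<open>f = L\<close>, where it amounts to \<open>\<sigma> (1 + l) < n + n a\<close> up to errors
  that a large \<open>t\<close> absorbs.\<close>

lemma children_step:
  fixes S :: "(nat \<Rightarrow> 'a::{field,finite} poly) set" and C :: "'a cellfun"
  assumes m: "m \<ge> 1" and n: "n \<ge> 1" and S: "S \<subseteq> polyvecs m" "infinite S"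
    and \<psi>: "\<forall>q\<in>polyvecs m. \<exists>r::int. \<psi> q = real CARD('a) powi r"
    and ord: "order_at_infinity m S \<psi> l"
    and a: "0 \<le> a" "a \<le> l" "a \<le> 0 \<or> real n * a < conv_exp m S"
    and \<sigma>: "0 < \<sigma>" "\<sigma> < real n" "\<sigma> * (1 + l) < real n + real n * a"
    and s: "s = real n * (real m - 1) + \<sigma>"
  shows "\<exists>L>E. \<exists>Ch \<subseteq> supp_on (cells m n L). Ch \<noteq> {} \<and>
      (\<forall>y\<in>Ch. agree m n E y C \<and> (\<exists>q\<in>S. vdeg m q \<ge> T \<and>
          (\<forall>A\<in>mat_space m n. trunc m n L A = y \<longrightarrow> vdist n (vecmat m n q A) < \<psi> q))) \<and>
      (\<forall>f D. E \<le> f \<longrightarrow> f \<le> L \<longrightarrow>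
          real (card {y \<in> Ch. agree m n f y D}) \<le> real (card Ch) * real CARD('a) powr (- s * (real f - real E)))"
proof -
  let ?k = "real CARD('a)"
  have k1: "?k > 1" by (rule card_field_gt_1)
  \<comment> \<open>Uses up half of the slack in the hypothesis on \<open>\<sigma>\<close>;
    \<open>\<delta>\<close> is the other half.\<close>
  define \<epsilon> where "\<epsilon> = (real n + real n * a - \<sigma> * (1 + l)) / (2 * \<sigma>)"
  define \<delta> where "\<delta> = real n + real n * a - \<sigma> * (1 + l + \<epsilon>)"
  have "\<sigma> * \<epsilon> = (real n + real n * a - \<sigma> * (1 + l)) / 2" using \<sigma> by (simp add: \<epsilon>_def)
  then have \<delta>: "\<delta> > 0" using \<sigma>(3) by (simp add: \<delta>_def algebra_simps)
  have \<epsilon>: "\<epsilon> > 0" using \<sigma> by (simp add: \<epsilon>_def)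
  obtain T2 where T2: "\<And>t q. t \<ge> T2 \<Longrightarrow> q \<in> level m S t \<Longrightarrow> ?k powr (- (l + \<epsilon>) * real t) < \<psi> q"
    using order_at_infinityD[OF S(1) \<psi> ord \<epsilon>] by blast
  \<comment> \<open>For the depth \<open>f = L\<close>: \<open>\<sigma>\<close> pays for rounding
    \<open>b1\<close> up, and \<open>(n - \<sigma>) (E + 1)\<close> for starting at depth
    \<open>E\<close> and for the lost proportion \<open>\<eta>\<close>.\<close>
  obtain T1 :: nat where T1: "(\<sigma> + (real n - \<sigma>) * (real E + 1)) / \<delta> \<le> real T1"
    using real_arch_simple by blast
  \<comment> \<open>The surviving proportion \<open>k powr (- (n - \<sigma>))\<close> is regained by
    a single step of depth, because \<open>s\<close> is smaller than the full dimension
    \<open>m n\<close> by \<open>n - \<sigma>\<close>. At \<open>f = E\<close> the bound is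
    trivial.\<close>
  define \<eta> where "\<eta> = 1 - ?k powr (- (real n - \<sigma>))"
  have \<eta>: "\<eta> > 0" using k1 \<sigma>(2) powr_less_mono[of "- (real n - \<sigma>)" 0 ?k] by (simp add: \<eta>_def)
  \<comment> \<open>All bad arrays might lie in the ball of \<open>C\<close>, whose share of the
    arrays is only \<open>k^(-m n E)\<close>.\<close>
  define \<eta>' where "\<eta>' = \<eta> / ?k ^ (m * n * E)"
  have \<eta>': "\<eta>' > 0" using \<eta> k1 by (simp add: \<eta>'_def)
  define Tm where "Tm = max (max T (E + 1)) (max T1 T2)"
  obtain t where t: "t \<ge> Tm" "level m S t \<noteq> {}"
    and bad: "real (card {x \<in> supp_on (cells m n (t + nat \<lceil>a * real t\<rceil>)). \<forall>q\<in>level m S t. \<not> near m n q t (nat \<lceil>a * real t\<rceil>) x})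
       \<le> \<eta>' * ?k ^ (m * n * (t + nat \<lceil>a * real t\<rceil>))"
    using ubiquity[where a = a and n = n and T = Tm, OF m S a(3) \<eta>'] by blast
  have tge: "t \<ge> T" "t > E" "t \<ge> T1" "t \<ge> T2" using t(1) by (auto simp: Tm_def)
  define b0 b1 where "b0 = nat \<lceil>a * real t\<rceil>" and "b1 = nat \<lceil>(l + \<epsilon>) * real t\<rceil>"
  have le: "a * real t \<le> (l + \<epsilon>) * real t" using a \<epsilon> by (intro mult_right_mono) auto
  then have b01: "b0 \<le> b1" unfolding b0_def b1_def by (intro nat_mono ceiling_mono)
  have b0: "real b0 \<ge> a * real t" unfolding b0_def by linarith
  have b1: "real b1 \<ge> (l + \<epsilon>) * real t" unfolding b1_def by linarith
  have b1': "real b1 \<le> (l + \<epsilon>) * real t + 1"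
  proof -
    have "0 \<le> (l + \<epsilon>) * real t" using a \<epsilon> by simp
    then show ?thesis unfolding b1_def by linarith
  qed
  have \<delta>t: "\<delta> * real t \<ge> \<sigma> + (real n - \<sigma>) * (real E + 1)"
  proof -
    have "(\<sigma> + (real n - \<sigma>) * (real E + 1)) / \<delta> \<le> real t" using T1 tge(3) by linarith
    then show ?thesis using \<delta> by (simp add: pos_divide_le_eq mult.commute)
  qed
  have EL: "E \<le> t + b0" using tge by simp
  have "\<eta>' * ?k ^ (m * n * (t + b0)) = \<eta> * ?k ^ (m * n * (t + b0 - E))"
  proof -
    have "?k ^ (m * n * (t + b0)) = ?k ^ (m * n * (t + b0 - E)) * ?k ^ (m * n * E)"
      using EL by (simp add: power_add[symmetric] add_mult_distrib2[symmetric])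
    then show ?thesis using k1 by (simp add: \<eta>'_def)
  qed
  with bad have bad': "real (card {x \<in> supp_on (cells m n (t + b0)). \<forall>q\<in>level m S t. \<not> near m n q t b0 x})
       \<le> \<eta> * ?k ^ (m * n * (t + b0 - E))" by (simp add: b0_def)
  have top: "\<exists>i<m. coeff (q i) t \<noteq> 0" if "q \<in> level m S t" for q
  proof -
    have "q \<in> polyvecs m" "q \<noteq> (\<lambda>_. 0)" "vdeg m q = t" using that S by (auto simp: level_def)
    then obtain i where "i < m" "q i \<noteq> 0" using polyvecs_nonzero by blast
    from vdeg_attained[of i m q, OF this] show ?thesis using \<open>vdeg m q = t\<close> by simp
  qed
  obtain Ch where Ch: "Ch \<subseteq> supp_on (cells m n (t + b1))"
      "\<forall>y\<in>Ch. agree m n E y C \<and> (\<exists>q\<in>level m S t. near m n q t b1 y)"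
      "real (card Ch) \<ge> (1 - \<eta>) * ?k ^ (m * n * (t + b0 - E)) * ?k ^ ((m - 1) * n * (b1 - b0))"
      "\<forall>f D. E \<le> f \<longrightarrow> f \<le> t + b0 \<longrightarrow> card {y \<in> Ch. agree m n f y D} \<le>
           CARD('a) ^ (m * n * (t + b0 - f)) * CARD('a) ^ ((m - 1) * n * (b1 - b0))"
      "\<forall>c D. b0 \<le> c \<longrightarrow> c \<le> b1 \<longrightarrow> card {y \<in> Ch. agree m n (t + c) y D} \<le> CARD('a) ^ ((m - 1) * n * (b1 - c))"
    using children_exist[OF top EL b01 bad', of C] by blast
  have m1: "real (m - 1) = real m - 1" using m by simp
  define X where "X = - (real n - \<sigma>) + real m * real n * (real t + real b0 - real E) + (real m - 1) * real n * (real b1 - real b0)"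
  have N: "?k powr X \<le> real (card Ch)"
  proof -
    have "?k powr X = (1 - \<eta>) * ?k ^ (m * n * (t + b0 - E)) * ?k ^ ((m - 1) * n * (b1 - b0))"
      using k1 EL b01 m1 by (simp add: X_def \<eta>_def powr_add powr_realpow[symmetric] of_nat_diff)
    then show ?thesis using Ch(3) by simp
  qed
  have finCh: "finite Ch" using Ch(1) finite_supp_on[OF finite_cells] by (rule finite_subset)
  have "?k powr X > 0" using k1 by simp
  then have N0: "real (card Ch) > 0" using N by linarith
  have count: "real (card {y \<in> Ch. agree m n f y D}) \<le> real (card Ch) * ?k powr (- s * (real f - real E))"
    if f: "E \<le> f" "f \<le> t + b1" for f D
  proof -
    have main: ?thesis if Y: "real (card {y \<in> Ch. agree m n f y D}) \<le> ?k powr Y" "Y + s * (real f - real E) \<le> X" for Y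
    proof -
      have "?k powr Y \<le> ?k powr (X + - s * (real f - real E))" using Y(2) k1 by simp
      also have "\<dots> = ?k powr X * ?k powr (- s * (real f - real E))" by (rule powr_add)
      also have "\<dots> \<le> real (card Ch) * ?k powr (- s * (real f - real E))" using N by (rule mult_right_mono) simp
      finally show ?thesis using Y(1) by linarith
    qed
    consider "f = E" | "E < f" "f \<le> t + b0" | "t + b0 < f" using f by linarith
    then show ?thesis
    proof cases
      case 1
      have "card {y \<in> Ch. agree m n f y D} \<le> card Ch" using finCh by (intro card_mono) auto
      then show ?thesis using 1 k1 by simp
    next
      case 2
      have "real (card {y \<in> Ch. agree m n f y D}) \<le> real (CARD('a) ^ (m * n * (t + b0 - f)) * CARD('a) ^ ((m - 1) * n * (b1 - b0)))"
        using Ch(4) 2 by (intro of_nat_mono) auto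
      also have "\<dots> = ?k powr (real m * real n * (real t + real b0 - real f) + (real m - 1) * real n * (real b1 - real b0))"
        using k1 2 b01 m1 by (simp add: powr_add powr_realpow[symmetric] of_nat_diff)
      finally show ?thesis
      proof (rule main)
        have "(real n - \<sigma>) * 1 \<le> (real n - \<sigma>) * (real f - real E)" using 2 \<sigma>(2) by (intro mult_left_mono) auto
        then show "real m * real n * (real t + real b0 - real f) + (real m - 1) * real n * (real b1 - real b0)
          + s * (real f - real E) \<le> X" unfolding X_def s by (simp add: algebra_simps)
      qed
    next
      case 3
      define c where "c = f - t"
      have c: "f = t + c" "b0 \<le> c" "c \<le> b1" using 3 f by (auto simp: c_def)
      have "real (card {y \<in> Ch. agree m n f y D}) \<le> real (CARD('a) ^ ((m - 1) * n * (b1 - c)))"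
        using Ch(5) c by (intro of_nat_mono) auto
      also have "\<dots> = ?k powr ((real m - 1) * real n * (real b1 - real c))"
        using k1 c m1 by (simp add: powr_realpow[symmetric] of_nat_diff)
      finally show ?thesis
      proof (rule main)
        have "\<sigma> * real c \<le> \<sigma> * ((l + \<epsilon>) * real t + 1)" using c(3) b1' \<sigma>(1) by (intro mult_left_mono) auto
        moreover have "real n * (a * real t) \<le> real n * real b0" using b0 by (intro mult_left_mono) auto
        moreover have "\<delta> * real t = real n * real t + real n * (a * real t) - \<sigma> * real t - \<sigma> * ((l + \<epsilon>) * real t)"
          by (simp add: \<delta>_def algebra_simps)
        ultimately have "real n * (real t + real b0 - real E) - \<sigma> * (real t + real c - real E) - (real n - \<sigma>) \<ge> 0"
          using \<delta>t by (simp add: algebra_simps)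
        then show "(real m - 1) * real n * (real b1 - real c) + s * (real f - real E) \<le> X"
          unfolding X_def s c(1) by (simp add: algebra_simps)
      qed
    qed
  qed
  have hit: "\<exists>q\<in>S. vdeg m q \<ge> T \<and> (\<forall>A\<in>mat_space m n. trunc m n (t + b1) A = y \<longrightarrow> vdist n (vecmat m n q A) < \<psi> q)"
    if y: "y \<in> Ch" for y
  proof -
    obtain q where q: "q \<in> level m S t" "near m n q t b1 y" using Ch(2) y by blast
    have "vdist n (vecmat m n q A) < \<psi> q" if A: "A \<in> mat_space m n" "trunc m n (t + b1) A = y" for A
    proof -
      have "degree (q i) \<le> t" if "i < m" for i
        using degree_le_vdeg[OF that, of q] q by (simp add: level_def)
      then have "vdist n (vecmat m n q A) < ?k powi (- int b1)"
        using vdist_vecmat_less_iff[OF n A(1), of q t b1 "t + b1"] q(2) A(2) by blast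
      also have "\<dots> = ?k powr (- real b1)" using powr_real_of_int'[of ?k "- int b1"] k1 by simp
      also have "\<dots> \<le> ?k powr (- (l + \<epsilon>) * real t)"
      proof (rule powr_mono)
        show "- real b1 \<le> - (l + \<epsilon>) * real t" using b1 by linarith
      qed (use k1 in simp)
      also have "\<dots> < \<psi> q" using T2 q tge by blast
      finally show ?thesis .
    qed
    moreover have "q \<in> S" "vdeg m q \<ge> T" using q tge by (auto simp: level_def)
    ultimately show ?thesis by blast
  qed
  have "Ch \<noteq> {}" using N0 by auto
  moreover have "t + b1 > E" using tge by simp
  ultimately show ?thesis using Ch(1,2) count hit by (intro exI[of _ "t + b1"] conjI exI[of _ Ch]) auto
qed

text \<open>If every child of a ball met too much of the cover, then summing over the children would
  show that the ball itself does.  This replaces a measure on the Cantor set of iterated children.\<close>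

lemma good_child:
  fixes Cc :: "nat \<Rightarrow> 'a::{field,finite} lmat" and r :: "nat \<Rightarrow> int"
    and s :: real and m n :: nat
  defines "c \<equiv> \<lambda>i. real CARD('a) powr (s * real_of_int (r i))"
  defines "meets \<equiv> \<lambda>L x i. mball m n (r i) (Cc i) \<inter> mball m n (- int L) (embed x) \<noteq> {}"
  assumes s: "s > 0" and sum: "summable c"
    and C: "C \<in> supp_on (cells m n E)" and good: "(\<Sum>i. if meets E C i then c i else 0) < real CARD('a) powr (- s * real E)"
    and L: "L > E" and Ch: "Ch \<subseteq> supp_on (cells m n L)" "Ch \<noteq> {}" "\<And>y. y \<in> Ch \<Longrightarrow> agree m n E y C"
    and count: "\<And>f D. E \<le> f \<Longrightarrow> f \<le> L \<Longrightarrow>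
          real (card {y \<in> Ch. agree m n f y D}) \<le> real (card Ch) * real CARD('a) powr (- s * (real f - real E))"
  shows "\<exists>y\<in>Ch. (\<Sum>i. if meets L y i then c i else 0) < real CARD('a) powr (- s * real L)"
proof (rule ccontr)
  let ?k = "real CARD('a)"
  have k1: "?k > 1" by (rule card_field_gt_1)
  assume "\<not> ?thesis"
  then have bad: "?k powr (- s * real L) \<le> (\<Sum>i. if meets L y i then c i else 0)" if "y \<in> Ch" for y
    using that by (meson not_le)
  have finCh: "finite Ch" using Ch(1) finite_supp_on[OF finite_cells] by (rule finite_subset)
  have N0: "real (card Ch) > 0" using finCh Ch(2) by (simp add: card_gt_0_iff)
  have c0: "c i > 0" for i using k1 by (simp add: c_def)
  have cL: "?k powr (s * real L) > 0" using k1 by simp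
  \<comment> \<open>Cost relative to the ball of a child, capped at 1 so that a cover ball larger
    than the children is not overweighted. A child that violates the conclusion has total weight at
    least 1.\<close>
  define w where "w i y = (if meets L y i then min 1 (c i * ?k powr (s * real L)) else 0)" for i y
  have sub: "summable (\<lambda>i. if P i then c i else 0)" for P
    by (rule summable_comparison_test'[OF sum, of 0]) (use c0 in \<open>auto simp: less_imp_le\<close>)
  have w0: "w i y \<ge> 0" for i y using c0[of i] cL by (simp add: w_def)
  have sw: "summable (\<lambda>i. w i y)" for y
  proof (rule summable_comparison_test'[where N = 0 and g = "\<lambda>i. c i * ?k powr (s * real L)"])
    show "summable (\<lambda>i. c i * ?k powr (s * real L))" using sum by (rule summable_mult2)
    show "norm (w i y) \<le> c i * ?k powr (s * real L)" for i
      using w0[of i y] c0[of i] cL by (simp add: w_def)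
  qed
  have w1: "1 \<le> (\<Sum>i. w i y)" if y: "y \<in> Ch" for y
  proof (cases "\<exists>i. meets L y i \<and> c i * ?k powr (s * real L) \<ge> 1")
    case True
    then obtain i where "meets L y i" "c i * ?k powr (s * real L) \<ge> 1" by blast
    then have "w i y = 1" by (simp add: w_def)
    moreover have "sum (\<lambda>i. w i y) {i} \<le> (\<Sum>i. w i y)" using sw w0 by (intro sum_le_suminf) auto
    ultimately show ?thesis by simp
  next
    case False
    then have "w i y = (if meets L y i then c i else 0) * ?k powr (s * real L)" for i
      by (auto simp: w_def not_le min_def)
    then have "(\<Sum>i. w i y) = (\<Sum>i. if meets L y i then c i else 0) * ?k powr (s * real L)"
      using suminf_mult2[OF sub[of "meets L y"], of "?k powr (s * real L)"] by simp
    moreover have "?k powr (- s * real L) * ?k powr (s * real L) \<le> \<dots>"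
      using bad[OF y] cL by (intro mult_right_mono) auto
    moreover have "?k powr (- s * real L) * ?k powr (s * real L) = 1" using k1 by (simp flip: powr_add)
    ultimately show ?thesis by linarith
  qed
  have meetsE: "meets E C i" if y: "y \<in> Ch" "meets L y i" for y i
  proof -
    have yL: "y \<in> supp_on (cells m n L)" using y Ch(1) by blast
    obtain A where A: "A \<in> mball m n (r i) (Cc i)" "A \<in> mat_space m n" "magree m n (- int L) A (embed y)"
      using y(2) by (auto simp: meets_def mball_def)
    have "magree m n (- int E) A (embed y)" using A(3) L by (intro magree_mono[OF _ A(3)]) auto
    moreover have "agree m n E (trunc m n E (embed y)) C"
      using Ch(3)[OF y(1)] L yL unfolding agree_def trunc_def embed_def cells_def by auto
    then have "magree m n (- int E) (embed y) (embed C)"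
      by (subst embed_magree_iff[OF C]) (auto simp: embed_def)
    ultimately have "A \<in> mball m n (- int E) (embed C)" using A(2) magree_trans by (auto simp: mball_def)
    then show ?thesis using A(1) by (auto simp: meets_def)
  qed
  have wsum: "(\<Sum>y\<in>Ch. w i y) \<le> (if meets E C i then c i else 0) * (real (card Ch) * ?k powr (s * real E))" for i
  proof (cases "meets E C i")
    case False
    then have "w i y = 0" if "y \<in> Ch" for y using meetsE that by (auto simp: w_def)
    then show ?thesis using False by simp
  next
    case True
    \<comment> \<open>A single cover ball meeting the parent costs less than the parent, so its
      radius is smaller.\<close>
    have "sum (\<lambda>i. if meets E C i then c i else 0) {i} \<le> (\<Sum>i. if meets E C i then c i else 0)"
      using sub c0 by (intro sum_le_suminf) (auto simp: less_imp_le)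
    then have "c i < ?k powr (- s * real E)" using good True by simp
    then have "s * real_of_int (r i) < - s * real E" using k1 by (simp add: c_def)
    then have "s * real_of_int (r i) < s * (- real E)" by simp
    then have "real_of_int (r i) < - real E" using s by (simp only: mult_less_cancel_left_pos)
    then have rE: "r i < - int E" by linarith
    define f where "f = nat (- r i)"
    have f: "r i = - int f" "E < f" using rE by (auto simp: f_def)
    show ?thesis
    \<comment> \<open>A cover ball at least as large as the children meets only those counted by
      \<open>count\<close> at depth \<open>f\<close>. A smaller one meets at most one child, and
      \<open>count\<close> at depth \<open>L\<close> bounds the number of children from
      below.\<close>
    proof (cases "f \<le> L")
      case True
      have sub1: "{y \<in> Ch. meets L y i} \<subseteq> {y \<in> Ch. agree m n f y (trunc m n f (Cc i))}"
      proof
        fix y assume y: "y \<in> {y \<in> Ch. meets L y i}"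
        then have yL: "y \<in> supp_on (cells m n L)" using Ch(1) by blast
        obtain A where A: "magree m n (- int f) A (Cc i)" "magree m n (- int L) A (embed y)"
          using y by (auto simp: meets_def mball_def f)
        have "magree m n (- int f) (embed y) A" using magree_sym[OF magree_mono[OF _ A(2)]] True by simp
        then have "magree m n (- int f) (embed y) (Cc i)" using A(1) magree_trans by blast
        then have "agree m n f (trunc m n L (embed y)) (trunc m n f (Cc i))"
          using True by (subst agree_trunc_iff) (auto simp: magree_def)
        then show "y \<in> {y \<in> Ch. agree m n f y (trunc m n f (Cc i))}" using y trunc_embed[OF yL, of L] by simp
      qed
      have "(\<Sum>y\<in>Ch. w i y) = (\<Sum>y\<in>{y \<in> Ch. meets L y i}. w i y)"
        using finCh by (intro sum.mono_neutral_right) (auto simp: w_def)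
      also have "\<dots> \<le> (\<Sum>y\<in>{y \<in> Ch. meets L y i}. 1)" by (intro sum_mono) (simp add: w_def)
      also have "\<dots> \<le> real (card {y \<in> Ch. agree m n f y (trunc m n f (Cc i))})"
        using sub1 finCh by (simp add: card_mono)
      also have "\<dots> \<le> real (card Ch) * ?k powr (- s * (real f - real E))" using count f(2) True by simp
      also have "\<dots> = c i * (real (card Ch) * ?k powr (s * real E))"
        using k1 by (simp add: c_def f(1) algebra_simps flip: powr_add)
      finally show ?thesis using \<open>meets E C i\<close> by simp
    next
      case False
      have uniq: "y = y'" if y: "y \<in> Ch" "meets L y i" and y': "y' \<in> Ch" "meets L y' i" for y y'
      proof -
        have yL: "y \<in> supp_on (cells m n L)" "y' \<in> supp_on (cells m n L)" using y y' Ch(1) by auto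
        obtain A A' where A: "magree m n (- int f) A (Cc i)" "magree m n (- int L) A (embed y)"
            "magree m n (- int f) A' (Cc i)" "magree m n (- int L) A' (embed y')"
          using y y' by (auto simp: meets_def mball_def f)
        have "magree m n (- int f) A A'" using A(1,3) magree_sym magree_trans by blast
        then have "magree m n (- int L) A A'" using False by (intro magree_mono[of "- int f" "- int L"]) auto
        then have "magree m n (- int L) (embed y) (embed y')" using A(2,4) magree_sym magree_trans by blast
        then have "agree m n L (trunc m n L (embed y)) (trunc m n L (embed y'))"
          by (subst agree_trunc_iff) (auto simp: magree_def)
        then have "agree m n L y y'" using trunc_embed yL by (metis order_refl)
        then show "y = y'" by (rule supp_on_cells_eqI[OF yL])
      qed
      have card1: "card {y \<in> Ch. meets L y i} \<le> 1"
      proof -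
        have "card {y \<in> Ch. meets L y i} \<le> Suc 0"
          by (rule card_le_Suc0_iff_eq[THEN iffD2]) (use finCh uniq in auto)
        then show ?thesis by simp
      qed
      have N1: "?k powr (s * (real L - real E)) \<le> real (card Ch)"
      proof -
        obtain y where y: "y \<in> Ch" using Ch(2) by blast
        have "card {y' \<in> Ch. agree m n L y' y} \<ge> 1"
          using y finCh by (auto simp: Suc_le_eq card_gt_0_iff agree_def)
        then have "1 \<le> real (card {y' \<in> Ch. agree m n L y' y})" by simp
        also have "\<dots> \<le> real (card Ch) * ?k powr (- s * (real L - real E))" using count[of L y] L by simp
        finally have "1 * ?k powr (s * (real L - real E)) \<le> real (card Ch) * ?k powr (- s * (real L - real E)) * ?k powr (s * (real L - real E))"
          by (rule mult_right_mono) simp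
        also have "\<dots> = real (card Ch)" using k1 by (simp add: mult.assoc flip: powr_add)
        finally show ?thesis by simp
      qed
      have "(\<Sum>y\<in>Ch. w i y) = (\<Sum>y\<in>{y \<in> Ch. meets L y i}. w i y)"
        using finCh by (intro sum.mono_neutral_right) (auto simp: w_def)
      also have "\<dots> \<le> (\<Sum>y\<in>{y \<in> Ch. meets L y i}. c i * ?k powr (s * real L))" by (intro sum_mono) (simp add: w_def)
      also have "\<dots> = real (card {y \<in> Ch. meets L y i}) * (c i * ?k powr (s * real L))" by simp
      also have "\<dots> \<le> 1 * (c i * ?k powr (s * real L))"
        using card1 c0[of i] cL by (intro mult_right_mono) auto
      also have "\<dots> = c i * (?k powr (s * (real L - real E)) * ?k powr (s * real E))"
        using k1 by (simp add: algebra_simps flip: powr_add)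
      also have "\<dots> \<le> c i * (real (card Ch) * ?k powr (s * real E))"
        using N1 c0[of i] by (intro mult_left_mono mult_right_mono) auto
      finally show ?thesis using \<open>meets E C i\<close> by simp
    qed
  qed
  have "real (card Ch) = (\<Sum>y\<in>Ch. 1)" by simp
  also have "\<dots> \<le> (\<Sum>y\<in>Ch. \<Sum>i. w i y)" using w1 by (rule sum_mono)
  also have "\<dots> = (\<Sum>i. \<Sum>y\<in>Ch. w i y)" using sw by (intro suminf_sum[symmetric]) auto
  also have "\<dots> \<le> (\<Sum>i. (if meets E C i then c i else 0) * (real (card Ch) * ?k powr (s * real E)))"
    using wsum sw by (intro suminf_le summable_sum summable_mult2 sub) auto
  also have "\<dots> = (\<Sum>i. if meets E C i then c i else 0) * (real (card Ch) * ?k powr (s * real E))"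
    by (rule suminf_mult2[OF sub, symmetric])
  also have "\<dots> < ?k powr (- s * real E) * (real (card Ch) * ?k powr (s * real E))"
    using good N0 k1 by (intro mult_strict_right_mono) auto
  also have "\<dots> = real (card Ch) * (?k powr (- s * real E) * ?k powr (s * real E))" by (simp only: mult_ac)
  also have "\<dots> = real (card Ch)" using k1 by (simp flip: powr_add)
  finally show False by simp
qed

text \<open>Under a cover of cost below 1 the root ball is good, and \<open>children_step\<close>
  with \<open>good_child\<close> yields nested good balls, the one at stage \<open>j + 1\<close>
  provided with a solution of degree at least \<open>j\<close>. Their limit lies in
  \<open>W\<close>, yet a cover ball containing it meets all of them and would have to be cheaper
  than each.\<close>

lemma hcontent_W_lower:
  fixes S :: "(nat \<Rightarrow> 'a::{field,finite} poly) set"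
  assumes m: "m \<ge> 1" and n: "n \<ge> 1" and S: "S \<subseteq> polyvecs m" "infinite S"
    and \<psi>: "\<forall>q\<in>polyvecs m. \<exists>r::int. \<psi> q = real CARD('a) powi r"
    and ord: "order_at_infinity m S \<psi> l"
    and a: "0 \<le> a" "a \<le> l" "a \<le> 0 \<or> real n * a < conv_exp m S"
    and \<sigma>: "0 < \<sigma>" "\<sigma> < real n" "\<sigma> * (1 + l) < real n + real n * a"
    and s: "s = real n * (real m - 1) + \<sigma>"
  shows "hcontent m n s (W_set m n S \<psi>) \<noteq> 0"
proof
  let ?k = "real CARD('a)"
  have k1: "?k > 1" by (rule card_field_gt_1)
  have s0: "s > 0" using \<sigma>(1) m unfolding s by (simp add: add_nonneg_pos)
  assume "hcontent m n s (W_set m n S \<psi>) = 0"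
  then have "hcontent m n s (W_set m n S \<psi>) < ennreal 1" by simp
  then obtain Cc :: "nat \<Rightarrow> 'a lmat" and r where cover: "W_set m n S \<psi> \<subseteq> (\<Union>i. mball m n (r i) (Cc i))"
      and sm: "(\<Sum>i. ennreal (?k powr (s * real_of_int (r i)))) < ennreal 1"
    by (rule hcontent_lessE) blast
  define c where "c = (\<lambda>i. ?k powr (s * real_of_int (r i)))"
  have c0: "c i > 0" for i using k1 by (simp add: c_def)
  have sumc: "summable c"
  proof (rule summable_suminf_not_top)
    show "(\<Sum>i. ennreal (c i)) \<noteq> top"
      using order_less_trans[OF sm ennreal_less_top] by (simp add: c_def less_top)
  qed (use c0 in \<open>simp add: less_imp_le\<close>)
  have "(\<Sum>i. ennreal (c i)) = ennreal (\<Sum>i. c i)"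
    using sumc c0 by (intro suminf_ennreal2) (auto simp: less_imp_le)
  then have "ennreal (\<Sum>i. c i) < ennreal 1" using sm by (simp add: c_def)
  moreover have "(\<Sum>i. c i) \<ge> 0" using sumc c0 by (intro suminf_nonneg) (auto simp: less_imp_le)
  ultimately have c1: "(\<Sum>i. c i) < 1" by (simp add: ennreal_less_iff)
  define meets where "meets = (\<lambda>L x i. mball m n (r i) (Cc i) \<inter> mball m n (- int L) (embed x) \<noteq> {})"
  define good where "good = (\<lambda>L x. (\<Sum>i. if meets L x i then c i else 0) < ?k powr (- s * real L))"
  have sub: "summable (\<lambda>i. if P i then c i else 0)" for P
    by (rule summable_comparison_test'[OF sumc, of 0]) (use c0 in \<open>auto simp: less_imp_le\<close>)
  define hit where "hit = (\<lambda>T L x. \<exists>q\<in>S. vdeg m q \<ge> T \<and>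
          (\<forall>A\<in>mat_space m n. trunc m n L A = x \<longrightarrow> vdist n (vecmat m n q A) < \<psi> q))"
  define Pst where "Pst = (\<lambda>(_ :: nat) (L, x). x \<in> supp_on (cells m n L) \<and> good L x)"
  define Qst where "Qst = (\<lambda>T (E, C) (L, x). E < L \<and> agree m n E x C \<and> hit T L x)"
  have "\<exists>f. \<forall>j. Pst j (f j) \<and> Qst j (f j) (f (Suc j))"
  proof (rule dependent_nat_choice)
    have "(\<Sum>i. if meets 0 (\<lambda>_. 0) i then c i else 0) \<le> (\<Sum>i. c i)"
      using sub sumc c0 by (intro suminf_le) (auto simp: less_imp_le)
    then have "good 0 (\<lambda>_. 0)" using c1 k1 by (simp add: good_def)
    then show "\<exists>x. Pst 0 x" by (intro exI[of _ "(0, \<lambda>_. 0)"]) (simp add: Pst_def supp_on_def)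
  next
    fix st T assume "Pst T st"
    then obtain E C where st: "st = (E, C)" "C \<in> supp_on (cells m n E)" "good E C" by (cases st) (auto simp: Pst_def)
    obtain L Ch where L: "E < L" and Ch: "Ch \<subseteq> supp_on (cells m n L)" "Ch \<noteq> {}"
       and hitCh0: "\<forall>y\<in>Ch. agree m n E y C \<and> (\<exists>q\<in>S. vdeg m q \<ge> T \<and>
          (\<forall>A\<in>mat_space m n. trunc m n L A = y \<longrightarrow> vdist n (vecmat m n q A) < \<psi> q))"
       and cnt: "\<forall>f D. E \<le> f \<longrightarrow> f \<le> L \<longrightarrow>
          real (card {y \<in> Ch. agree m n f y D}) \<le> real (card Ch) * real CARD('a) powr (- s * (real f - real E))"
      using children_step[OF m n S \<psi> ord a \<sigma> s, of E C T] by (elim exE conjE) (rule that)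
    have hitCh: "\<forall>y\<in>Ch. agree m n E y C \<and> hit T L y" unfolding hit_def by (rule hitCh0)
    have "\<exists>y\<in>Ch. (\<Sum>i. if mball m n (r i) (Cc i) \<inter> mball m n (- int L) (embed y) \<noteq> {} then ?k powr (s * real_of_int (r i)) else 0)
        < ?k powr (- s * real L)"
    proof (rule good_child[OF s0 _ st(2) _ L Ch])
      show "summable (\<lambda>i. ?k powr (s * real_of_int (r i)))" using sumc by (simp add: c_def)
      show "(\<Sum>i. if mball m n (r i) (Cc i) \<inter> mball m n (- int E) (embed C) \<noteq> {} then ?k powr (s * real_of_int (r i)) else 0)
        < ?k powr (- s * real E)" using st(3) by (simp only: good_def meets_def c_def)
    qed (use hitCh cnt in auto)
    then obtain y where "y \<in> Ch" "good L y" by (auto simp only: good_def meets_def c_def)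
    then show "\<exists>st'. Pst (Suc T) st' \<and> Qst T st st'"
      using Ch(1) hitCh L by (intro exI[of _ "(L, y)"]) (auto simp: Pst_def Qst_def st)
  qed
  then obtain f where f: "\<And>j. Pst j (f j) \<and> Qst j (f j) (f (Suc j))" by blast
  define L x where "L j = fst (f j)" and "x j = snd (f j)" for j
  have st: "x j \<in> supp_on (cells m n (L j))" "good (L j) (x j)" "L j < L (Suc j)"
      "agree m n (L j) (x (Suc j)) (x j)" "hit j (L (Suc j)) (x (Suc j))" for j
    using f[of j] by (auto simp: Pst_def Qst_def L_def x_def case_prod_unfold)
  have Lj: "j \<le> L j" for j
  proof (induction j)
    case (Suc j)
    then show ?case using st(3)[of j] by linarith
  qed simp
  have Lmono: "L i \<le> L j" if "i \<le> j" for i j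
    using that st(3) by (metis lift_Suc_mono_le less_imp_le)
  have agrx: "agree m n (L i) (x (i + d)) (x i)" for i d
  proof (induction d)
    case (Suc d)
    have "agree m n (L (i + d)) (x (Suc (i + d))) (x (i + d))" by (rule st(4))
    then have "agree m n (L i) (x (Suc (i + d))) (x (i + d))" by (rule agree_mono[OF Lmono[OF le_add1]])
    from agree_trans[OF this Suc] show ?case by simp
  qed (simp add: agree_def)
  \<comment> \<open>The digit at depth \<open>l\<close> is read from stage \<open>l\<close>, where
    it is final because \<open>l \<le> L l\<close>.\<close>
  define z where "z = (\<lambda>(i, j, l). x l (i, j, l))"
  define A where "A = embed z"
  have Am: "A \<in> mat_space m n" unfolding A_def
  proof (rule embed_in_mat_space)
    fix i j l assume "\<not> (i < m \<and> j < n)"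
    then show "z (i, j, l) = 0" using st(1)[of l] by (simp add: z_def supp_on_def cells_def)
  qed
  have trA: "trunc m n (L p) A = x p" for p
  proof (rule supp_on_cells_eqI[OF trunc_in st(1)])
    show "agree m n (L p) (trunc m n (L p) A) (x p)"
      unfolding agree_def
    proof (intro allI impI ballI)
      fix i j l assume u: "i < m" "j < n" "l \<in> {1..L p}"
      have "trunc m n (L p) A (i, j, l) = x l (i, j, l)"
        using u by (simp add: trunc_def cells_def A_def embed_def z_def)
      also have "\<dots> = x p (i, j, l)"
      proof (cases "p \<le> l")
        case True
        then have "agree m n (L p) (x l) (x p)" using agrx[of p "l - p"] by simp
        then show ?thesis using u unfolding agree_def by blast
      next
        case False
        then have "agree m n (L l) (x p) (x l)" using agrx[of l "p - l"] by simp
        moreover have "l \<in> {1..L l}" using u Lj[of l] by auto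
        ultimately show ?thesis using u unfolding agree_def by metis
      qed
      finally show "trunc m n (L p) A (i, j, l) = x p (i, j, l)" .
    qed
  qed
  have "A \<in> W_set m n S \<psi>"
  proof -
    have "infinite {q \<in> S. vdist n (vecmat m n q A) < \<psi> q}"
    proof
      assume fin: "finite {q \<in> S. vdist n (vecmat m n q A) < \<psi> q}"
      define T where "T = Suc (Max (insert 0 (vdeg m ` {q \<in> S. vdist n (vecmat m n q A) < \<psi> q})))"
      obtain q where q: "q \<in> S" "vdeg m q \<ge> T" "vdist n (vecmat m n q A) < \<psi> q"
        using st(5)[of T] trA[of "Suc T"] Am unfolding hit_def by blast
      then have "vdeg m q \<le> Max (insert 0 (vdeg m ` {q \<in> S. vdist n (vecmat m n q A) < \<psi> q}))"
        using fin by (intro Max_ge) auto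
      then show False using q by (simp add: T_def)
    qed
    then show ?thesis using Am by (simp add: W_set_def)
  qed
  then obtain i where i: "A \<in> mball m n (r i) (Cc i)" using cover by blast
  have lt: "c i < ?k powr (- s * real (L j))" for j
  proof -
    have "magree m n (- int (L j)) A (embed (x j))"
      using embed_magree_iff[OF st(1)[of j] order_refl, of A] trA[of j] by (simp add: A_def embed_def agree_def)
    then have "meets (L j) (x j) i" using i Am by (auto simp: meets_def mball_def)
    moreover have "sum (\<lambda>i. if meets (L j) (x j) i then c i else 0) {i} \<le> (\<Sum>i. if meets (L j) (x j) i then c i else 0)"
      using sub c0 by (intro sum_le_suminf) (auto simp: less_imp_le)
    ultimately show ?thesis using st(2)[of j] by (simp add: good_def)
  qed
  \<comment> \<open>At stage \<open>J\<close> the nested ball is at least as deep as the cover ball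
    \<open>i\<close>.\<close>
  define J where "J = nat (- r i)"
  have "s * real_of_int (r i) < - s * real (L J)" using lt[of J] k1 by (simp add: c_def)
  then have "s * real_of_int (r i) < s * (- real (L J))" by simp
  then have "real_of_int (r i) < - real (L J)" using s0 by (simp only: mult_less_cancel_left_pos)
  then show False using Lj[of J] unfolding J_def by linarith
qed

theorem theorem1:
  fixes S :: "(nat \<Rightarrow> 'a::{field,finite} poly) set"
    and \<psi> :: "(nat \<Rightarrow> 'a poly) \<Rightarrow> real"
    and m n :: nat and l :: real
  assumes "m \<ge> 1" and "n \<ge> 1"
    and "S \<subseteq> polyvecs m" and "infinite S"
    and "\<forall>q\<in>polyvecs m. \<exists>r::int. \<psi> q = real CARD('a) powi r"
    and "\<forall>q\<in>polyvecs m. \<forall>q'\<in>polyvecs m. vnorm m q = vnorm m q' \<longrightarrow> \<psi> q = \<psi> q'"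
    and "\<forall>q\<in>polyvecs m. \<forall>q'\<in>polyvecs m. vnorm m q \<le> vnorm m q' \<longrightarrow> \<psi> q' \<le> \<psi> q"
    and "order_at_infinity m S \<psi> l"
  shows "(real n * l < conv_exp m S \<longrightarrow>
            haar_outer m n (mat_space m n - W_set m n S \<psi>) = 0)
       \<and> (real n * l \<ge> conv_exp m S \<longrightarrow>
            hdim m n (W_set m n S \<psi>) =
              real n * (real m - 1) + (real n + conv_exp m S) / (1 + l))"
proof (intro conjI impI)
  note mn = assms(1,2) and S = assms(3,4) and \<psi> = assms(5) and ord = assms(8)
  show "haar_outer m n (mat_space m n - W_set m n S \<psi>) = 0" if "real n * l < conv_exp m S"
    by (rule haar_outer_eq_0[OF mn complement_null[OF mn S \<psi> ord that]])
  assume lv: "real n * l \<ge> conv_exp m S"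
  define v \<theta> where "v = conv_exp m S" and "\<theta> = (real n + v) / (1 + l)"
  define D where "D = real n * (real m - 1) + \<theta>"
  define base where "base = real n * (real m - 1)"
  have n0: "real n > 0" using mn by simp
  have v0: "v \<ge> 0" unfolding v_def by (rule conv_exp_nonneg[OF mn(1) S])
  then have "real n * l \<ge> 0" using lv by (simp add: v_def)
  then have l0: "l \<ge> 0" using n0 by (simp add: zero_le_mult_iff)
  have \<theta>: "\<theta> > 0" "\<theta> * (1 + l) = real n + v" using n0 v0 l0 by (simp_all add: \<theta>_def)
  \<comment> \<open>This is \<open>v \<le> n l\<close> rewritten; it supplies the bound
    \<open>\<sigma> < n\<close> for the lower estimate.\<close>
  have \<theta>n: "\<theta> \<le> real n" using lv l0 unfolding \<theta>_def v_def by (simp add: pos_divide_le_eq algebra_simps)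
  have base0: "base \<ge> 0" using mn by (simp add: base_def)
  let ?Z = "{s. 0 \<le> s \<and> hausdorff m n s (W_set m n S \<psi>) = 0}"
  have upper: "s \<in> ?Z" if "s > D" for s
  proof -
    define \<sigma> where "\<sigma> = s - base"
    have \<sigma>: "\<sigma> > \<theta>" using that by (simp add: \<sigma>_def D_def base_def)
    then have "\<theta> * (1 + l) < \<sigma> * (1 + l)" using l0 by (intro mult_strict_right_mono) auto
    then have "hcontent m n (real n * (real m - 1) + \<sigma>) (W_set m n S \<psi>) = 0"
      using \<sigma> \<theta> by (intro hcontent_W_upper[OF mn S \<psi> ord l0]) (auto simp: v_def)
    then have "hcontent m n s (W_set m n S \<psi>) = 0" by (simp add: \<sigma>_def base_def)
    moreover have "s > 0" using \<sigma> \<theta>(1) base0 by (simp add: \<sigma>_def)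
    ultimately show ?thesis using hausdorff_eq_0[OF mn] by (simp add: less_imp_le)
  qed
  have lower: "D \<le> s" if "s \<in> ?Z" for s
  proof (rule ccontr)
    assume "\<not> D \<le> s"
    \<comment> \<open>\<open>s\<close> may lie below \<open>base\<close>, where
      \<open>\<sigma>\<close> would not be positive, so the contradiction is sought at a larger
      exponent \<open>s'\<close>, to which vanishing passes.\<close>
    then have "max s base < D" using \<theta>(1) by (simp add: D_def base_def)
    then obtain s' where s': "max s base < s'" "s' < D" using dense by blast
    define \<sigma> where "\<sigma> = s' - base"
    have \<sigma>: "0 < \<sigma>" "\<sigma> < \<theta>" using s' by (simp_all add: \<sigma>_def D_def base_def)
    have "\<sigma> * (1 + l) < real n + v"
      using mult_strict_right_mono[OF \<sigma>(2), of "1 + l"] \<theta>(2) l0 by simp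
    then have d: "(\<sigma> * (1 + l) - real n) / real n < v / real n" using n0 by (intro divide_strict_right_mono) auto
    obtain a where a: "0 \<le> a" "a \<le> l" "a \<le> 0 \<or> real n * a < v" "\<sigma> * (1 + l) < real n + real n * a"
    proof (cases "v = 0")
      case True
      then show ?thesis using that[of 0] l0 \<open>\<sigma> * (1 + l) < real n + v\<close> by simp
    next
      case False
      then have "max 0 ((\<sigma> * (1 + l) - real n) / real n) < v / real n" using d v0 n0 by simp
      then obtain a where a: "max 0 ((\<sigma> * (1 + l) - real n) / real n) < a" "a < v / real n" using dense by blast
      then have na: "real n * a < v" using n0 by (simp add: pos_less_divide_eq mult.commute)
      then have "real n * a \<le> real n * l" using lv by (simp add: v_def)
      then have "a \<le> l" using n0 by simp
      moreover have "\<sigma> * (1 + l) < real n + real n * a"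
        using a(1) n0 by (simp add: pos_divide_less_eq mult.commute)
      ultimately show ?thesis using that[of a] a(1) na by simp
    qed
    have "hcontent m n s' (W_set m n S \<psi>) \<noteq> 0"
      by (rule hcontent_W_lower[OF mn S \<psi> ord a(1,2)]) (use a \<sigma> \<theta>n in \<open>auto simp: v_def \<sigma>_def base_def\<close>)
    moreover have "hcontent m n s' (W_set m n S \<psi>) = 0"
      using that s' base0 by (intro hcontent_eq_0[OF mn, of s]) auto
    ultimately show False by contradiction
  qed
  have "hdim m n (W_set m n S \<psi>) = D"
    unfolding hdim_def
  proof (rule antisym)
    have bdd: "bdd_below ?Z" by (rule bdd_belowI[of _ D]) (rule lower)
    show "Inf ?Z \<le> D"
    proof (rule field_le_epsilon)
      fix e :: real assume "e > 0"
      then show "Inf ?Z \<le> D + e" by (intro cInf_lower[OF _ bdd] upper) simp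
    qed
    show "D \<le> Inf ?Z"
    proof (rule cInf_greatest)
      show "?Z \<noteq> {}" using upper[of "D + 1"] by auto
    qed (rule lower)
  qed
  then show "hdim m n (W_set m n S \<psi>) = real n * (real m - 1) + (real n + conv_exp m S) / (1 + l)"
    by (simp add: D_def \<theta>_def v_def)
qed

end
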